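(* Make $W_{a}$ into a $\mathbb{Z}/2[[X,Y]]$-module with $X$ acting by $T_{3}$ and $Y$ acting by $T_{7}$. Then the action of $\mathbb{Z}/2[[X,Y]]$ on $W_{a}$ is faithful.
   Context: All power series are in $\mathbb{Z}/2[[x]]$. Let $F=\sum_{n\ \mathrm{odd},\,n>0}x^{n^{2}}$, $G=F(x^{5})$, and $D=\sum_{n>0,\ (n,10)=1}x^{n^{2}}$. For $k>0$ with $(k,10)=1$ define $D_{k}$ by $D_{1}=D$, $D_{3}=D^{8}/G$, $D_{7}=D^{2}G$, $D_{9}=D^{4}G$ and $D_{k+10}=G^{2}D_{k}$. $W_{a}$ is the $\mathbb{Z}/2$-span of the $D_{k}$ with $k\equiv 1,3,7,9 \pmod{20}$. For an odd prime $p$, $T_{p}(\sum c_{n}x^{n})=\sum c_{pn}x^{n}+\sum c_{n}x^{pn}$. The commuting operators $T_{3},T_{7}$ map $W_{a}$ into itself and each expresses $T_{3}(D_{k})$, $T_{7}(D_{k})$ as sums of $D_{i}$ with $i<k$, so every element of $W_{a}$ is killed by all monomials $X^{i}Y^{j}$ with $i+j$ large; hence the $\mathbb{Z}/2[X,Y]$-module structure extends to a $\mathbb{Z}/2[[X,Y]]$-module structure. *)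

theory Defs
  imports "HOL-Library.Z2" "HOL-Computational_Algebra.Formal_Power_Series"
    "HOL-Number_Theory.Number_Theory"
begin

definition F :: "bit fps" where
  "F = Abs_fps (\<lambda>m. if (\<exists>n::nat. odd n \<and> m = n^2) then 1 else 0)"

definition G :: "bit fps" where
  "G = Abs_fps (\<lambda>m. if 5 dvd m then fps_nth F (m div 5) else 0)"

definition D :: "bit fps" where
  "D = Abs_fps (\<lambda>m. if (\<exists>n::nat. n > 0 \<and> coprime n 10 \<and> m = n^2) then 1 else 0)"

text \<open>The D_k for k < 10 (only k = 1,3,7,9 are meaningful); D_3 = D^8/G
  uses power series division, which is exact here.\<close>
definition Dbase :: "nat \<Rightarrow> bit fps" where
  "Dbase k = (if k = 1 then D
              else if k = 3 then D ^ 8 div G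
              else if k = 7 then D ^ 2 * G
              else if k = 9 then D ^ 4 * G
              else 0)"

fun Dk :: "nat \<Rightarrow> bit fps" where
  "Dk k = (if k < 10 then Dbase k else G ^ 2 * Dk (k - 10))"

definition Wa :: "bit fps set" where
  "Wa = {f. \<exists>S c. finite S \<and> S \<subseteq> {k. k > 0 \<and> k mod 20 \<in> {1, 3, 7, 9}} \<and>
             f = (\<Sum>k\<in>S. fps_const (c k) * Dk k)}"

definition Tp :: "nat \<Rightarrow> bit fps \<Rightarrow> bit fps" where
  "Tp p f = Abs_fps (\<lambda>n. fps_nth f (p * n) + (if p dvd n then fps_nth f (n div p) else 0))"

text \<open>Action of Z/2[[X,Y]] (rendered as bit fps fps: fps_nth (fps_nth P j) i is the coefficient
  of X^i Y^j) on W_a, X acting by T_3 and Y by T_7.  The sum is over the terms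
  with nonzero T_3^i T_7^j f, which form a finite set (nilpotence).\<close>
definition act :: "bit fps fps \<Rightarrow> bit fps \<Rightarrow> bit fps" where
  "act P f = (\<Sum>(i, j) \<in> {(i, j). (Tp 3 ^^ i) ((Tp 7 ^^ j) f) \<noteq> 0}.
                 fps_const (fps_nth (fps_nth P j) i) * (Tp 3 ^^ i) ((Tp 7 ^^ j) f))"

end

theory Submission
  imports Defs "HOL-Computational_Algebra.Polynomial"
begin

text \<open>
  Put \<open>y = 1 + \<Sum> x^(m^2)\<close> over \<open>m > 0\<close> prime to 5. Counting representations by \<open>a^2 + k b^2\<close> modulo 2
  gives \<open>G y^8 = D^5\<close>, \<open>D^16 = G^3 D + G^4 D^4\<close> and symmetric relations between \<open>G\<close>, \<open>y\<close> and their images under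
  \<open>x \<mapsto> x^p\<close>, \<open>p = 3, 7\<close>. Such a relation is the same thing as a linear recurrence for \<open>T_p\<close>. With
  \<open>e_n\<close> denoting the \<open>n\<close>-th \<open>D_k\<close>, \<open>k \<equiv> 1, 3, 7, 9 (mod 20)\<close>, both operators become recursively defined
  operators on polynomials over the field with two elements, \<open>x^n\<close> standing for \<open>e_n\<close>.

  Give the binary digit \<open>2^k\<close> the weight \<open>2^(k div 2)\<close> and \<open>n\<close> the sum of the weights of its digits. Both operators
  strictly lower the weight, and an induction on the leading binary digit shows that an element of
  weight \<open>d > 0\<close> cannot be mapped to weight below \<open>d - 1\<close> by both. Hence some \<open>T_3^i T_7^j\<close> with \<open>i + j = d\<close> maps it
  to \<open>D\<close>. There are as many exponents of weight at most \<open>e\<close> as monomials \<open>X^i Y^j\<close> with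
  \<open>i + j \<le> e\<close> (interleave the digits of \<open>i\<close> and \<open>j\<close>), so the functionals \<open>f \<mapsto> coeff_1 (T_3^i T_7^j f)\<close>, \<open>i + j \<le> e\<close>,
  take arbitrary values. A nonzero power series with lowest degree \<open>e\<close> therefore acts nontrivially on some \<open>f\<close>
  of weight at most \<open>e\<close>.
\<close>

text \<open>The weight is dictated by the recurrences. With \<open>G^4\<close> acting as
  multiplication by \<open>x^4\<close>, they trade a binary digit \<open>2^K\<close> of the exponent
  for two digits \<open>2^(K-2)\<close>, one inside the argument of the operator and one multiplied
  in front. Giving \<open>2^(K-2)\<close> half the weight of \<open>2^K\<close> makes this trade
  neutral. The second trade occurring for \<open>T_7\<close>, into two digits
  \<open>2^(K-3)\<close>, cannot raise the weight either.

  The linear changes of variables behind the theta identities are multiplications by elements of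
  norm 5, 4, 8 or 2 in imaginary quadratic orders. They yield equations only up to an error series
  that is fixed by a dilation; as its constant term is 0, the error vanishes.

  The obstacle in the induction on the leading digit is the power \<open>x^(2^K)\<close> itself: its
  cofactor is constant, so the induction hypothesis says nothing about it. This case needs a
  separate statement, which cannot be derived from the level just below and is carried along in
  steps of 2.\<close>

subsection \<open>Power series over the field with two elements and theta series\<close>

unbundle fps_syntax

declare add_bit_eq_xor [simp del] mult_bit_eq_and [simp del]

lemma bit_add_self [simp]: "(a::bit) + a = 0"
  by (cases a) (auto simp: add_bit_eq_xor)

lemma bfps_add_self [simp]: "(f::bit fps) + f = 0"
  by (rule fps_ext) (simp only: fps_add_nth fps_zero_nth bit_add_self)

lemma bfps_add_self_left [simp]: "(f::bit fps) + (f + g) = g"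
  by (simp add: add.assoc[symmetric])

lemma bfps_two_mult [simp]: "2 * (f::bit fps) = 0"
  by (simp only: mult_2 bfps_add_self)

lemma bfps_eq_iff: "(f::bit fps) = g \<longleftrightarrow> f + g = 0"
  by (metis bfps_add_self bfps_add_self_left add.right_neutral)

text \<open>Off the fixed points of \<open>i\<close> the terms come in pairs of equal value, which
  cancel modulo 2.\<close>

lemma bit_sum_involution:
  fixes h :: "'a \<Rightarrow> bit"
  assumes "finite S" "\<And>x. x \<in> S \<Longrightarrow> i x \<in> S" "\<And>x. x \<in> S \<Longrightarrow> i (i x) = x"
    "\<And>x. x \<in> S \<Longrightarrow> h (i x) = h x"
  shows "sum h S = sum h {x\<in>S. i x = x}"
  using assms
proof (induction "card S" arbitrary: S rule: less_induct)
  case less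
  show ?case
  proof (cases "\<exists>x\<in>S. i x \<noteq> x")
    case False
    hence "{x\<in>S. i x = x} = S" by auto
    thus ?thesis by simp
  next
    case True
    then obtain x where x: "x \<in> S" "i x \<noteq> x" by auto
    let ?S' = "S - {x, i x}"
    have S: "S = insert x (insert (i x) ?S')" using x less.prems by auto
    have "sum h S = h x + (h (i x) + sum h ?S')"
      using x less.prems(1) by (subst S) (simp add: sum.insert_if)
    also have "\<dots> = sum h ?S'"
      using less.prems(4)[OF x(1)] by (simp add: add.assoc[symmetric])
    also have "\<dots> = sum h {z\<in>?S'. i z = z}"
    proof (rule less.hyps)
      show "card ?S' < card S" using x less.prems(1) by (intro psubset_card_mono) auto
      show "i z \<in> ?S'" if "z \<in> ?S'" for z
        using that less.prems(2,3) x by (metis Diff_iff insert_iff empty_iff)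
    qed (use less.prems in auto)
    also have "{z\<in>?S'. i z = z} = {z\<in>S. i z = z}"
      using x less.prems(3) by auto
    finally show ?thesis .
  qed
qed

abbreviation dil :: "nat \<Rightarrow> bit fps \<Rightarrow> bit fps" where
  "dil k f \<equiv> fps_compose f (fps_X ^ k)"

lemma dil_nth: "k > 0 \<Longrightarrow> dil k f $ n = (if k dvd n then f $ (n div k) else 0)"
proof -
  assume k: "k > 0"
  have "dil k f $ n = (\<Sum>i=0..n. if n = k * i then f $ i else 0)"
    unfolding fps_compose_nth by (intro sum.cong) (auto simp: power_mult[symmetric])
  also have "\<dots> = (\<Sum>i\<in>{i\<in>{0..n}. n = k * i}. f $ i)"
    by (simp add: sum.If_cases Int_def)
  also have "{i\<in>{0..n}. n = k * i} = (if k dvd n then {n div k} else {})"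
    using k by (auto simp: dvd_def)
  finally show ?thesis by simp
qed

lemma dil_mult: "k > 0 \<Longrightarrow> dil k (f * g) = dil k f * dil k g"
  by (intro fps_compose_mult_distrib) (simp add: zero_power)

lemma dil_power: "k > 0 \<Longrightarrow> dil k (f ^ n) = dil k f ^ n"
  by (induction n) (simp_all add: dil_mult)

lemma dil_add: "dil k (f + g) = dil k f + dil k g"
  by (rule fps_compose_add_distrib)

lemma dil_dil: "j > 0 \<Longrightarrow> k > 0 \<Longrightarrow> dil j (dil k f) = dil (j * k) f"
  by (rule fps_ext) (auto simp: dil_nth div_mult2_eq dvd_mult_imp_div mult.commute
      dest: dvd_mult_left dvd_mult_right)

text \<open>Frobenius: exchanging the two factors pairs off the terms of the convolution, only the
  diagonal remains, and \<open>a * a = a\<close> for coefficients. Powers 2, 4, 8 thus become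
  dilations.\<close>

lemma bfps_square: "(f::bit fps)\<^sup>2 = dil 2 f"
proof (rule fps_ext)
  fix n
  have "f\<^sup>2 $ n = (\<Sum>i=0..n. f $ i * f $ (n - i))"
    by (simp add: power2_eq_square fps_mult_nth)
  also have "\<dots> = (\<Sum>i\<in>{i\<in>{0..n}. n - i = i}. f $ i * f $ (n - i))"
    by (rule bit_sum_involution) (auto simp: mult.commute)
  also have "\<dots> = (if even n then f $ (n div 2) else 0)"
  proof (cases "even n")
    case True
    hence "{i\<in>{0..n}. n - i = i} = {n div 2}" by auto
    with True show ?thesis by (cases "f $ (n div 2)") (auto elim!: evenE)
  next
    case False
    hence "{i\<in>{0..n}. n - i = i} = {}" by (auto, presburger)
    with False show ?thesis by (simp only: sum.empty if_False)
  qed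
  finally show "f\<^sup>2 $ n = dil 2 f $ n" by (simp add: dil_nth)
qed

lemma bfps_power4: "(f::bit fps) ^ 4 = dil 4 f"
proof -
  have "f ^ 4 = (f\<^sup>2)\<^sup>2" by (simp flip: power_mult)
  also have "\<dots> = dil 2 (dil 2 f)"
    unfolding bfps_square[of "f\<^sup>2"] unfolding bfps_square[of f] ..
  finally show ?thesis by (simp add: dil_dil)
qed

lemma bfps_power8: "(f::bit fps) ^ 8 = dil 8 f"
proof -
  have "f ^ 8 = (f ^ 4)\<^sup>2" by (simp flip: power_mult)
  also have "\<dots> = dil 2 (dil 4 f)"
    unfolding bfps_square[of "f ^ 4"] unfolding bfps_power4[of f] ..
  finally show ?thesis by (simp add: dil_dil)
qed

lemma bfps_add_square: "((f::bit fps) + g)\<^sup>2 = f\<^sup>2 + g\<^sup>2"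
  by (simp add: power2_sum)

lemma bfps_add_power4: "((f::bit fps) + g) ^ 4 = f ^ 4 + g ^ 4"
  using bfps_power4[of "f + g"] bfps_power4[of f] bfps_power4[of g] by (simp add: dil_add)

lemma bfps_add_power8: "((f::bit fps) + g) ^ 8 = f ^ 8 + g ^ 8"
  using bfps_power8[of "f + g"] bfps_power8[of f] bfps_power8[of g] by (simp add: dil_add)

text \<open>A coefficient at \<open>n > 0\<close> is 0 or equals the one at
  \<open>n div k < n\<close>. The theta identities arrive as equations \<open>dil k v = v\<close>
  for an error series \<open>v\<close>, and this removes \<open>v\<close>.\<close>

lemma dil_fixpoint:
  assumes "k > 1" "dil k f = f" "f $ 0 = 0"
  shows "f = 0"
proof (rule fps_ext)
  fix n show "f $ n = (0::bit fps) $ n"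
  proof (induction n rule: less_induct)
    case (less n)
    show ?case
    proof (cases "n = 0")
      case False
      have "f $ n = dil k f $ n" using assms by simp
      also have "\<dots> = 0" using less[of "n div k"] False assms(1) by (simp add: dil_nth)
      finally show ?thesis by simp
    qed (use assms in auto)
  qed
qed

definition rep :: "nat \<Rightarrow> nat \<Rightarrow> (nat \<times> nat) set" where
  "rep k N = {(a, b). a\<^sup>2 + k * b\<^sup>2 = N}"

text \<open>A weighted theta series of \<open>a^2 + k b^2\<close>. The pairs are natural numbers
  because \<open>sqs\<close> records each square once.\<close>

definition theta :: "nat \<Rightarrow> (nat \<Rightarrow> nat \<Rightarrow> bit) \<Rightarrow> bit fps" where
  "theta k h = Abs_fps (\<lambda>N. \<Sum>(a, b)\<in>rep k N. h a b)"

definition sqs :: "nat set \<Rightarrow> bit fps" where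
  "sqs A = Abs_fps (\<lambda>n. of_bool (\<exists>a\<in>A. n = a\<^sup>2))"

lemma finite_rep [simp]: "k > 0 \<Longrightarrow> finite (rep k N)"
proof (rule finite_subset[of _ "{..N} \<times> {..N}"])
  assume k: "k > 0"
  have "a \<le> a\<^sup>2 + k * b\<^sup>2 \<and> b \<le> a\<^sup>2 + k * b\<^sup>2" for a b
  proof -
    have "a \<le> a\<^sup>2" "b \<le> b\<^sup>2" "b\<^sup>2 \<le> k * b\<^sup>2" using k by (simp_all add: power2_eq_square)
    thus ?thesis by linarith
  qed
  thus "rep k N \<subseteq> {..N} \<times> {..N}" unfolding rep_def by auto
qed simp

lemma theta_add: "theta k (\<lambda>a b. g a b + h a b) = theta k g + theta k h"
  by (rule fps_ext) (simp add: theta_def split_beta sum.distrib)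

text \<open>A square determines its natural root, so the convolution counts the pairs
  \<open>(a, b)\<close> themselves.\<close>

lemma sqs_mult_dil:
  assumes k: "k > 0"
  shows "sqs A * dil k (sqs B) = theta k (\<lambda>a b. of_bool (a \<in> A \<and> b \<in> B))"
proof (rule fps_ext)
  fix N
  let ?f = "\<lambda>(a, b). a\<^sup>2 :: nat"
  let ?S = "{(a, b) \<in> rep k N. a \<in> A \<and> b \<in> B}"
  have inj: "inj_on ?f ?S"
    using k by (auto simp: inj_on_def rep_def)
  have im: "?f ` ?S = {i\<in>{0..N}. (\<exists>a\<in>A. i = a\<^sup>2) \<and> (\<exists>b\<in>B. N - i = k * b\<^sup>2)}" (is "_ = ?R")
  proof (intro equalityI subsetI)
    fix i assume "i \<in> ?R"
    then obtain a b where "i \<le> N" "a \<in> A" "i = a\<^sup>2" "b \<in> B" "N - i = k * b\<^sup>2" by auto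
    hence "(a, b) \<in> ?S" "i = ?f (a, b)" by (auto simp: rep_def)
    thus "i \<in> ?f ` ?S" by blast
  qed (auto simp: rep_def)
  have d: "dil k (sqs B) $ j = of_bool (\<exists>b\<in>B. j = k * b\<^sup>2)" for j
    using k by (auto simp: dil_nth sqs_def of_bool_def)
  have "(sqs A * dil k (sqs B)) $ N
      = (\<Sum>i=0..N. of_bool ((\<exists>a\<in>A. i = a\<^sup>2) \<and> (\<exists>b\<in>B. N - i = k * b\<^sup>2)))"
    unfolding fps_mult_nth d by (intro sum.cong) (auto simp: sqs_def)
  also have "\<dots> = of_nat (card ?R)"
    by (simp add: of_bool_def sum.If_cases Int_def)
  also have "card ?R = card ?S"
    unfolding im[symmetric] by (rule card_image[OF inj])
  also have "of_nat (card ?S) = (\<Sum>(a, b)\<in>rep k N. of_bool (a \<in> A \<and> b \<in> B) :: bit)"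
    using k by (simp add: of_bool_def sum.If_cases Int_def case_prod_unfold)
  finally show "(sqs A * dil k (sqs B)) $ N = theta k (\<lambda>a b. of_bool (a \<in> A \<and> b \<in> B)) $ N"
    by (simp add: theta_def)
qed

text \<open>Integer solutions, because the linear substitutions below do not preserve signs;
  \<open>fold_sign\<close> brings the counts back to natural pairs.\<close>

definition srep :: "nat \<Rightarrow> (int \<Rightarrow> int \<Rightarrow> bool) \<Rightarrow> nat \<Rightarrow> (int \<times> int) set" where
  "srep k P N = {(a, b). P a b \<and> a\<^sup>2 + int k * b\<^sup>2 = int N}"

text \<open>For \<open>P\<close> invariant under negation, half the number of representations by integers of absolute values \<open>a\<close>, \<open>b\<close> satisfying \<open>P\<close>.\<close>
definition fold_sign :: "(int \<Rightarrow> int \<Rightarrow> bool) \<Rightarrow> nat \<Rightarrow> nat \<Rightarrow> nat" where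
  "fold_sign P a b = (if a = 0 \<or> b = 0 then of_bool (P (int a) (int b))
     else of_bool (P (int a) (int b)) + of_bool (P (int a) (- int b)))"

text \<open>The solutions lie over their pairs of absolute values. Each fibre is a union of orbits
  of negation, and as the origin is excluded every orbit has two elements.\<close>

lemma card_srep:
  assumes k: "k > 0" and sym: "\<And>a b. P (- a) (- b) = P a b" and zero: "\<not> P 0 0"
  shows "card (srep k P N) = 2 * (\<Sum>(a, b)\<in>rep k N. fold_sign P a b)"
proof -
  define fib where "fib = (\<lambda>(a::nat, b::nat). {(x, y). P x y \<and> \<bar>x\<bar> = int a \<and> \<bar>y\<bar> = int b})"
  have fib_eq: "fib (a, b) = (if P (int a) (int b) then {(int a, int b), (- int a, - int b)} else {})
      \<union> (if P (int a) (- int b) then {(int a, - int b), (- int a, int b)} else {})" for a b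
  proof -
    have abs_eq: "\<bar>x\<bar> = int c \<longleftrightarrow> x = int c \<or> x = - int c" for x c by arith
    have "P (- int a) (- int b) = P (int a) (int b)" "P (- int a) (int b) = P (int a) (- int b)"
      using sym[of "int a" "int b"] sym[of "int a" "- int b"] by simp_all
    thus ?thesis unfolding fib_def abs_eq by auto
  qed
  have card_fib: "card (fib (a, b)) = 2 * fold_sign P a b" for a b
    unfolding fib_eq fold_sign_def
    using zero sym[of 0 "int b"] by (auto simp: card_insert_if)
  have "srep k P N = (\<Union>t\<in>rep k N. fib t)"
  proof (intro equalityI subsetI)
    fix z assume z: "z \<in> srep k P N"
    obtain x y where xy: "z = (x, y)" by force
    have "(nat \<bar>x\<bar>)\<^sup>2 + k * (nat \<bar>y\<bar>)\<^sup>2 = N"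
    proof -
      have "int ((nat \<bar>x\<bar>)\<^sup>2 + k * (nat \<bar>y\<bar>)\<^sup>2) = int N"
        using z xy by (simp add: srep_def)
      thus ?thesis by (simp only: of_nat_eq_iff)
    qed
    hence "(nat \<bar>x\<bar>, nat \<bar>y\<bar>) \<in> rep k N" by (simp add: rep_def)
    moreover have "z \<in> fib (nat \<bar>x\<bar>, nat \<bar>y\<bar>)" using z xy by (simp add: fib_def srep_def)
    ultimately show "z \<in> (\<Union>t\<in>rep k N. fib t)" by blast
  next
    fix z assume "z \<in> (\<Union>t\<in>rep k N. fib t)"
    then obtain a b x y where *: "(a, b) \<in> rep k N" "z = (x, y)" "P x y" "\<bar>x\<bar> = int a" "\<bar>y\<bar> = int b"
      by (auto simp: fib_def)
    have "x\<^sup>2 + int k * y\<^sup>2 = (int a)\<^sup>2 + int k * (int b)\<^sup>2"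
      using *(4,5) by (metis power2_abs)
    also have "\<dots> = int (a\<^sup>2 + k * b\<^sup>2)" by simp
    also have "\<dots> = int N" using *(1) by (simp only: rep_def mem_Collect_eq prod.case)
    finally show "z \<in> srep k P N" using * by (simp add: srep_def rep_def)
  qed
  also have "card \<dots> = (\<Sum>t\<in>rep k N. card (fib t))"
  proof (intro card_UN_disjoint ballI impI)
    show "finite (rep k N)" using k by simp
    show "finite (fib t)" for t by (cases t) (simp add: fib_eq)
    show "fib t \<inter> fib t' = {}" if "t \<noteq> t'" for t t'
      using that by (auto simp: fib_def split: prod.splits)
  qed
  also have "\<dots> = (\<Sum>t\<in>rep k N. 2 * (case t of (a, b) \<Rightarrow> fold_sign P a b))"
    by (intro sum.cong) (auto simp: card_fib)
  finally show ?thesis by (simp add: sum_distrib_left)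
qed

lemma theta_fold_nth:
  assumes "k > 0" "\<And>a b. P (- a) (- b) = P a b" "\<not> P 0 0"
  shows "theta k (\<lambda>a b. of_nat (fold_sign P a b)) $ N = of_nat (card (srep k P N) div 2)"
proof -
  have "card (srep k P N) = 2 * (\<Sum>(a, b)\<in>rep k N. fold_sign P a b)"
    by (rule card_srep) (use assms in auto)
  thus ?thesis by (simp add: theta_def split_beta)
qed

subsection \<open>Series supported on squares\<close>

lemma sqs_nth: "sqs A $ n = of_bool (\<exists>a\<in>A. n = a\<^sup>2)"
  by (simp add: sqs_def)

lemma sqs_Un: "A \<inter> B = {} \<Longrightarrow> sqs (A \<union> B) = sqs A + sqs B"
  by (rule fps_ext) (auto simp: sqs_nth of_bool_def)

lemma sqs_dil: "k > 0 \<Longrightarrow> dil (k\<^sup>2) (sqs A) = sqs ((*) k ` A)"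
proof (rule fps_ext)
  fix n assume k: "k > 0"
  have "(k\<^sup>2 dvd n \<and> (\<exists>a\<in>A. n div k\<^sup>2 = a\<^sup>2)) \<longleftrightarrow> (\<exists>a\<in>A. n = (k * a)\<^sup>2)"
    using k by (auto simp: power_mult_distrib)
  thus "dil (k\<^sup>2) (sqs A) $ n = sqs ((*) k ` A) $ n"
    using k by (auto simp: sqs_nth dil_nth of_bool_def)
qed

definition zz where "zz = sqs {m. m > 0}"
definition ww where "ww = sqs {m. \<not> 5 dvd m}"
definition w1 where "w1 = sqs {m. m mod 5 = 1 \<or> m mod 5 = 4}"
definition w2 where "w2 = sqs {m. m mod 5 = 2 \<or> m mod 5 = 3}"
definition yy where "yy = sqs {m. m = 0 \<or> \<not> 5 dvd m}"

lemma yy_eq: "yy = 1 + ww"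
proof -
  have "{m::nat. m = 0 \<or> \<not> 5 dvd m} = {0} \<union> {m. \<not> 5 dvd m}" by auto
  hence "yy = sqs {0} + ww" unfolding yy_def ww_def by (simp only:) (rule sqs_Un, auto)
  also have "sqs {0} = 1" by (rule fps_ext) (simp add: sqs_nth)
  finally show ?thesis .
qed

lemma ww_eq: "ww = w1 + w2"
proof -
  have "\<not> 5 dvd m \<longleftrightarrow> (m mod 5 = 1 \<or> m mod 5 = 4) \<or> (m mod 5 = 2 \<or> m mod 5 = 3)" for m :: nat
    by presburger
  hence "{m::nat. \<not> 5 dvd m} = {m. m mod 5 = 1 \<or> m mod 5 = 4} \<union> {m. m mod 5 = 2 \<or> m mod 5 = 3}"
    by blast
  thus ?thesis unfolding ww_def w1_def w2_def
    using sqs_Un[of "{m. m mod 5 = 1 \<or> m mod 5 = 4}" "{m. m mod 5 = 2 \<or> m mod 5 = 3}"] by force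
qed

text \<open>Even members contribute squares \<open>4 b^2\<close>, and dilation by 4 is the fourth
  power.\<close>

lemma sqs_even_odd:
  assumes "\<And>m. 2 * m \<in> A \<longleftrightarrow> m \<in> B"
  shows "sqs A = sqs {m\<in>A. odd m} + sqs B ^ 4"
proof -
  have "{m\<in>A. even m} = (*) 2 ` B" using assms by (auto elim!: evenE)
  moreover have "sqs A = sqs {m\<in>A. odd m} + sqs {m\<in>A. even m}"
  proof -
    have "{m\<in>A. odd m} \<union> {m\<in>A. even m} = A" by auto
    thus ?thesis using sqs_Un[of "{m\<in>A. odd m}" "{m\<in>A. even m}"] by auto
  qed
  ultimately show ?thesis using sqs_dil[of 2 B] by (simp add: bfps_power4[of "sqs B"])
qed

lemma D_sqs: "D = sqs {m. \<not> 5 dvd m \<and> odd m}"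
proof -
  have "coprime n 10 \<longleftrightarrow> \<not> 5 dvd n \<and> odd n" for n :: nat
  proof -
    have "coprime n 10 \<longleftrightarrow> coprime n 2 \<and> coprime n 5"
      using coprime_mult_right_iff[of n 2 5] by simp
    moreover have "coprime n 5 \<longleftrightarrow> \<not> 5 dvd n"
    proof
      assume "coprime n 5" thus "\<not> 5 dvd n" using coprime_common_divisor[of n 5 5] by auto
    next
      assume "\<not> 5 dvd n" thus "coprime n 5"
        using prime_imp_coprime[of 5 n] by (simp add: coprime_commute)
    qed
    ultimately show ?thesis by (simp only: coprime_right_2_iff_odd) blast
  qed
  hence "(n > 0 \<and> coprime n 10) \<longleftrightarrow> (\<not> 5 dvd n \<and> odd n)" for n :: nat
    by (cases "n = 0") auto
  hence "(\<exists>n::nat. n > 0 \<and> coprime n 10 \<and> m = n\<^sup>2) \<longleftrightarrow> (\<exists>n\<in>{n. \<not> 5 dvd n \<and> odd n}. m = n\<^sup>2)" for m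
    by blast
  thus ?thesis unfolding D_def sqs_def of_bool_def by (simp only:)
qed

lemma five_dvd_double: "5 dvd 2 * m \<longleftrightarrow> 5 dvd (m::nat)"
  by presburger

lemma D_ww: "D = ww + ww ^ 4"
proof -
  have "{m \<in> {m::nat. \<not> 5 dvd m}. odd m} = {m. \<not> 5 dvd m \<and> odd m}" by auto
  hence "ww = D + ww ^ 4"
    unfolding ww_def D_sqs
    using sqs_even_odd[of "{m. \<not> 5 dvd m}" "{m. \<not> 5 dvd m}"]
    by (simp only: mem_Collect_eq five_dvd_double simp_thms)
  hence "ww + ww ^ 4 = D + ww ^ 4 + ww ^ 4" by simp
  thus ?thesis by (simp only: add.assoc bfps_add_self add_0_right)
qed

lemma ww_zz: "ww = zz + dil 25 zz"
proof -
  have "{m::nat. m > 0} = {m. \<not> 5 dvd m} \<union> (*) 5 ` {m. m > 0}" (is "?A = ?B \<union> ?C")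
    by (auto elim!: dvdE intro!: gr0I)
  moreover have "?B \<inter> ?C = {}" by auto
  ultimately have "zz = ww + dil (5\<^sup>2) zz"
    unfolding zz_def ww_def by (metis sqs_Un sqs_dil zero_less_numeral)
  hence "zz + dil 25 zz = ww + dil 25 zz + dil 25 zz" by simp
  thus ?thesis by (simp only: add.assoc bfps_add_self add_0_right)
qed

lemma F_zz: "F = zz + zz ^ 4"
proof -
  have "{m \<in> {m::nat. m > 0}. odd m} = {m. odd m}" by (auto intro!: gr0I)
  moreover have "F = sqs {m. odd m}"
    unfolding F_def sqs_def of_bool_def by simp
  moreover have "2 * m \<in> {m. m > 0} \<longleftrightarrow> m \<in> {m. m > 0}" for m :: nat by simp
  ultimately have "zz = F + zz ^ 4"
    unfolding zz_def using sqs_even_odd[of "{m. m > 0}" "{m. m > 0}"] by simp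
  hence "zz + zz ^ 4 = F + zz ^ 4 + zz ^ 4" by simp
  thus ?thesis by (simp only: add.assoc bfps_add_self add_0_right)
qed

lemma G_dil: "G = dil 5 F"
  by (rule fps_ext) (simp add: G_def dil_nth)

section \<open>The form \<open>a^2 + b^2\<close> at the prime 5\<close>

lemma mod5_cases:
  "r < (5::nat) \<Longrightarrow> r = 0 \<or> r = 1 \<or> r = 2 \<or> r = 3 \<or> r = 4"
  by linarith

text \<open>The two flags of \<open>h\<close> mark vanishing arguments, which residues cannot see:
  on the axes \<open>(a, b)\<close> and \<open>(a, -b)\<close> agree up to negation and count once.
  What remains is a finite check.\<close>

lemma fold_sign_mod5:
  assumes "\<And>a b. P a b \<longleftrightarrow> C (a mod 5) (b mod 5)"
    and "\<And>z z' r s. r < 5 \<Longrightarrow> s < 5 \<Longrightarrow> (z \<longrightarrow> r = 0) \<Longrightarrow> (z' \<longrightarrow> s = 0) \<Longrightarrow>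
      of_bool (C (int r) (int s)) + (if z \<or> z' then 0 else of_bool (C (int r) (- int s mod 5)))
       = (h z z' r s :: bit)"
  shows "of_nat (fold_sign P a b) = h (a = 0) (b = 0) (a mod 5) (b mod 5)"
proof -
  have "of_nat (fold_sign P a b) = (of_bool (C (int (a mod 5)) (int (b mod 5))) +
     (if a = 0 \<or> b = 0 then 0 else of_bool (C (int (a mod 5)) (- int (b mod 5) mod 5))) :: bit)"
    by (simp add: fold_sign_def assms(1) zmod_int mod_minus_eq)
  also have "\<dots> = h (a = 0) (b = 0) (a mod 5) (b mod 5)"
    by (rule assms(2)) auto
  finally show ?thesis .
qed

text \<open>For \<open>a\<close> = +-1 and \<open>b\<close> = +-2 modulo 5 exactly one sign of
  \<open>b\<close> gives \<open>b = 2 a\<close> modulo 5, so \<open>P1\<close> selects each such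
  pair once up to negation.\<close>

definition P1 :: "int \<Rightarrow> int \<Rightarrow> bool" where
  "P1 n m \<longleftrightarrow> n mod 5 \<in> {1, 4} \<and> (m mod 5 - 2 * (n mod 5)) mod 5 = 0"

lemma fold_P1: "of_nat (fold_sign P1 a b) =
    (of_bool (a mod 5 \<in> {1, 4} \<and> b mod 5 \<in> {2, 3}) :: bit)"
proof (rule fold_sign_mod5[where h = "\<lambda>_ _ r s. of_bool (r \<in> {1, 4} \<and> s \<in> {2, 3})"])
  show "P1 a b \<longleftrightarrow> (\<lambda>n m. n \<in> {1, 4} \<and> (m - 2 * n) mod 5 = 0) (a mod 5) (b mod 5)" for a b
    by (simp add: P1_def)
qed (drule mod5_cases, drule mod5_cases, (elim disjE; simp))

text \<open>\<open>P1\<close> transported back through multiplication by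
  \<open>1 + 2i\<close>.\<close>

definition P2 :: "int \<Rightarrow> int \<Rightarrow> bool" where
  "P2 a b \<longleftrightarrow> (a mod 5 - 2 * (b mod 5)) mod 5 \<in> {1, 4}"

lemma fold_P2: "of_nat (fold_sign P2 a b) =
   (of_bool (a mod 5 \<in> {2, 3} \<and> b mod 5 \<in> {1, 4}) + of_bool (a mod 5 \<in> {1, 4} \<and> b mod 5 \<in> {1, 4})
    + of_bool (a mod 5 \<in> {2, 3} \<and> b mod 5 \<in> {2, 3})
    + of_bool (a mod 5 \<in> {1, 4} \<and> b = 0) + of_bool (a = 0 \<and> b mod 5 \<in> {2, 3}) :: bit)"
proof (rule fold_sign_mod5[where h = "\<lambda>z z' r s. of_bool (r \<in> {2, 3} \<and> s \<in> {1, 4}) +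
     of_bool (r \<in> {1, 4} \<and> s \<in> {1, 4}) + of_bool (r \<in> {2, 3} \<and> s \<in> {2, 3})
    + of_bool (r \<in> {1, 4} \<and> z') + of_bool (z \<and> s \<in> {2, 3})"])
  show "P2 a b \<longleftrightarrow> (\<lambda>a b. (a - 2 * b) mod 5 \<in> {1, 4}) (a mod 5) (b mod 5)" for a b
    by (simp add: P2_def)
qed (drule mod5_cases, drule mod5_cases, (elim disjE; simp))

lemma P1_iff: "P1 n m \<longleftrightarrow> (n mod 5 = 1 \<or> n mod 5 = 4) \<and> 5 dvd m - 2 * n"
proof -
  have "(m mod 5 - 2 * (n mod 5)) mod 5 = (m - 2 * n) mod 5"
    by (intro mod_diff_cong) (simp_all add: mod_mult_right_eq)
  thus ?thesis unfolding P1_def by (simp only: dvd_eq_mod_eq_0 insert_iff empty_iff simp_thms)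
qed

lemma P2_iff: "P2 a b \<longleftrightarrow> (a - 2 * b) mod 5 = 1 \<or> (a - 2 * b) mod 5 = 4"
proof -
  have "(a mod 5 - 2 * (b mod 5)) mod 5 = (a - 2 * b) mod 5"
    by (intro mod_diff_cong) (simp_all add: mod_mult_right_eq)
  thus ?thesis unfolding P2_def by simp
qed

lemma P1_dvd: "P1 n m \<Longrightarrow> 5 dvd m - 2 * n"
  by (simp add: P1_iff)

text \<open>Multiplication by the Gaussian integer \<open>1 + 2i\<close> of norm 5; the congruence
  in \<open>P1\<close> expresses divisibility of \<open>n + m i\<close> by it.\<close>

lemma card_srep_P1: "card (srep 1 P1 (5 * N)) = card (srep 1 P2 N)"
proof -
  have "bij_betw (\<lambda>(a, b). (a - 2 * b, 2 * a + b)) (srep 1 P2 N) (srep 1 P1 (5 * N))"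
  proof (rule bij_betw_byWitness[where f' = "\<lambda>(n, m). ((n + 2 * m) div 5, (m - 2 * n) div 5)"])
    show "(\<lambda>(a, b). (a - 2 * b, 2 * a + b)) ` srep 1 P2 N \<subseteq> srep 1 P1 (5 * N)"
    proof (rule image_subsetI, simp only: split_paired_all split_conv)
      fix a b assume "(a, b) \<in> srep 1 P2 N"
      hence P: "P2 a b" and q: "a\<^sup>2 + b\<^sup>2 = int N" by (auto simp: srep_def)
      have "(a - 2 * b)\<^sup>2 + (2 * a + b)\<^sup>2 = 5 * (a\<^sup>2 + b\<^sup>2)"
        by (simp add: power2_eq_square algebra_simps)
      moreover have "P1 (a - 2 * b) (2 * a + b)" using P by (simp add: P1_iff P2_iff)
      ultimately show "(a - 2 * b, 2 * a + b) \<in> srep 1 P1 (5 * N)" using q by (simp add: srep_def)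
    qed
    show "(\<lambda>(n, m). ((n + 2 * m) div 5, (m - 2 * n) div 5)) ` srep 1 P1 (5 * N) \<subseteq> srep 1 P2 N"
    proof (rule image_subsetI, simp only: split_paired_all split_conv)
      fix n m assume "(n, m) \<in> srep 1 P1 (5 * N)"
      hence P: "P1 n m" and q: "n\<^sup>2 + m\<^sup>2 = 5 * int N" by (auto simp: srep_def)
      have "5 dvd m - 2 * n" using P by (rule P1_dvd)
      then obtain b where m: "m = 2 * n + 5 * b" by (metis dvdE diff_eq_eq add.commute)
      have div: "(n + 2 * m) div 5 = n + 2 * b" "(m - 2 * n) div 5 = b" using m by simp_all
      have "n\<^sup>2 + m\<^sup>2 = 5 * ((n + 2 * b)\<^sup>2 + b\<^sup>2)" unfolding m by (simp add: power2_eq_square algebra_simps)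
      hence "(n + 2 * b)\<^sup>2 + b\<^sup>2 = int N" using q by simp
      moreover have "P2 (n + 2 * b) b" using P by (simp add: P1_iff P2_iff)
      ultimately show "((n + 2 * m) div 5, (m - 2 * n) div 5) \<in> srep 1 P2 N"
        unfolding div by (simp add: srep_def)
    qed
    show "\<forall>z\<in>srep 1 P2 N. (\<lambda>(n, m). ((n + 2 * m) div 5, (m - 2 * n) div 5))
        ((\<lambda>(a, b). (a - 2 * b, 2 * a + b)) z) = z" by auto
    show "\<forall>z\<in>srep 1 P1 (5 * N). (\<lambda>(a, b). (a - 2 * b, 2 * a + b))
        ((\<lambda>(n, m). ((n + 2 * m) div 5, (m - 2 * n) div 5)) z) = z"
    proof (rule ballI, simp only: split_paired_all split_conv)
      fix n m assume "(n, m) \<in> srep 1 P1 (5 * N)"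
      hence "5 dvd m - 2 * n" using P1_dvd by (simp add: srep_def)
      then obtain b where m: "m = 2 * n + 5 * b" by (metis dvdE diff_eq_eq add.commute)
      thus "((n + 2 * m) div 5 - 2 * ((m - 2 * n) div 5), 2 * ((n + 2 * m) div 5) + (m - 2 * n) div 5) = (n, m)"
        by simp
    qed
  qed
  thus ?thesis by (simp add: bij_betw_same_card)
qed

lemma srep_P1_empty: "\<not> 5 dvd M \<Longrightarrow> srep 1 P1 M = {}"
proof (rule ccontr)
  assume M: "\<not> 5 dvd M" and "srep 1 P1 M \<noteq> {}"
  then obtain n m where P: "P1 n m" and q: "n\<^sup>2 + m\<^sup>2 = int M" by (auto simp: srep_def)
  have "5 dvd m - 2 * n" using P by (rule P1_dvd)
  then obtain b where m: "m = 2 * n + 5 * b" by (metis dvdE diff_eq_eq add.commute)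
  have "n\<^sup>2 + m\<^sup>2 = 5 * ((n + 2 * b)\<^sup>2 + b\<^sup>2)" unfolding m by (simp add: power2_eq_square algebra_simps)
  hence "int 5 dvd int M" using q by (metis dvd_triv_left of_nat_numeral)
  thus False using M by (simp only: int_dvd_int_iff)
qed

lemma theta_P1: "theta 1 (\<lambda>a b. of_nat (fold_sign P1 a b)) = dil 5 (theta 1 (\<lambda>a b. of_nat (fold_sign P2 a b)))"
proof (rule fps_ext)
  fix n
  have m: "(- x) mod 5 = 1 \<longleftrightarrow> x mod 5 = 4" "(- x) mod 5 = 4 \<longleftrightarrow> x mod 5 = 1" for x :: int
    by presburger+
  have s1: "P1 (- a) (- b) = P1 a b" for a b
    using dvd_minus_iff[of 5 "b - 2 * a"] unfolding P1_iff m by auto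
  have s2: "P2 (- a) (- b) = P2 a b" for a b
    using m[of "a - 2 * b"] unfolding P2_iff by (auto simp: algebra_simps)
  have z: "\<not> P1 0 0" "\<not> P2 0 0" by (simp_all add: P1_def P2_def)
  show "theta 1 (\<lambda>a b. of_nat (fold_sign P1 a b)) $ n
      = dil 5 (theta 1 (\<lambda>a b. of_nat (fold_sign P2 a b))) $ n"
    using theta_fold_nth[of 1 P1 n] theta_fold_nth[of 1 P2 "n div 5"] s1 s2 z
      card_srep_P1[of "n div 5"] srep_P1_empty[of n]
    by (cases "5 dvd n") (simp_all add: dil_nth)
qed

lemma w12_nth0: "w1 $ 0 = 0" "w2 $ 0 = 0" "zz $ 0 = 0" "ww $ 0 = 0"
  by (simp_all add: w1_def w2_def zz_def ww_def sqs_nth)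

lemma theta_P2: "theta 1 (\<lambda>a b. of_nat (fold_sign P2 a b)) = w1 * w2 + ww\<^sup>2 + ww"
proof -
  have d1: "dil 1 f = f" for f by simp
  have one: "sqs {0} = 1" by (rule fps_ext) (simp add: sqs_nth)
  have s: "w1 = sqs {m. m mod 5 \<in> {1, 4}}" "w2 = sqs {m. m mod 5 \<in> {2, 3}}"
    by (simp_all add: w1_def w2_def)
  \<comment> \<open>The factors 1 are the series of the square 0 and account for points on the
    axes.\<close>
  have "theta 1 (\<lambda>a b. of_nat (fold_sign P2 a b)) = w2 * w1 + w1 * w1 + w2 * w2 + w1 * 1 + 1 * w2"
    unfolding fold_P2 theta_add s
    using sqs_mult_dil[of 1 "{m. m mod 5 \<in> {2, 3}}" "{m. m mod 5 \<in> {1, 4}}"]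
      sqs_mult_dil[of 1 "{m. m mod 5 \<in> {1, 4}}" "{m. m mod 5 \<in> {1, 4}}"]
      sqs_mult_dil[of 1 "{m. m mod 5 \<in> {2, 3}}" "{m. m mod 5 \<in> {2, 3}}"]
      sqs_mult_dil[of 1 "{m. m mod 5 \<in> {1, 4}}" "{0}"]
      sqs_mult_dil[of 1 "{0}" "{m. m mod 5 \<in> {2, 3}}"]
    unfolding d1 one mem_Collect_eq singleton_iff by (simp only:)
  also have "\<dots> = w1 * w2 + ww\<^sup>2 + ww"
    by (simp only: ww_eq bfps_add_square) (simp add: power2_eq_square ac_simps)
  finally show ?thesis .
qed

text \<open>Chosen so that \<open>dil 5 BB = BB + dil 5 ww\<close>; then \<open>BB + BB^2\<close>
  solves the functional equation that \<open>theta_P1\<close> gives for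
  \<open>w1 * w2\<close>.\<close>

definition BB where "BB = dil 5 zz + dil 25 zz"

text \<open>Two solutions of that functional equation differ by a series fixed by
  \<open>dil 5\<close>.\<close>

lemma w1_w2: "w1 * w2 = BB + BB\<^sup>2"
proof -
  have t: "theta 1 (\<lambda>a b. of_nat (fold_sign P1 a b)) = w1 * w2"
    unfolding fold_P1 w1_def w2_def
    using sqs_mult_dil[of 1 "{m. m mod 5 \<in> {1, 4}}" "{m. m mod 5 \<in> {2, 3}}"] by simp
  have C: "w1 * w2 = dil 5 (w1 * w2 + ww\<^sup>2 + ww)"
    using theta_P1 unfolding t theta_P2 .
  define v where "v = w1 * w2 + BB + BB\<^sup>2"
  have B: "dil 5 BB = BB + dil 5 ww"
    by (simp add: BB_def ww_zz dil_add dil_dil ac_simps)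
  have "dil 5 v = dil 5 (w1 * w2) + (BB + dil 5 ww) + (BB + dil 5 ww)\<^sup>2"
    unfolding v_def dil_add B by (simp add: dil_power B)
  also have "\<dots> = v + (w1 * w2 + dil 5 (w1 * w2 + ww\<^sup>2 + ww))"
    unfolding v_def bfps_add_square dil_add by (simp add: dil_power ac_simps)
  also have "\<dots> = v" using C by simp
  finally have "dil 5 v = v" .
  moreover have "v $ 0 = 0"
    by (simp add: v_def w12_nth0 BB_def dil_nth power2_eq_square)
  ultimately have "v = 0" using dil_fixpoint[of 5 v] by simp
  thus ?thesis unfolding v_def bfps_eq_iff[of "w1 * w2"] by (simp only: add.assoc)
qed

section \<open>The form \<open>a^2 + 3 b^2\<close> and the relation for \<open>p = 3\<close>\<close>

definition OP :: "(int \<Rightarrow> int \<Rightarrow> bool) \<Rightarrow> int \<Rightarrow> int \<Rightarrow> bool" where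
  "OP Q n m \<longleftrightarrow> odd n \<and> 4 dvd n - m \<and> Q n m"

text \<open>The counterpart of the parity condition in \<open>OP\<close>: both
  \<open>a + 3 b\<close> and \<open>a - 7 b\<close> are odd exactly when \<open>a + b\<close>
  is.\<close>

definition SP :: "(int \<Rightarrow> int \<Rightarrow> bool) \<Rightarrow> int \<Rightarrow> int \<Rightarrow> bool" where
  "SP Q a b \<longleftrightarrow> odd (a + b) \<and> Q a b"

lemma fold_sign_SP: "fold_sign (SP Q) a b = (if odd (a + b) then fold_sign Q a b else 0)"
  by (simp add: fold_sign_def SP_def)

lemma fold_sign_OP:
  "fold_sign (OP Q) a b = (if odd a \<and> odd b then of_bool (Q (int a) (int b)) * of_bool (4 dvd int a - int b)
     + of_bool (Q (int a) (- int b)) * of_bool (4 dvd int a + int b) else 0)"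
proof -
  have "\<not> (odd a \<and> 4 dvd int a - int b)" "\<not> (odd a \<and> 4 dvd int a + int b)" if "even b"
    using that by presburger+
  moreover have "\<not> (odd a \<and> 4 dvd int a)" by presburger
  ultimately show ?thesis unfolding fold_sign_def OP_def by (cases "even b") auto
qed

text \<open>So among the sign choices of an odd pair, up to negation, \<open>OP\<close> keeps
  exactly one.\<close>

lemma one_sign: "odd a \<Longrightarrow> odd b \<Longrightarrow> 4 dvd int a - int b \<longleftrightarrow> \<not> 4 dvd int a + int b"
  by presburger

definition Q0 :: "int \<Rightarrow> int \<Rightarrow> bool" where "Q0 n m \<longleftrightarrow> \<not> 5 dvd n \<and> \<not> 5 dvd m"

lemma fold_O_Q0: "of_nat (fold_sign (OP Q0) a b) =
   (of_bool (a \<in> {m. \<not> 5 dvd m \<and> odd m} \<and> b \<in> {m. \<not> 5 dvd m \<and> odd m}) :: bit)"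
proof -
  have "(5 dvd int n) = (5 dvd n)" for n by presburger
  thus ?thesis using one_sign[of a b] by (simp add: fold_sign_OP Q0_def)
qed

definition MM :: "nat set" where "MM = {m. m = 0 \<or> \<not> 5 dvd m}"

text \<open>The assumption on \<open>C\<close> is a finite check: an odd number of signs is
  admissible exactly when both coordinates belong to \<open>MM\<close> and do not both vanish.
  Oddness of \<open>a + b\<close> then makes one coordinate odd and the other even.\<close>

lemma fold_S_linear:
  assumes "\<And>a b. Q a b \<longleftrightarrow> C (a mod 5) (b mod 5)"
    and "\<And>z z' r s. r < 5 \<Longrightarrow> s < 5 \<Longrightarrow> (z \<longrightarrow> r = 0) \<Longrightarrow> (z' \<longrightarrow> s = 0) \<Longrightarrow>
      of_bool (C (int r) (int s)) + (if z \<or> z' then 0 else of_bool (C (int r) (- int s mod 5)))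
       = (of_bool (\<not> (z \<and> z') \<and> (z \<or> r \<noteq> 0) \<and> (z' \<or> s \<noteq> 0)) :: bit)"
  shows "of_nat (fold_sign (SP Q) a b) =
    (of_bool (a \<in> {m\<in>MM. odd m} \<and> b \<in> {m\<in>MM. even m})
    + of_bool (a \<in> {m\<in>MM. even m} \<and> b \<in> {m\<in>MM. odd m}) :: bit)"
proof -
  have Q: "of_nat (fold_sign Q a b) =
     (of_bool (\<not> (a = 0 \<and> b = 0) \<and> (a = 0 \<or> a mod 5 \<noteq> 0) \<and> (b = 0 \<or> b mod 5 \<noteq> 0)) :: bit)"
    by (rule fold_sign_mod5[where C = C and h = "\<lambda>z z' r s.
          of_bool (\<not> (z \<and> z') \<and> (z \<or> r \<noteq> 0) \<and> (z' \<or> s \<noteq> 0))"]) (rule assms; assumption)+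
  show ?thesis
  proof (cases "odd (a + b)")
    case True
    hence "\<not> (a = 0 \<and> b = 0)" "odd a \<longleftrightarrow> even b" by auto
    thus ?thesis using True Q
      by (simp only: fold_sign_SP MM_def mem_Collect_eq dvd_eq_mod_eq_0[of 5]) auto
  next
    case False
    hence "odd a \<longleftrightarrow> odd b" by auto
    thus ?thesis using False by (simp add: fold_sign_SP)
  qed
qed

definition QQ where "QQ k = D * dil k (yy ^ 4) + yy ^ 4 * dil k D"

lemma theta_QQ:
  assumes "k > 0"
  shows "theta k (\<lambda>a b. of_bool (a \<in> {m\<in>MM. odd m} \<and> b \<in> {m\<in>MM. even m})
    + of_bool (a \<in> {m\<in>MM. even m} \<and> b \<in> {m\<in>MM. odd m})) = QQ k"
proof -
  have "{m\<in>MM. odd m} = {m. \<not> 5 dvd m \<and> odd m}" by (auto simp: MM_def)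
  hence o: "sqs {m\<in>MM. odd m} = D" by (simp only: D_sqs)
  have "{m\<in>MM. even m} = (*) 2 ` MM"
    by (auto simp: MM_def five_dvd_double elim!: evenE)
  hence "sqs {m\<in>MM. even m} = dil (2\<^sup>2) (sqs MM)" by (simp only: sqs_dil zero_less_numeral)
  moreover have "yy = sqs MM" by (simp add: yy_def MM_def)
  ultimately have e: "sqs {m\<in>MM. even m} = yy ^ 4"
    using bfps_power4[of yy] by simp
  show ?thesis unfolding theta_add sqs_mult_dil[OF assms, symmetric] o e QQ_def ..
qed

lemma theta_O_Q0: "k > 0 \<Longrightarrow> theta k (\<lambda>a b. of_nat (fold_sign (OP Q0) a b)) = D * dil k D"
  unfolding fold_O_Q0 D_sqs by (simp only: sqs_mult_dil)

text \<open>After inserting \<open>D = yy + yy^4\<close> the right side collapses to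
  \<open>yy * dil k yy\<close> plus its fourth power. The theta identities thereby concern the
  single unknown \<open>1 + yy * dil k yy\<close>.\<close>

lemma u_QQ:
  assumes "k > 0"
  shows "(1 + yy * dil k yy) + (1 + yy * dil k yy) ^ 4 = QQ k + D * dil k D"
proof -
  have D: "D = yy + yy ^ 4" by (simp add: D_ww yy_eq bfps_add_power4 ac_simps)
  have Y: "dil k D = dil k yy + dil k yy ^ 4" using assms by (simp add: D dil_add dil_power)
  let ?y = yy and ?Y = "dil k yy"
  have "QQ k + D * dil k D = (?y + ?y ^ 4) * ?Y ^ 4 + ?y ^ 4 * (?Y + ?Y ^ 4) + (?y + ?y ^ 4) * (?Y + ?Y ^ 4)"
    unfolding QQ_def Y dil_power[OF assms] by (simp only: D)
  also have "\<dots> = ?y * ?Y + ?y ^ 4 * ?Y ^ 4"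
    by (simp add: distrib_left distrib_right ac_simps)
  also have "\<dots> = (1 + ?y * ?Y) + (1 + (?y * ?Y) ^ 4)"
    by (simp add: power_mult_distrib ac_simps)
  finally show ?thesis unfolding bfps_add_power4 by simp
qed

text \<open>\<open>Q0\<close> pulled back along \<open>n = a + 3 b\<close>,
  \<open>m = a - b\<close>.\<close>

definition R3 :: "int \<Rightarrow> int \<Rightarrow> bool" where
  "R3 a b \<longleftrightarrow> (a mod 5 + 3 * (b mod 5)) mod 5 \<noteq> 0 \<and> (a mod 5 - b mod 5) mod 5 \<noteq> 0"

lemma R3_iff: "R3 a b \<longleftrightarrow> \<not> 5 dvd a + 3 * b \<and> \<not> 5 dvd a - b"
proof -
  have "(a mod 5 + 3 * (b mod 5)) mod 5 = (a + 3 * b) mod 5" "(a mod 5 - b mod 5) mod 5 = (a - b) mod 5"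
    by (intro mod_diff_cong mod_add_cong; simp add: mod_mult_right_eq)+
  thus ?thesis unfolding R3_def by (simp only: dvd_eq_mod_eq_0)
qed

lemma theta_S_R3: "k > 0 \<Longrightarrow> theta k (\<lambda>a b. of_nat (fold_sign (SP R3) a b)) = QQ k"
proof -
  assume k: "k > 0"
  have "of_nat (fold_sign (SP R3) a b) =
    (of_bool (a \<in> {m\<in>MM. odd m} \<and> b \<in> {m\<in>MM. even m})
    + of_bool (a \<in> {m\<in>MM. even m} \<and> b \<in> {m\<in>MM. odd m}) :: bit)" for a b
  proof (rule fold_S_linear[where C = "\<lambda>r s. (r + 3 * s) mod 5 \<noteq> 0 \<and> (r - s) mod 5 \<noteq> 0"])
    show "R3 a b \<longleftrightarrow> (a mod 5 + 3 * (b mod 5)) mod 5 \<noteq> 0 \<and> (a mod 5 - b mod 5) mod 5 \<noteq> 0" for a b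
      by (simp only: R3_def)
  qed (drule mod5_cases, drule mod5_cases, (elim disjE; simp))
  thus ?thesis using theta_QQ[OF k] by simp
qed

text \<open>The substitution multiplies \<open>a - b sqrt(-3)\<close> by
  \<open>1 + sqrt(-3)\<close>, of norm 4. Its image is cut out by \<open>4 dvd n - m\<close>, the
  sign condition in \<open>OP\<close>.\<close>

lemma card_srep_O3: "card (srep 3 (OP Q0) (4 * N)) = card (srep 3 (SP R3) N)"
proof -
  let ?f = "\<lambda>(a, b). (a + 3 * b, a - b)" and ?g = "\<lambda>(n, m). ((n + 3 * m) div 4, (n - m) div 4)"
  have OP_dvd: "\<exists>b. n = m + 4 * b" if "OP Q0 n m" for n m
    using that by (auto simp: OP_def dvd_def algebra_simps)
  have "bij_betw ?f (srep 3 (SP R3) N) (srep 3 (OP Q0) (4 * N))"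
  proof (rule bij_betw_byWitness[where f' = ?g])
    show "?f ` srep 3 (SP R3) N \<subseteq> srep 3 (OP Q0) (4 * N)"
    proof (rule image_subsetI, simp only: split_paired_all split_conv)
      fix a b assume "(a, b) \<in> srep 3 (SP R3) N"
      hence P: "odd (a + b)" "\<not> 5 dvd a + 3 * b" "\<not> 5 dvd a - b" and q: "a\<^sup>2 + 3 * b\<^sup>2 = int N"
        by (auto simp: srep_def SP_def R3_iff)
      have "(a + 3 * b)\<^sup>2 + 3 * (a - b)\<^sup>2 = 4 * (a\<^sup>2 + 3 * b\<^sup>2)"
        by (simp add: power2_eq_square algebra_simps)
      moreover have "(a + 3 * b) - (a - b) = 4 * b" by simp
      hence "4 dvd (a + 3 * b) - (a - b)" by (metis dvd_triv_left)
      hence "OP Q0 (a + 3 * b) (a - b)" using P unfolding OP_def Q0_def by auto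
      ultimately show "(a + 3 * b, a - b) \<in> srep 3 (OP Q0) (4 * N)" using q by (simp add: srep_def)
    qed
    show "?g ` srep 3 (OP Q0) (4 * N) \<subseteq> srep 3 (SP R3) N"
    proof (rule image_subsetI, simp only: split_paired_all split_conv)
      fix n m assume nm: "(n, m) \<in> srep 3 (OP Q0) (4 * N)"
      then obtain b where n: "n = m + 4 * b" using OP_dvd[of n m] by (auto simp: srep_def)
      have P: "odd n" "\<not> 5 dvd n" "\<not> 5 dvd m" and q: "n\<^sup>2 + 3 * m\<^sup>2 = 4 * int N"
        using nm by (auto simp: srep_def OP_def Q0_def)
      have div: "(n + 3 * m) div 4 = m + b" "(n - m) div 4 = b" using n by simp_all
      have "n\<^sup>2 + 3 * m\<^sup>2 = 4 * ((m + b)\<^sup>2 + 3 * b\<^sup>2)"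
        unfolding n by (simp add: power2_eq_square algebra_simps)
      hence "(m + b)\<^sup>2 + 3 * b\<^sup>2 = int N" using q by simp
      moreover have "(m + b) + 3 * b = n" using n by simp
      moreover have "odd (m + b + b)" using P(1) n by simp
      ultimately show "((n + 3 * m) div 4, (n - m) div 4) \<in> srep 3 (SP R3) N"
        unfolding div srep_def SP_def R3_iff using P by simp
    qed
    show "\<forall>z\<in>srep 3 (SP R3) N. ?g (?f z) = z" by auto
    show "\<forall>z\<in>srep 3 (OP Q0) (4 * N). ?f (?g z) = z"
    proof (rule ballI, simp only: split_paired_all split_conv)
      fix n m assume "(n, m) \<in> srep 3 (OP Q0) (4 * N)"
      then obtain b where "n = m + 4 * b" using OP_dvd[of n m] by (auto simp: srep_def)
      thus "((n + 3 * m) div 4 + 3 * ((n - m) div 4), (n + 3 * m) div 4 - (n - m) div 4) = (n, m)"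
        by simp
    qed
  qed
  thus ?thesis by (simp add: bij_betw_same_card)
qed

lemma srep_O3_empty: "\<not> 4 dvd M \<Longrightarrow> srep 3 (OP Q0) M = {}"
proof (rule ccontr)
  assume M: "\<not> 4 dvd M" and "srep 3 (OP Q0) M \<noteq> {}"
  then obtain n m where P: "OP Q0 n m" and q: "n\<^sup>2 + 3 * m\<^sup>2 = int M" by (auto simp: srep_def)
  obtain b where b: "n - m = 4 * b" using P by (auto simp: OP_def)
  hence n: "n = m + 4 * b" by simp
  have "n\<^sup>2 + 3 * m\<^sup>2 = 4 * ((m + b)\<^sup>2 + 3 * b\<^sup>2)"
    unfolding n by (simp add: power2_eq_square algebra_simps)
  hence "int 4 dvd int M" using q by (metis dvd_triv_left of_nat_numeral)
  thus False using M by (simp only: int_dvd_int_iff)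
qed

lemma OP_Q0_sym: "OP Q0 (- n) (- m) = OP Q0 n m"
  using dvd_diff_commute[of 4 m n] by (auto simp: OP_def Q0_def)

lemma SP_R3_sym: "SP R3 (- n) (- m) = SP R3 n m"
  using dvd_minus_iff[of 5 "n + 3 * m"] dvd_minus_iff[of 5 "n - m"]
  by (auto simp: SP_def R3_iff algebra_simps)

lemma delta3_core: "D * dil 3 D = dil 4 (QQ 3)"
proof (rule fps_ext)
  fix n
  have "theta 3 (\<lambda>a b. of_nat (fold_sign (OP Q0) a b)) $ n
      = dil 4 (theta 3 (\<lambda>a b. of_nat (fold_sign (SP R3) a b))) $ n"
    using theta_fold_nth[of 3 "OP Q0" n] theta_fold_nth[of 3 "SP R3" "n div 4"] OP_Q0_sym SP_R3_sym
      card_srep_O3[of "n div 4"] srep_O3_empty[of n]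
    by (cases "4 dvd n") (simp_all add: dil_nth OP_def SP_def)
  thus "(D * dil 3 D) $ n = dil 4 (QQ 3) $ n" by (simp add: theta_O_Q0 theta_S_R3)
qed

text \<open>With \<open>u = 1 + yy * dil 3 yy\<close> and \<open>d = D * dil 3 D\<close> one has
  \<open>u + u^4 = QQ 3 + d\<close> and \<open>d = QQ 3 ^ 4\<close>. Eliminating \<open>QQ 3\<close>
  shows that \<open>u^4 + d\<close> is its own fourth power.\<close>

lemma delta3: "D * dil 3 D = (1 + yy * dil 3 yy) ^ 4"
proof -
  define u d where "u = 1 + yy * dil 3 yy" and "d = D * dil 3 D"
  have u: "u + u ^ 4 = QQ 3 + d" using u_QQ[of 3] by (simp add: u_def d_def)
  have d: "d = QQ 3 ^ 4" using delta3_core by (simp add: d_def bfps_power4[of "QQ 3"])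
  define v where "v = u ^ 4 + d"
  have "(u + u ^ 4) ^ 4 = (QQ 3 + d) ^ 4" by (simp only: u)
  hence "u ^ 4 + (u ^ 4) ^ 4 = d + d ^ 4" by (simp only: bfps_add_power4 d[symmetric])
  hence "v ^ 4 = v" unfolding v_def bfps_add_power4
    by (metis bfps_add_self_left add.commute add.left_commute)
  hence "dil 4 v = v" using bfps_power4[of v] by simp
  moreover have "v $ 0 = 0"
    by (simp add: v_def u_def d_def yy_eq w12_nth0 D_ww dil_nth fps_power_zeroth)
  ultimately have "v = 0" using dil_fixpoint[of 4 v] by simp
  thus ?thesis unfolding v_def u_def d_def by (metis bfps_eq_iff add.commute)
qed

section \<open>The form \<open>a^2 + 7 b^2\<close> and the relation for \<open>p = 7\<close>\<close>

lemma bfps_eqI: "f + g = 0 \<Longrightarrow> f = (g :: bit fps)"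
  using bfps_eq_iff by blast

lemma bfps_eq_add: "f + g = h \<Longrightarrow> f = h + (g :: bit fps)"
  by (auto simp: add.assoc)

text \<open>Multiplication by \<open>1 + sqrt(-7)\<close>, of norm 8, reaches the solutions with
  \<open>8 dvd m - n\<close>. The others come from half that element, of norm 2, and their quotients
  satisfy the conditions of \<open>OP\<close> again. The assumption \<open>scale\<close> absorbs the
  halving.\<close>

lemma OP_split7:
  assumes lin: "\<And>a b. Q (a - 7 * b) (a + b) = Q' a b"
    and scale: "\<And>n m. Q (2 * n) (2 * m) = Q n m"
  shows "card (srep 7 (OP Q) M) =
    card {(a, b). SP Q' a b \<and> 8 * (a\<^sup>2 + 7 * b\<^sup>2) = int M} +
    card {(e, c). OP Q' e c \<and> 2 * (e\<^sup>2 + 7 * c\<^sup>2) = int M}"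
proof -
  let ?A = "{(a, b). SP Q' a b \<and> 8 * (a\<^sup>2 + 7 * b\<^sup>2) = int M}"
  let ?B = "{(e, c). OP Q' e c \<and> 2 * (e\<^sup>2 + 7 * c\<^sup>2) = int M}"
  let ?X = "srep 7 (OP Q) M"
  have OP_dvd: "\<exists>b. n = m + 4 * b" if "OP Q n m" for n m and Q :: "int \<Rightarrow> int \<Rightarrow> bool"
    using that by (auto simp: OP_def dvd_def algebra_simps)
  have fin: "finite ?X"
  proof (rule finite_subset[of _ "{-int M..int M} \<times> {-int M..int M}"])
    show "?X \<subseteq> {-int M..int M} \<times> {-int M..int M}"
    proof clarify
      fix n m assume "(n, m) \<in> ?X"
      hence q: "n\<^sup>2 + 7 * m\<^sup>2 = int M" by (simp add: srep_def)
      have *: "\<bar>x\<bar> \<le> x\<^sup>2" for x :: int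
      proof -
        have "\<bar>x\<bar> * 1 \<le> \<bar>x\<bar> * \<bar>x\<bar>" by (cases "x = 0") (use mult_left_mono[of 1 "\<bar>x\<bar>" "\<bar>x\<bar>"] in auto)
        also have "\<bar>x\<bar> * \<bar>x\<bar> = x\<^sup>2" by (simp add: power2_eq_square flip: abs_mult)
        finally show ?thesis by simp
      qed
      have "\<bar>n\<bar> \<le> int M" "\<bar>m\<bar> \<le> int M"
        using *[of n] *[of m] q zero_le_power2[of n] zero_le_power2[of m] by linarith+
      thus "n \<in> {-int M..int M} \<and> m \<in> {-int M..int M}" by auto
    qed
  qed simp
  have A: "bij_betw (\<lambda>(a, b). (a - 7 * b, a + b)) ?A {(n, m) \<in> ?X. 8 dvd m - n}"
  proof (rule bij_betw_byWitness[where f' = "\<lambda>(n, m). (m - (m - n) div 8, (m - n) div 8)"])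
    show "(\<lambda>(a, b). (a - 7 * b, a + b)) ` ?A \<subseteq> {(n, m) \<in> ?X. 8 dvd m - n}"
    proof (rule image_subsetI, simp only: split_paired_all split_conv)
      fix a b assume "(a, b) \<in> ?A"
      hence P: "odd (a + b)" "Q' a b" and q: "8 * (a\<^sup>2 + 7 * b\<^sup>2) = int M" by (auto simp: SP_def)
      have "(a - 7 * b)\<^sup>2 + 7 * (a + b)\<^sup>2 = 8 * (a\<^sup>2 + 7 * b\<^sup>2)"
        by (simp add: power2_eq_square algebra_simps)
      moreover have "(a - 7 * b) - (a + b) = 4 * (- 2 * b)" "(a + b) - (a - 7 * b) = 8 * b" by simp_all
      moreover from this have "4 dvd (a - 7 * b) - (a + b)" "8 dvd (a + b) - (a - 7 * b)"
        by (metis dvd_triv_left)+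
      moreover have "odd (a - 7 * b)" using P(1) by simp
      ultimately show "(a - 7 * b, a + b) \<in> {(n, m) \<in> ?X. 8 dvd m - n}"
        using q P(2) lin[of a b] by (simp add: srep_def OP_def)
    qed
    show "(\<lambda>(n, m). (m - (m - n) div 8, (m - n) div 8)) ` {(n, m) \<in> ?X. 8 dvd m - n} \<subseteq> ?A"
    proof (rule image_subsetI, simp only: split_paired_all split_conv)
      fix n m assume nm: "(n, m) \<in> {(n, m) \<in> ?X. 8 dvd m - n}"
      then obtain b where "m - n = 8 * b" by auto
      hence n: "n = (m - b) - 7 * b" by simp
      have P: "odd n" "Q n m" and q: "n\<^sup>2 + 7 * m\<^sup>2 = int M" using nm by (auto simp: srep_def OP_def)
      have div: "(m - n) div 8 = b" using n by simp
      have "n\<^sup>2 + 7 * m\<^sup>2 = 8 * ((m - b)\<^sup>2 + 7 * b\<^sup>2)"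
        unfolding n by (simp add: power2_eq_square algebra_simps)
      moreover have "Q' (m - b) b" using lin[of "m - b" b] P(2) n by simp
      moreover have "odd (m - b + b)" using P(1) n by simp
      ultimately show "(m - (m - n) div 8, (m - n) div 8) \<in> ?A" unfolding div SP_def using q by simp
    qed
  qed auto
  have B: "bij_betw (\<lambda>(e, c). ((e - 7 * c) div 2, (e + c) div 2)) ?B {(n, m) \<in> ?X. \<not> 8 dvd m - n}"
  proof (rule bij_betw_byWitness[where f' = "\<lambda>(n, m). (2 * m - (m - n) div 4, (m - n) div 4)"])
    have Bdiv: "\<exists>k. e = c + 4 * k \<and> odd c \<and> (e - 7 * c) div 2 = 2 * k - 3 * c \<and> (e + c) div 2 = c + 2 * k"
      if "(e, c) \<in> ?B" for e c
    proof -
      have "OP Q' e c" using that by simp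
      then obtain k where k: "e = c + 4 * k" using OP_dvd by blast
      have "e - 7 * c = 2 * (2 * k - 3 * c)" "e + c = 2 * (c + 2 * k)" using k by simp_all
      hence "(e - 7 * c) div 2 = 2 * k - 3 * c" "(e + c) div 2 = c + 2 * k" by simp_all
      moreover have "odd c" using that k by (auto simp: OP_def)
      ultimately show ?thesis using k by blast
    qed
    have Xdiv: "\<exists>c. n = m - 4 * c \<and> odd c \<and> (m - n) div 4 = c"
      if "(n, m) \<in> {(n, m) \<in> ?X. \<not> 8 dvd m - n}" for n m
    proof -
      have "OP Q n m" using that by (simp add: srep_def)
      then obtain b where b: "n = m + 4 * b" using OP_dvd by blast
      have "odd b"
      proof
        assume "even b"
        then obtain d where "b = 2 * d" by auto
        hence "m - n = 8 * (- d)" using b by simp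
        hence "8 dvd m - n" by (metis dvd_triv_left)
        thus False using that by simp
      qed
      hence "odd (- b)" "n = m - 4 * (- b)" "(m - n) div 4 = - b" using b by simp_all
      thus ?thesis by blast
    qed
    show "(\<lambda>(e, c). ((e - 7 * c) div 2, (e + c) div 2)) ` ?B \<subseteq> {(n, m) \<in> ?X. \<not> 8 dvd m - n}"
    proof (rule image_subsetI, simp only: split_paired_all split_conv)
      fix e c assume ec: "(e, c) \<in> ?B"
      then obtain k where k: "e = c + 4 * k" "odd c"
        "(e - 7 * c) div 2 = 2 * k - 3 * c" "(e + c) div 2 = c + 2 * k" using Bdiv[of e c] by blast
      have P: "Q' e c" and q: "2 * (e\<^sup>2 + 7 * c\<^sup>2) = int M" using ec by (auto simp: OP_def)
      have "(2 * k - 3 * c)\<^sup>2 + 7 * (c + 2 * k)\<^sup>2 = 2 * (e\<^sup>2 + 7 * c\<^sup>2)"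
        unfolding k by (simp add: power2_eq_square algebra_simps)
      moreover have "Q (2 * k - 3 * c) (c + 2 * k)"
      proof -
        have "e - 7 * c = 2 * (2 * k - 3 * c)" "e + c = 2 * (c + 2 * k)" using k(1) by simp_all
        thus ?thesis using lin[of e c] P scale by metis
      qed
      moreover have "(c + 2 * k) - (2 * k - 3 * c) = 4 * c" by simp
      moreover have "\<not> 8 dvd 4 * c"
      proof
        assume "8 dvd 4 * c"
        then obtain d where "4 * c = 8 * d" by auto
        hence "c = 2 * d" by simp
        thus False using k(2) by simp
      qed
      moreover have "(2 * k - 3 * c) - (c + 2 * k) = 4 * (- c)" by simp
      hence "4 dvd (2 * k - 3 * c) - (c + 2 * k)" by (metis dvd_triv_left)
      moreover have "odd (2 * k - 3 * c)" using k(2) by simp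
      ultimately show "((e - 7 * c) div 2, (e + c) div 2) \<in> {(n, m) \<in> ?X. \<not> 8 dvd m - n}"
        unfolding k(3,4) using q by (simp add: srep_def OP_def)
    qed
    show "(\<lambda>(n, m). (2 * m - (m - n) div 4, (m - n) div 4)) ` {(n, m) \<in> ?X. \<not> 8 dvd m - n} \<subseteq> ?B"
    proof (rule image_subsetI, simp only: split_paired_all split_conv)
      fix n m assume nm: "(n, m) \<in> {(n, m) \<in> ?X. \<not> 8 dvd m - n}"
      then obtain c where n: "n = m - 4 * c" and c: "odd c" and div: "(m - n) div 4 = c"
        using Xdiv[of n m] by blast
      have P: "odd n" "Q n m" and q: "n\<^sup>2 + 7 * m\<^sup>2 = int M" using nm by (auto simp: srep_def OP_def)
      have "n\<^sup>2 + 7 * m\<^sup>2 = 2 * ((2 * m - c)\<^sup>2 + 7 * c\<^sup>2)"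
        unfolding n by (simp add: power2_eq_square algebra_simps)
      moreover have "Q' (2 * m - c) c"
      proof -
        have "(2 * m - c) - 7 * c = 2 * n" "(2 * m - c) + c = 2 * m" using n by simp_all
        thus ?thesis using lin[of "2 * m - c" c] P(2) scale by metis
      qed
      moreover have "odd m" using P(1) n by simp
      then have "even (m - c)" using c by simp
      then obtain d where "m - c = 2 * d" by (rule evenE)
      hence "(2 * m - c) - c = 4 * d" by simp
      hence "4 dvd (2 * m - c) - c" by (metis dvd_triv_left)
      moreover have "odd (2 * m - c)" using c by simp
      ultimately show "(2 * m - (m - n) div 4, (m - n) div 4) \<in> ?B" unfolding div OP_def using q by simp
    qed
    show "\<forall>z\<in>?B. (\<lambda>(n, m). (2 * m - (m - n) div 4, (m - n) div 4))
      ((\<lambda>(e, c). ((e - 7 * c) div 2, (e + c) div 2)) z) = z"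
    proof (rule ballI, simp only: split_paired_all split_conv)
      fix e c assume "(e, c) \<in> ?B"
      then obtain k where k: "e = c + 4 * k"
        "(e - 7 * c) div 2 = 2 * k - 3 * c" "(e + c) div 2 = c + 2 * k" using Bdiv[of e c] by blast
      show "(2 * ((e + c) div 2) - ((e + c) div 2 - (e - 7 * c) div 2) div 4,
          ((e + c) div 2 - (e - 7 * c) div 2) div 4) = (e, c)"
        unfolding k(2,3) using k(1) by simp
    qed
    show "\<forall>z\<in>{(n, m) \<in> ?X. \<not> 8 dvd m - n}. (\<lambda>(e, c). ((e - 7 * c) div 2, (e + c) div 2))
      ((\<lambda>(n, m). (2 * m - (m - n) div 4, (m - n) div 4)) z) = z"
    proof (rule ballI, simp only: split_paired_all split_conv)
      fix n m assume "(n, m) \<in> {(n, m) \<in> ?X. \<not> 8 dvd m - n}"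
      then obtain c where n: "n = m - 4 * c" and div: "(m - n) div 4 = c"
        using Xdiv[of n m] by blast
      show "((2 * m - (m - n) div 4 - 7 * ((m - n) div 4)) div 2,
          (2 * m - (m - n) div 4 + (m - n) div 4) div 2) = (n, m)"
        unfolding div using n by simp
    qed
  qed
  have "?X = {(n, m) \<in> ?X. 8 dvd m - n} \<union> {(n, m) \<in> ?X. \<not> 8 dvd m - n}" by auto
  hence "card ?X = card {(n, m) \<in> ?X. 8 dvd m - n} + card {(n, m) \<in> ?X. \<not> 8 dvd m - n}"
    using card_Un_disjoint[of "{(n, m) \<in> ?X. 8 dvd m - n}" "{(n, m) \<in> ?X. \<not> 8 dvd m - n}"]
      finite_subset[OF _ fin] by auto
  thus ?thesis using bij_betw_same_card[OF A] bij_betw_same_card[OF B] by simp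
qed

lemma card_multiple:
  assumes "c > 0"
  shows "card {(a, b). P a b \<and> int c * (a\<^sup>2 + 7 * b\<^sup>2) = int M} =
    (if c dvd M then card (srep 7 P (M div c)) else 0)"
proof (cases "c dvd M")
  case True
  then obtain N where "M = c * N" by auto
  hence "int c * x = int M \<longleftrightarrow> x = int (M div c)" for x using assms by simp
  thus ?thesis using True unfolding srep_def by simp
next
  case False
  hence "int c * x \<noteq> int M" for x by (metis dvd_triv_left int_dvd_int_iff)
  thus ?thesis using False by simp
qed

lemma theta_OP_split7:
  assumes lin: "\<And>a b. Q (a - 7 * b) (a + b) = Q' a b"
    and scale: "\<And>n m. Q (2 * n) (2 * m) = Q n m"
    and sym: "\<And>n m. Q (- n) (- m) = Q n m" "\<And>n m. Q' (- n) (- m) = Q' n m"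
  shows "theta 7 (\<lambda>a b. of_nat (fold_sign (OP Q) a b)) =
    theta 7 (\<lambda>a b. of_nat (fold_sign (SP Q') a b)) ^ 8 +
    (theta 7 (\<lambda>a b. of_nat (fold_sign (OP Q') a b)))\<^sup>2"
proof -
  have O: "OP Q (- n) (- m) = OP Q n m" "OP Q' (- n) (- m) = OP Q' n m" for n m
    using sym dvd_diff_commute[of 4 m n] by (auto simp: OP_def)
  have S: "SP Q' (- a) (- b) = SP Q' a b" for a b
    using sym by (auto simp: SP_def)
  have nz: "\<not> OP Q 0 0" "\<not> OP Q' 0 0" "\<not> SP Q' 0 0" by (auto simp: OP_def SP_def)
  have c: "card (srep 7 (OP Q) N) = 2 * (\<Sum>(a, b)\<in>rep 7 N. fold_sign (OP Q) a b)"
    "card (srep 7 (OP Q') N) = 2 * (\<Sum>(a, b)\<in>rep 7 N. fold_sign (OP Q') a b)"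
    "card (srep 7 (SP Q') N) = 2 * (\<Sum>(a, b)\<in>rep 7 N. fold_sign (SP Q') a b)" for N
    using card_srep[of 7 "OP Q", OF zero_less_numeral O(1) nz(1)]
      card_srep[of 7 "OP Q'", OF zero_less_numeral O(2) nz(2)]
      card_srep[of 7 "SP Q'", OF zero_less_numeral S nz(3)] by simp_all
  let ?f = "\<lambda>P N. \<Sum>(a, b)\<in>rep 7 N. fold_sign P a b"
  have "?f (OP Q) N = (if 8 dvd N then ?f (SP Q') (N div 8) else 0)
      + (if 2 dvd N then ?f (OP Q') (N div 2) else 0)" for N
    using OP_split7[of Q Q' N, OF lin scale] card_multiple[of 8 "SP Q'" N] card_multiple[of 2 "OP Q'" N]
    unfolding c by (simp split: if_splits)
  hence "(of_nat (?f (OP Q) N) :: bit) = (if 8 dvd N then of_nat (?f (SP Q') (N div 8)) else 0)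
      + (if 2 dvd N then of_nat (?f (OP Q') (N div 2)) else 0)" for N by simp
  hence "theta 7 (\<lambda>a b. of_nat (fold_sign (OP Q) a b)) =
      dil 8 (theta 7 (\<lambda>a b. of_nat (fold_sign (SP Q') a b)))
      + dil 2 (theta 7 (\<lambda>a b. of_nat (fold_sign (OP Q') a b)))"
    by (intro fps_ext) (simp add: theta_def dil_nth split_beta)
  thus ?thesis
    unfolding bfps_power8[of "theta 7 (\<lambda>a b. of_nat (fold_sign (SP Q') a b))"]
      bfps_square[of "theta 7 (\<lambda>a b. of_nat (fold_sign (OP Q') a b))"] .
qed

text \<open>\<open>Q1\<close> and \<open>Q2\<close> are successive pullbacks of \<open>Q0\<close>
  along \<open>(a, b) \<mapsto> (a - 7 b, a + b)\<close>, with \<open>Q2\<close> simplified modulo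
  5.\<close>

definition Q1 :: "int \<Rightarrow> int \<Rightarrow> bool" where "Q1 a b \<longleftrightarrow> \<not> 5 dvd a - 7 * b \<and> \<not> 5 dvd a + b"
definition Q2 :: "int \<Rightarrow> int \<Rightarrow> bool" where "Q2 a b \<longleftrightarrow> \<not> 5 dvd a - b \<and> \<not> 5 dvd a + 2 * b"

lemma five_dvd_twice: "5 dvd 2 * n \<longleftrightarrow> 5 dvd (n::int)"
  by presburger

lemma Q_sym: "Q0 (- n) (- m) = Q0 n m" "Q1 (- n) (- m) = Q1 n m" "Q2 (- n) (- m) = Q2 n m"
  using dvd_minus_iff[of 5 "n - 7 * m"] dvd_minus_iff[of 5 "n + m"]
    dvd_minus_iff[of 5 "n - m"] dvd_minus_iff[of 5 "n + 2 * m"]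
  by (auto simp: Q0_def Q1_def Q2_def algebra_simps)

lemma Q_scale: "Q0 (2 * n) (2 * m) = Q0 n m" "Q1 (2 * n) (2 * m) = Q1 n m"
proof -
  have "2 * n - 7 * (2 * m) = 2 * (n - 7 * m)" "2 * n + 2 * m = 2 * (n + m)" by simp_all
  thus "Q0 (2 * n) (2 * m) = Q0 n m" "Q1 (2 * n) (2 * m) = Q1 n m"
    by (simp_all only: Q0_def Q1_def five_dvd_twice)
qed

lemma Q0_lin: "Q0 (a - 7 * b) (a + b) = Q1 a b"
  by (simp add: Q0_def Q1_def)

lemma Q1_lin: "Q1 (a - 7 * b) (a + b) = Q2 a b"
proof -
  have "(a - 7 * b) - 7 * (a + b) = - (a - b) + 5 * (- a - 3 * b)" by simp
  hence "5 dvd (a - 7 * b) - 7 * (a + b) \<longleftrightarrow> 5 dvd a - b"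
    by (metis dvd_add_left_iff dvd_minus_iff dvd_triv_left)
  moreover have "(a - 7 * b) + (a + b) = 2 * (a + 2 * b) + 5 * (- 2 * b)" by simp
  hence "5 dvd (a - 7 * b) + (a + b) \<longleftrightarrow> 5 dvd a + 2 * b"
    by (metis dvd_add_left_iff dvd_triv_left five_dvd_twice)
  ultimately show ?thesis by (simp only: Q1_def Q2_def)
qed

lemma Q_mod: "Q0 a b \<longleftrightarrow> a mod 5 \<noteq> 0 \<and> b mod 5 \<noteq> 0"
  "Q1 a b \<longleftrightarrow> (a mod 5 - 7 * (b mod 5)) mod 5 \<noteq> 0 \<and> (a mod 5 + b mod 5) mod 5 \<noteq> 0"
  "Q2 a b \<longleftrightarrow> (a mod 5 - b mod 5) mod 5 \<noteq> 0 \<and> (a mod 5 + 2 * (b mod 5)) mod 5 \<noteq> 0"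
proof -
  have "(a mod 5 - 7 * (b mod 5)) mod 5 = (a - 7 * b) mod 5" "(a mod 5 + b mod 5) mod 5 = (a + b) mod 5"
    "(a mod 5 - b mod 5) mod 5 = (a - b) mod 5" "(a mod 5 + 2 * (b mod 5)) mod 5 = (a + 2 * b) mod 5"
    by (intro mod_diff_cong mod_add_cong; simp add: mod_mult_right_eq)+
  thus "Q0 a b \<longleftrightarrow> a mod 5 \<noteq> 0 \<and> b mod 5 \<noteq> 0"
    "Q1 a b \<longleftrightarrow> (a mod 5 - 7 * (b mod 5)) mod 5 \<noteq> 0 \<and> (a mod 5 + b mod 5) mod 5 \<noteq> 0"
    "Q2 a b \<longleftrightarrow> (a mod 5 - b mod 5) mod 5 \<noteq> 0 \<and> (a mod 5 + 2 * (b mod 5)) mod 5 \<noteq> 0"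
    unfolding Q0_def Q1_def Q2_def by (simp_all only: dvd_eq_mod_eq_0)
qed

lemma theta_S_Q1: "theta 7 (\<lambda>a b. of_nat (fold_sign (SP Q1) a b)) = QQ 7"
proof -
  have "of_nat (fold_sign (SP Q1) a b) =
    (of_bool (a \<in> {m\<in>MM. odd m} \<and> b \<in> {m\<in>MM. even m})
    + of_bool (a \<in> {m\<in>MM. even m} \<and> b \<in> {m\<in>MM. odd m}) :: bit)" for a b
  proof (rule fold_S_linear[where C = "\<lambda>r s. (r - 7 * s) mod 5 \<noteq> 0 \<and> (r + s) mod 5 \<noteq> 0"])
    show "Q1 a b \<longleftrightarrow> (a mod 5 - 7 * (b mod 5)) mod 5 \<noteq> 0 \<and> (a mod 5 + b mod 5) mod 5 \<noteq> 0" for a b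
      by (rule Q_mod)
  qed (drule mod5_cases, drule mod5_cases, (elim disjE; simp))
  thus ?thesis using theta_QQ[of 7] by simp
qed

lemma theta_S_Q2: "theta 7 (\<lambda>a b. of_nat (fold_sign (SP Q2) a b)) = QQ 7"
proof -
  have "of_nat (fold_sign (SP Q2) a b) =
    (of_bool (a \<in> {m\<in>MM. odd m} \<and> b \<in> {m\<in>MM. even m})
    + of_bool (a \<in> {m\<in>MM. even m} \<and> b \<in> {m\<in>MM. odd m}) :: bit)" for a b
  proof (rule fold_S_linear[where C = "\<lambda>r s. (r - s) mod 5 \<noteq> 0 \<and> (r + 2 * s) mod 5 \<noteq> 0"])
    show "Q2 a b \<longleftrightarrow> (a mod 5 - b mod 5) mod 5 \<noteq> 0 \<and> (a mod 5 + 2 * (b mod 5)) mod 5 \<noteq> 0" for a b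
      by (rule Q_mod)
  qed (drule mod5_cases, drule mod5_cases, (elim disjE; simp))
  thus ?thesis using theta_QQ[of 7] by simp
qed

text \<open>The three conditions exclude the ratios \<open>a / b\<close> in {0, infinity}, {2, 4}
  and {1, 3}, a partition of the projective line over the field with 5 elements. A nonzero vector
  violates exactly one condition, the zero vector all three.\<close>

lemma Q_sum: "of_bool (Q0 a b) + of_bool (Q1 a b) + of_bool (Q2 a b) = (0 :: bit)"
proof -
  have *: "of_bool (r \<noteq> 0 \<and> s \<noteq> 0) + of_bool ((r - 7 * s) mod 5 \<noteq> 0 \<and> (r + s) mod 5 \<noteq> 0)
      + of_bool ((r - s) mod 5 \<noteq> 0 \<and> (r + 2 * s) mod 5 \<noteq> 0) = (0 :: bit)"
    if "r \<in> {0, 1, 2, 3, 4}" "s \<in> {0, 1, 2, 3, 4}" for r s :: int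
    using that by (elim insertE emptyE; simp)
  have "a mod 5 \<in> {0, 1, 2, 3, 4}" for a :: int
    using pos_mod_bound[of 5 a] pos_mod_sign[of 5 a] unfolding insert_iff empty_iff by linarith
  thus ?thesis unfolding Q_mod by (intro *)
qed

lemma fold_OP_sum: "of_nat (fold_sign (OP Q0) a b) + of_nat (fold_sign (OP Q1) a b)
    + of_nat (fold_sign (OP Q2) a b) = (0 :: bit)"
proof -
  let ?s = "of_bool (4 dvd int a - int b) :: bit" and ?t = "of_bool (4 dvd int a + int b) :: bit"
  have "of_nat (fold_sign (OP Q0) a b) + of_nat (fold_sign (OP Q1) a b) + of_nat (fold_sign (OP Q2) a b)
    = (if odd a \<and> odd b then
        (of_bool (Q0 (int a) (int b)) + of_bool (Q1 (int a) (int b)) + of_bool (Q2 (int a) (int b))) * ?s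
      + (of_bool (Q0 (int a) (- int b)) + of_bool (Q1 (int a) (- int b)) + of_bool (Q2 (int a) (- int b))) * ?t
       else 0)"
    unfolding fold_sign_OP by (simp only: of_nat_add of_nat_mult of_nat_of_bool of_nat_0 distrib_right
        split: if_split) (simp add: ac_simps)
  thus ?thesis unfolding Q_sum by simp
qed

text \<open>The splitting relates the series of \<open>Q0\<close> to that of \<open>Q1\<close>, and
  this to that of \<open>Q2\<close>; \<open>Q_sum\<close> closes the system. It yields
  \<open>QQ 7 ^ 8 = d + d^2 + d^4\<close>, and then \<open>u^8 + d + d^2\<close> is its own fourth
  power.\<close>

lemma delta7: "D * dil 7 D + (D * dil 7 D)\<^sup>2 = (1 + yy * dil 7 yy) ^ 8"
proof -
  define u d q where "u = 1 + yy * dil 7 yy" and "d = D * dil 7 D" and "q = QQ 7"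
  define O1 O2 where "O1 = theta 7 (\<lambda>a b. of_nat (fold_sign (OP Q1) a b))"
    and "O2 = theta 7 (\<lambda>a b. of_nat (fold_sign (OP Q2) a b))"
  have u: "u + u ^ 4 = q + d" using u_QQ[of 7] by (simp add: u_def d_def q_def)
  have O0: "theta 7 (\<lambda>a b. of_nat (fold_sign (OP Q0) a b)) = d"
    unfolding d_def by (rule theta_O_Q0) simp
  have d: "d = q ^ 8 + O1\<^sup>2"
    using theta_OP_split7[of Q0 Q1, OF Q0_lin Q_scale(1) Q_sym(1,2)]
    unfolding O0 theta_S_Q1 by (simp add: O1_def q_def)
  have O1: "O1 = q ^ 8 + O2\<^sup>2"
    using theta_OP_split7[of Q1 Q2, OF Q1_lin Q_scale(2) Q_sym(2,3)]
    unfolding theta_S_Q2 by (simp add: O1_def O2_def q_def)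
  have "d + O1 + O2 = 0"
    unfolding O0[symmetric] O1_def O2_def theta_add[symmetric] fold_OP_sum
    by (intro fps_ext) (simp add: theta_def)
  hence O2: "O2 = d + O1" by (rule bfps_eqI[symmetric])
  have "O1 + d = (q ^ 8 + O2\<^sup>2) + (q ^ 8 + O1\<^sup>2)"
    by (rule arg_cong2[where f = "(+)", OF O1 d])
  also have "\<dots> = (q ^ 8 + (d + O1)\<^sup>2) + (q ^ 8 + O1\<^sup>2)" by (simp only: O2)
  also have "\<dots> = d\<^sup>2" by (simp add: bfps_add_square ac_simps)
  finally have O1': "O1 = d + d\<^sup>2" using bfps_eq_add[of O1 d "d\<^sup>2"] by (simp add: add.commute)
  have q8: "q ^ 8 = d + (d\<^sup>2 + d ^ 4)"
  proof -
    have "O1\<^sup>2 = d\<^sup>2 + d ^ 4" unfolding O1' bfps_add_square by (simp flip: power_mult)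
    thus ?thesis using bfps_eq_add[of "q ^ 8" "O1\<^sup>2" d, OF d[symmetric]] by (simp only:)
  qed
  define v where "v = u ^ 8 + d + d\<^sup>2"
  have "(u + u ^ 4) ^ 8 = (q + d) ^ 8" by (simp only: u)
  hence "u ^ 8 + (u ^ 4) ^ 8 = d + (d\<^sup>2 + d ^ 4) + d ^ 8" by (simp only: bfps_add_power8 q8)
  hence "(u ^ 4) ^ 8 = (d + (d\<^sup>2 + d ^ 4) + d ^ 8) + u ^ 8"
    using bfps_eq_add[of "(u ^ 4) ^ 8" "u ^ 8"] by (simp only: add.commute)
  hence "(u ^ 8) ^ 4 = u ^ 8 + (d + (d\<^sup>2 + d ^ 4) + d ^ 8)"
    by (simp add: add.commute flip: power_mult)
  moreover have "(d\<^sup>2) ^ 4 = d ^ 8" by (simp flip: power_mult)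
  ultimately have "v ^ 4 = u ^ 8 + (d + (d\<^sup>2 + d ^ 4) + d ^ 8) + d ^ 4 + d ^ 8"
    by (simp only: v_def bfps_add_power4)
  also have "\<dots> = v" unfolding v_def
    by (simp only: add.assoc add.commute add.left_commute bfps_add_self bfps_add_self_left add_0_right)
  finally have "v ^ 4 = v" .
  hence "dil 4 v = v" using bfps_power4[of v] by simp
  moreover have "v $ 0 = 0"
    by (simp add: v_def u_def d_def yy_eq w12_nth0 D_ww dil_nth fps_power_zeroth)
  ultimately have "v = 0" using dil_fixpoint[of 4 v] by simp
  hence "u ^ 8 + (d + d\<^sup>2) = 0" by (simp only: v_def add.assoc)
  from bfps_eqI[OF this] show ?thesis by (simp only: u_def d_def)
qed

section \<open>The relation \<open>G * yy^8 = D^5\<close>\<close>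

definition ii :: "bit fps" where "ii = inverse yy"

lemma yy_ii: "yy * ii = 1" "ii * yy = 1"
  using inverse_mult_eq_1[of yy] by (simp_all add: ii_def yy_eq w12_nth0 mult.commute)

lemma yy_nonzero: "yy \<noteq> 0" "ii \<noteq> 0"
  using yy_ii by auto

lemma D_yy: "D = yy + yy ^ 4"
  by (simp add: D_ww yy_eq bfps_add_power4 ac_simps)

definition supp :: "nat \<Rightarrow> nat \<Rightarrow> bit fps \<Rightarrow> bool" where
  "supp M r f \<longleftrightarrow> (\<forall>n. n mod M \<noteq> r \<longrightarrow> f $ n = 0)"

lemma supp_add: "supp M r f \<Longrightarrow> supp M r g \<Longrightarrow> supp M r (f + g)"
  by (simp add: supp_def)

lemma supp_mult:
  assumes "supp M r f" "supp M s g"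
  shows "supp M ((r + s) mod M) (f * g)"
  unfolding supp_def
proof (intro allI impI)
  fix n assume n: "n mod M \<noteq> (r + s) mod M"
  have "f $ i * g $ (n - i) = 0" if "i \<in> {0..n}" for i
  proof (rule ccontr)
    assume "f $ i * g $ (n - i) \<noteq> 0"
    hence "i mod M = r" "(n - i) mod M = s" using assms by (auto simp: supp_def)
    hence "(r + s) mod M = (i + (n - i)) mod M" by (metis mod_add_eq)
    thus False using n that by simp
  qed
  thus "(f * g) $ n = 0" unfolding fps_mult_nth by (intro sum.neutral) blast
qed

lemma supp_sep:
  assumes "supp M r f" "supp M s g" "r \<noteq> s" "f + g = 0"
  shows "f = 0"
proof (rule fps_ext)
  fix n
  have "f $ n + g $ n = 0" using assms(4) by (metis fps_add_nth fps_zero_nth)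
  thus "f $ n = (0::bit fps) $ n" using assms(1-3) unfolding supp_def
    by (cases "n mod M = r") auto
qed

lemma supp_dil: "k > 0 \<Longrightarrow> supp k 0 (dil k f)"
  by (auto simp: supp_def dil_nth)

lemma odd_square_mod8: "odd (m::nat) \<Longrightarrow> m\<^sup>2 mod 8 = 1"
proof -
  assume "odd m"
  then obtain k where m: "m = 2 * k + 1" by (auto elim: oddE)
  have "m\<^sup>2 = 4 * (k * (k + 1)) + 1" by (simp add: m power2_eq_square algebra_simps)
  moreover have "even (k * (k + 1))" by simp
  then obtain j where "k * (k + 1) = 2 * j" by (rule evenE)
  ultimately have "m\<^sup>2 = 8 * j + 1" by (simp only: mult.assoc[symmetric])
  thus ?thesis by simp
qed

lemma supp_sqs_odd: "(\<And>m. m \<in> A \<Longrightarrow> odd m) \<Longrightarrow> supp 8 1 (sqs A)"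
  using odd_square_mod8 by (auto simp: supp_def sqs_nth)

lemma supp_8_2: "supp 8 r f \<Longrightarrow> supp 2 (r mod 2) f"
  unfolding supp_def by (metis mod_mod_cancel dvd_refl even_numeral num_double numeral_times_numeral dvd_triv_left)

text \<open>Newton's formula for the fifth power sum, reduced modulo 2.\<close>

lemma bfps_power5_sum: "(a::bit fps) ^ 5 + b ^ 5 = (a + b) ^ 5 + a * b * (a + b) ^ 3 + (a * b)\<^sup>2 * (a + b)"
  by (simp add: algebra_simps eval_nat_numeral)

text \<open>Odd squares are 1 modulo 8. Separating exponents by residue class therefore extracts
  from \<open>w1_w2\<close> first its odd part and then the part in class 5 modulo 8, which
  expresses \<open>G\<close> by the odd parts of \<open>w1\<close> and \<open>w2\<close>. The
  remaining algebra eliminates the auxiliary series.\<close>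

lemma G_eq: "G * yy ^ 8 = D ^ 5"
proof -
  \<comment> \<open>The odd parts of \<open>w1\<close> and \<open>w2\<close>: doubling exchanges the
    classes +-1 and +-2 modulo 5.\<close>
  define D1 D2 where "D1 = w1 + w2 ^ 4" and "D2 = w2 + w1 ^ 4"
  define E where "E = dil 25 F"
  define C where "C = w1 * w2"
  have m5: "2 * m mod 5 = 1 \<longleftrightarrow> m mod 5 = 3" "2 * m mod 5 = 4 \<longleftrightarrow> m mod 5 = 2"
      "2 * m mod 5 = 2 \<longleftrightarrow> m mod 5 = 1" "2 * m mod 5 = 3 \<longleftrightarrow> m mod 5 = 4" for m :: nat
    by presburger+
  have e1: "w1 = sqs {m \<in> {m. m mod 5 = 1 \<or> m mod 5 = 4}. odd m} + w2 ^ 4"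
    unfolding w1_def w2_def by (rule sqs_even_odd) (auto simp only: mem_Collect_eq m5)
  have "D1 = sqs {m \<in> {m. m mod 5 = 1 \<or> m mod 5 = 4}. odd m}"
    using arg_cong[OF e1, of "\<lambda>x. x + w2 ^ 4"] by (simp only: D1_def add.assoc bfps_add_self add_0_right)
  hence s1: "supp 8 1 D1" by (simp only:) (rule supp_sqs_odd, simp)
  have e2: "w2 = sqs {m \<in> {m. m mod 5 = 2 \<or> m mod 5 = 3}. odd m} + w1 ^ 4"
    unfolding w1_def w2_def by (rule sqs_even_odd) (auto simp only: mem_Collect_eq m5)
  have "D2 = sqs {m \<in> {m. m mod 5 = 2 \<or> m mod 5 = 3}. odd m}"
    using arg_cong[OF e2, of "\<lambda>x. x + w1 ^ 4"] by (simp only: D2_def add.assoc bfps_add_self add_0_right)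
  hence s2: "supp 8 1 D2" by (simp only:) (rule supp_sqs_odd, simp)
  have F: "F = sqs {m. odd m}" unfolding F_def sqs_def of_bool_def by simp
  have sF: "supp 8 1 F" unfolding F by (rule supp_sqs_odd) simp
  have sdil: "supp 8 (k mod 8) (dil k f)" if "supp 8 1 f" "k > 0" for k f
    unfolding supp_def
  proof (intro allI impI)
    fix n assume n: "n mod 8 \<noteq> k mod 8"
    show "dil k f $ n = 0"
    proof (cases "k dvd n")
      case True
      then obtain q where q: "n = k * q" by auto
      have "q mod 8 \<noteq> 1"
      proof
        assume "q mod 8 = 1"
        hence "n mod 8 = k * 1 mod 8" unfolding q by (metis mod_mult_right_eq)
        thus False using n by simp
      qed
      thus ?thesis using that q by (simp add: dil_nth supp_def)
    qed (use that in \<open>simp add: dil_nth\<close>)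
  qed
  have sG: "supp 8 5 G" using sdil[OF sF, of 5] by (simp add: G_dil)
  have sE: "supp 8 1 E" using sdil[OF sF, of 25] by (simp add: E_def)
  \<comment> \<open>\<open>A\<close> is the odd part of \<open>BB\<close>, with \<open>G\<close> in
    class 5 and \<open>E\<close> in class 1 modulo 8.\<close>
  define A where "A = G + E"
  have AB: "BB + BB ^ 4 = A"
    unfolding BB_def A_def E_def G_dil F_zz bfps_add_power4
    by (simp add: dil_add dil_power ac_simps)
  have C: "C = BB + BB\<^sup>2" using w1_w2 by (simp add: C_def)
  have ev: "supp 2 0 (f ^ 4)" "supp 2 0 (f\<^sup>2)" for f
  proof -
    show "supp 2 0 (f\<^sup>2)" using supp_dil[of 2 f] bfps_square[of f] by simp
    have "f ^ 4 = (f\<^sup>2)\<^sup>2" by (simp flip: power_mult)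
    thus "supp 2 0 (f ^ 4)" using supp_dil[of 2 "f\<^sup>2"] bfps_square[of "f\<^sup>2"] by simp
  qed
  have od: "supp 2 1 D1" "supp 2 1 D2" "supp 2 1 A"
    using supp_8_2[OF s1] supp_8_2[OF s2] supp_add[OF supp_8_2[OF sG] , of E] supp_8_2[OF sE]
    by (simp_all add: A_def)
  have w: "w1 = D1 + w2 ^ 4" "w2 = D2 + w1 ^ 4"
    by (simp_all add: D1_def D2_def add.assoc)
  \<comment> \<open>\<open>w1 * w2 = BB + BB^2\<close>, grouped into odd and even exponents.\<close>
  have "(D1 * w1 ^ 4 + D2 * w2 ^ 4 + A) + (D1 * D2 + w2 ^ 4 * w1 ^ 4 + (BB ^ 4 + BB\<^sup>2)) = 0"
  proof -
    have "(D1 + w2 ^ 4) * (D2 + w1 ^ 4) = BB + BB\<^sup>2" using w C by (simp add: C_def)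
    moreover have "BB = A + BB ^ 4" using AB by (rule bfps_eq_add)
    ultimately have "(D1 + w2 ^ 4) * (D2 + w1 ^ 4) = (A + BB ^ 4) + BB\<^sup>2" by (simp only:)
    hence "(D1 + w2 ^ 4) * (D2 + w1 ^ 4) + ((A + BB ^ 4) + BB\<^sup>2) = 0"
      by (rule iffD1[OF bfps_eq_iff])
    thus ?thesis by (simp add: distrib_left distrib_right ac_simps)
  qed
  moreover have "supp 2 1 (D1 * w1 ^ 4 + D2 * w2 ^ 4 + A)"
    using supp_mult[OF od(1) ev(1)[of w1]] supp_mult[OF od(2) ev(1)[of w2]] od(3)
    by (simp add: supp_add)
  moreover have "supp 2 0 (D1 * D2 + w2 ^ 4 * w1 ^ 4 + (BB ^ 4 + BB\<^sup>2))"
    using supp_mult[OF od(1,2)] supp_mult[OF ev(1)[of w2] ev(1)[of w1]] ev(1)[of BB] ev(2)[of BB]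
    by (simp add: supp_add)
  ultimately have "D1 * w1 ^ 4 + D2 * w2 ^ 4 + A = 0"
    using supp_sep[of 2 1 _ 0] by simp
  hence DA: "D1 * w1 ^ 4 + D2 * w2 ^ 4 = A" by (rule bfps_eqI)
  have pw: "w1 ^ 4 = D1 ^ 4 + w2 ^ 16" "w2 ^ 4 = D2 ^ 4 + w1 ^ 16"
  proof -
    have "(a + b ^ 4) ^ 4 = a ^ 4 + b ^ 16" for a b :: "bit fps"
      unfolding bfps_add_power4 by (simp flip: power_mult)
    from this[of D1 w2, folded w(1)] this[of D2 w1, folded w(2)]
    show "w1 ^ 4 = D1 ^ 4 + w2 ^ 16" "w2 ^ 4 = D2 ^ 4 + w1 ^ 16" .
  qed
  have w5: "w1 ^ 5 + w2 ^ 5 = A"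
    using DA unfolding D1_def D2_def by (simp add: distrib_left distrib_right ac_simps eval_nat_numeral)
  \<comment> \<open>The odd part, grouped into classes 5 and 1 modulo 8.\<close>
  have "(D1 ^ 5 + D2 ^ 5 + G) + (D1 * w2 ^ 16 + D2 * w1 ^ 16 + E) = 0"
    using iffD1[OF bfps_eq_iff DA] unfolding pw A_def by (simp add: distrib_left ac_simps eval_nat_numeral)
  moreover have e16: "supp 8 0 (f ^ 16)" for f
  proof -
    have "f ^ 16 = (f\<^sup>2) ^ 8" by (simp flip: power_mult)
    thus ?thesis using supp_dil[of 8 "f\<^sup>2"] bfps_power8[of "f\<^sup>2"] by simp
  qed
  have "supp 8 5 (f ^ 5)" if "supp 8 1 f" for f
  proof -
    have "f ^ 5 = f * (f * (f * (f * f)))" by (simp add: eval_nat_numeral)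
    thus ?thesis
      using supp_mult[OF that supp_mult[OF that supp_mult[OF that supp_mult[OF that that]]]] by simp
  qed
  hence "supp 8 5 (D1 ^ 5 + D2 ^ 5 + G)" using s1 s2 sG by (intro supp_add)
  moreover have "supp 8 1 (D1 * w2 ^ 16 + D2 * w1 ^ 16 + E)"
    using supp_mult[OF s1 e16[of w2]] supp_mult[OF s2 e16[of w1]] sE by (simp add: supp_add)
  ultimately have "D1 ^ 5 + D2 ^ 5 + G = 0"
    using supp_sep[of 8 5 _ 1] by simp
  hence G5: "D1 ^ 5 + D2 ^ 5 = G" by (rule bfps_eqI)
  have AC: "A = C + C\<^sup>2"
    unfolding AB[symmetric] C bfps_add_square by (simp add: ac_simps flip: power_mult)
  have Dsum: "D = D1 + D2"
    unfolding D1_def D2_def D_ww ww_eq bfps_add_power4 by (simp add: ac_simps)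
  have "D1 * D2 = C + (w1 ^ 5 + w2 ^ 5) + C ^ 4"
    unfolding D1_def D2_def C_def by (simp add: distrib_left distrib_right ac_simps eval_nat_numeral)
  also have "\<dots> = A\<^sup>2" unfolding w5 AC bfps_add_square by (simp add: ac_simps flip: power_mult)
  finally have Dprod: "D1 * D2 = A\<^sup>2" .
  \<comment> \<open>Newton's formula for sum \<open>D\<close> and product
    \<open>A^2\<close>.\<close>
  have GD: "G = D ^ 5 + A\<^sup>2 * D ^ 3 + A ^ 4 * D"
    using bfps_power5_sum[of D1 D2] unfolding G5 Dprod Dsum[symmetric] by (simp flip: power_mult)
  define y w m where "y = yy" and "w = ww" and "m = 1 + w + w\<^sup>2"
  have y: "y = 1 + w" by (simp add: y_def w_def yy_eq)
  have D: "D = w * y * m" unfolding D_ww y m_def w_def[symmetric] by (simp add: algebra_simps eval_nat_numeral)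
  have "w ^ 5 + C * w ^ 3 + C\<^sup>2 * w = C + C\<^sup>2"
    using bfps_power5_sum[of w1 w2] unfolding w5 ww_eq[symmetric] C_def[symmetric] w_def AC by simp
  from iffD1[OF bfps_eq_iff this]
  have "w ^ 5 + (C * w ^ 3 + C\<^sup>2 * w + C + C\<^sup>2) = 0" by (simp add: ac_simps)
  hence h1: "y * C\<^sup>2 = w ^ 5 + y * m * C"
    unfolding y m_def by (intro bfps_eqI[of "(1 + w) * C\<^sup>2"]) (simp add: algebra_simps eval_nat_numeral)
  have h2: "y * A = w ^ 5 + w * y\<^sup>2 * C"
  proof -
    have "y * A = y * C + (w ^ 5 + y * m * C)" by (simp only: AC distrib_left h1)
    also have "\<dots> = w ^ 5 + w * y\<^sup>2 * C" unfolding m_def y by (simp add: algebra_simps eval_nat_numeral)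
    finally show ?thesis .
  qed
  have h3: "y\<^sup>2 * A\<^sup>2 = w ^ 10 + w\<^sup>2 * y ^ 3 * (w ^ 5 + y * m * C)"
  proof -
    have "y\<^sup>2 * A\<^sup>2 = (w ^ 5 + w * y\<^sup>2 * C)\<^sup>2" by (simp only: h2[symmetric] power_mult_distrib)
    also have "\<dots> = w ^ 10 + w\<^sup>2 * y ^ 3 * (y * C\<^sup>2)"
      unfolding bfps_add_square by (simp add: power_mult_distrib ac_simps eval_nat_numeral)
    finally show ?thesis by (simp only: h1)
  qed
  \<comment> \<open>Its square turns \<open>y^8 (D^4 + A^2 D^2 + A^4)\<close>, the cofactor of
    \<open>D\<close> in \<open>y^8 G\<close>, into \<open>D^4 (y^8 + w^8)\<close>, and
    \<open>y + w = 1\<close>.\<close>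
  have key: "y ^ 4 * (A\<^sup>2 + A * D) = D\<^sup>2 * w ^ 4"
  proof -
    have "y ^ 4 * (A\<^sup>2 + A * D) = y\<^sup>2 * (y\<^sup>2 * A\<^sup>2) + y ^ 3 * (y * A) * D"
      by (simp add: distrib_left ac_simps eval_nat_numeral)
    also have "\<dots> = w ^ 6 * y\<^sup>2 * (w ^ 4 + w * y ^ 3 + y\<^sup>2 * m)"
      unfolding h3 h2 D by (simp add: distrib_left distrib_right ac_simps eval_nat_numeral)
    also have "w ^ 4 + w * y ^ 3 + y\<^sup>2 * m = m\<^sup>2"
      unfolding m_def y by (simp add: algebra_simps eval_nat_numeral)
    finally show ?thesis unfolding D by (simp add: power_mult_distrib ac_simps eval_nat_numeral)
  qed
  have "(y ^ 4 * (A\<^sup>2 + A * D))\<^sup>2 = D ^ 4 * w ^ 8"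
    unfolding key by (simp add: power_mult_distrib flip: power_mult)
  moreover have "(y ^ 4 * (A\<^sup>2 + A * D))\<^sup>2 = y ^ 8 * A ^ 4 + y ^ 8 * (A\<^sup>2 * D\<^sup>2)"
    unfolding power_mult_distrib bfps_add_square by (simp add: distrib_left power_mult_distrib flip: power_mult)
  ultimately have h4: "y ^ 8 * A ^ 4 = D ^ 4 * w ^ 8 + y ^ 8 * (A\<^sup>2 * D\<^sup>2)"
    using bfps_eq_add[of "y ^ 8 * A ^ 4" "y ^ 8 * (A\<^sup>2 * D\<^sup>2)" "D ^ 4 * w ^ 8"] by (simp only:)
  have "G * y ^ 8 = y ^ 8 * D ^ 5 + y ^ 8 * (A\<^sup>2 * D\<^sup>2) * D + (y ^ 8 * A ^ 4) * D"
    unfolding GD by (simp add: distrib_left distrib_right ac_simps eval_nat_numeral)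
  also have "\<dots> = D ^ 5 * (y ^ 8 + w ^ 8)"
    unfolding h4 by (simp add: distrib_left distrib_right ac_simps eval_nat_numeral)
  also have "y ^ 8 + w ^ 8 = 1" unfolding y bfps_add_power8 by (simp add: add.assoc)
  finally show ?thesis by (simp add: y_def)
qed

lemmas ring_expand = distrib_left distrib_right ac_simps eval_nat_numeral

lemma bfps_cancel: "a \<noteq> 0 \<Longrightarrow> a * f = a * g \<Longrightarrow> f = (g :: bit fps)"
  by simp

section \<open>Modular equations for \<open>G\<close> at 3 and 7\<close>

lemma D16: "D ^ 16 = D * G ^ 3 + D ^ 4 * G ^ 4"
proof (rule bfps_cancel[of "yy ^ 32"])
  have D8: "D ^ 8 = yy ^ 8 + yy ^ 32" unfolding D_yy bfps_add_power8 by (simp flip: power_mult)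
  have "yy ^ 32 * (D * G ^ 3 + D ^ 4 * G ^ 4) = D * yy ^ 8 * (G * yy ^ 8) ^ 3 + D ^ 4 * (G * yy ^ 8) ^ 4"
    by (simp add: distrib_left power_mult_distrib ac_simps flip: power_mult power_add)
  also have "\<dots> = D ^ 16 * (yy ^ 8 + D ^ 8)"
    unfolding G_eq by (simp add: distrib_left ac_simps flip: power_mult power_add)
      (metis mult.commute power_Suc numeral_eq_Suc pred_numeral_simps(2) semiring_norm(26,27,28))
  also have "\<dots> = D ^ 16 * yy ^ 32" by (simp add: D8)
  finally show "yy ^ 32 * D ^ 16 = yy ^ 32 * (D * G ^ 3 + D ^ 4 * G ^ 4)" by (simp only: mult.commute)
qed (simp add: yy_nonzero)

text \<open>Dividing \<open>(yy + yy^4)^5\<close> by \<open>yy^8\<close> makes \<open>G\<close> a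
  Laurent polynomial in \<open>yy\<close>.\<close>

lemma G_yy: "G = ii ^ 3 + 1 + yy ^ 9 + yy ^ 12"
proof (rule bfps_cancel[of "yy ^ 8"])
  have y3: "yy ^ 8 * ii ^ 3 = yy ^ 5"
  proof -
    have "yy ^ 8 * ii ^ 3 = yy ^ 5 * (yy * ii) ^ 3"
      by (simp add: power_mult_distrib ac_simps flip: power_add)
    thus ?thesis by (simp add: yy_ii)
  qed
  have "yy ^ 8 * G = (yy + yy ^ 4) ^ 5" using G_eq by (simp add: mult.commute flip: D_yy)
  also have "\<dots> = yy ^ 5 + yy ^ 8 + yy ^ 17 + yy ^ 20"
  proof -
    have "(yy + yy ^ 4) ^ 5 = (yy + yy ^ 4) ^ 4 * (yy + yy ^ 4)" by (simp add: eval_nat_numeral ac_simps)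
    thus ?thesis unfolding bfps_add_power4 by (simp add: distrib_left distrib_right flip: power_mult power_add power_Suc power_Suc2)
  qed
  finally show "yy ^ 8 * G = yy ^ 8 * (ii ^ 3 + 1 + yy ^ 9 + yy ^ 12)"
    by (simp add: distrib_left y3 flip: power_add)
qed (simp add: yy_nonzero)

text \<open>All three left sides are symmetric in \<open>yy\<close> and its dilate, hence
  expressible by the symmetric \<open>P\<close> and \<open>s\<close>; the powers of \<open>P\<close>
  clear the negative powers of \<open>yy\<close> in \<open>G\<close>. With \<open>delta3\<close> or
  \<open>delta7\<close> as a further relation, \<open>P\<close> and \<open>s\<close> can be
  eliminated.\<close>

lemma level_one:
  assumes k: "k > 0"
  defines "P \<equiv> yy * dil k yy" and "s \<equiv> yy ^ 4 * dil k yy + yy * dil k yy ^ 4"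
  shows "D * dil k D = P + s + P ^ 4"
    and "P ^ 4 * (G + dil k G) = s + P * s ^ 3 + P ^ 6 * s + s ^ 4"
    and "P ^ 8 * (G * dil k G) = (D * dil k D) ^ 5"
proof -
  let ?y = yy and ?Y = "dil k yy" and ?i = ii and ?j = "dil k ii"
  have D': "dil k D = ?Y + ?Y ^ 4" using k by (simp add: D_yy dil_add dil_power)
  have G': "dil k G = ?j ^ 3 + 1 + ?Y ^ 9 + ?Y ^ 12"
    using k by (simp add: G_yy dil_add dil_power)
  have j: "?Y * ?j = 1" using k yy_ii by (simp flip: dil_mult)
  show "D * dil k D = P + s + P ^ 4"
    unfolding D' P_def s_def unfolding D_yy by (simp add: distrib_left distrib_right power_mult_distrib ac_simps)
  have i3: "P ^ 4 * ?i ^ 3 = ?y * ?Y ^ 4 * (?y * ?i) ^ 3" "P ^ 4 * ?j ^ 3 = ?y ^ 4 * ?Y * (?Y * ?j) ^ 3"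
    unfolding P_def by (simp_all add: ring_expand)
  have "P ^ 4 * (G + dil k G) = P ^ 4 * ?i ^ 3 + P ^ 4 * ?j ^ 3 + P ^ 4 * (?y ^ 9 + ?Y ^ 9) + P ^ 4 * (?y ^ 12 + ?Y ^ 12)"
    unfolding G' unfolding G_yy by (simp add: distrib_left ac_simps)
  also have "P ^ 4 * ?i ^ 3 + P ^ 4 * ?j ^ 3 = s"
    unfolding i3 j yy_ii s_def by (simp add: ac_simps)
  also have "P ^ 4 * (?y ^ 9 + ?Y ^ 9) = P * s ^ 3 + P ^ 6 * s"
    unfolding P_def s_def by (simp add: ring_expand)
  also have "P ^ 4 * (?y ^ 12 + ?Y ^ 12) = s ^ 4"
    unfolding s_def P_def bfps_add_power4 by (simp add: ring_expand)
  finally show "P ^ 4 * (G + dil k G) = s + P * s ^ 3 + P ^ 6 * s + s ^ 4" by (simp add: add.assoc)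
  have "dil k G * ?Y ^ 8 = dil k D ^ 5"
    using arg_cong[OF G_eq, of "dil k"] k by (simp add: dil_mult dil_power)
  hence "(G * ?y ^ 8) * (dil k G * ?Y ^ 8) = (D * dil k D) ^ 5"
    by (simp only: G_eq power_mult_distrib)
  thus "P ^ 8 * (G * dil k G) = (D * dil k D) ^ 5"
    unfolding P_def power_mult_distrib by (simp only: ac_simps)
qed

lemma P_nonzero: "k > 0 \<Longrightarrow> yy * dil k yy \<noteq> 0"
proof -
  assume k: "k > 0"
  have "dil k yy * dil k ii = 1" using k yy_ii by (simp flip: dil_mult)
  thus ?thesis using yy_nonzero by auto
qed

text \<open>\<open>delta3\<close> becomes \<open>s = 1 + P\<close>. Up to powers of
  \<open>P\<close>, sum and product of \<open>G\<close> and its dilate are then the 5th and the 20th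
  power of \<open>1 + P\<close>, so the fourth power of the sum is the product.\<close>

lemma G_modular3: "dil 3 G ^ 4 = G * dil 3 G + G ^ 4"
proof -
  define P s g h where "P = yy * dil 3 yy" and "s = yy ^ 4 * dil 3 yy + yy * dil 3 yy ^ 4"
    and "g = G" and "h = dil 3 G"
  note L = level_one[of 3, OF zero_less_numeral, folded P_def s_def g_def h_def]
  have "P + s + P ^ 4 = (1 + P) ^ 4" using L(1) delta3 by (simp add: P_def)
  hence s: "s = 1 + P"
    unfolding bfps_add_power4 using bfps_eq_add[of s "P + P ^ 4" "1 + P ^ 4"] by (simp add: ac_simps)
  have "P ^ 4 * (g + h) = P\<^sup>2 * (1 + P) ^ 5"
    unfolding L(2) s by (simp add: ring_expand)
  hence "(P ^ 4 * (g + h)) ^ 4 = (P\<^sup>2 * (1 + P) ^ 5) ^ 4" by simp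
  also have "\<dots> = P ^ 8 * ((1 + P) ^ 4) ^ 5" by (simp add: power_mult_distrib flip: power_mult)
  also have "((1 + P) ^ 4) ^ 5 = P ^ 8 * (g * h)"
    unfolding L(3) unfolding delta3 P_def ..
  finally have "P ^ 16 * (g ^ 4 + h ^ 4) = P ^ 16 * (g * h)"
    by (simp add: power_mult_distrib bfps_add_power4 mult.assoc[symmetric] flip: power_mult power_add)
  hence "g ^ 4 + h ^ 4 = g * h"
    using P_nonzero[of 3] by (simp add: P_def)
  thus ?thesis using bfps_eq_add[of "h ^ 4" "g ^ 4" "g * h"] by (simp add: g_def h_def add.commute)
qed

text \<open>With \<open>R = P^8\<close>, \<open>delta7\<close> is the quadratic equation
  \<open>d^2 = d + 1 + R\<close>. Everything is reduced to the form \<open>a + b d\<close> with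
  \<open>a\<close>, \<open>b\<close> polynomials in \<open>R\<close> and compared there.\<close>

lemma G_modular7: "dil 7 G ^ 8 = G\<^sup>2 * (dil 7 G)\<^sup>2 + G * dil 7 G + G ^ 8"
proof -
  define P s g h d where "P = yy * dil 7 yy" and "s = yy ^ 4 * dil 7 yy + yy * dil 7 yy ^ 4"
    and "g = G" and "h = dil 7 G" and "d = D * dil 7 D"
  note L = level_one[of 7, OF zero_less_numeral, folded P_def s_def g_def h_def d_def]
  define R S where "R = P ^ 8" and "S = s ^ 8"
  have "d + d\<^sup>2 = 1 + R" using delta7 unfolding d_def P_def R_def bfps_add_power8 by simp
  hence d2: "d\<^sup>2 = d + 1 + R" using bfps_eq_add[of "d\<^sup>2" d] by (simp add: ac_simps)
  have d4: "d ^ 4 = d + R + R\<^sup>2"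
  proof -
    have "d ^ 4 = (d\<^sup>2)\<^sup>2" by (simp flip: power_mult)
    also have "\<dots> = d\<^sup>2 + 1 + R\<^sup>2" unfolding d2 bfps_add_square by simp
    finally show ?thesis unfolding d2 by (simp add: ac_simps)
  qed
  have d8: "d ^ 8 = d + 1 + R + R\<^sup>2 + R ^ 4"
  proof -
    have "d ^ 8 = (d ^ 4)\<^sup>2" by (simp flip: power_mult)
    also have "\<dots> = d\<^sup>2 + R\<^sup>2 + R ^ 4" unfolding d4 bfps_add_square by (simp flip: power_mult)
    finally show ?thesis unfolding d2 by (simp add: ac_simps)
  qed
  have "s = d + P + P ^ 4" using L(1) by (simp add: ac_simps)
  hence "S = d ^ 8 + R + R ^ 4" unfolding S_def R_def by (simp add: bfps_add_power8 flip: power_mult)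
  hence S: "S = d + 1 + R\<^sup>2" unfolding d8 by (simp add: ac_simps)
  have S2: "S\<^sup>2 = d + R + R ^ 4"
    unfolding S bfps_add_square d2 by (simp add: ac_simps flip: power_mult)
  have S4: "S ^ 4 = d + 1 + R + R\<^sup>2 + R ^ 8"
  proof -
    have "S ^ 4 = (S\<^sup>2)\<^sup>2" by (simp flip: power_mult)
    also have "\<dots> = d\<^sup>2 + R\<^sup>2 + R ^ 8" unfolding S2 bfps_add_square by (simp flip: power_mult)
    finally show ?thesis unfolding d2 by (simp add: ac_simps)
  qed
  have S3: "S ^ 3 = (R + R\<^sup>2 + R ^ 4) * d + 1 + R ^ 3 + R ^ 4 + R ^ 6"
  proof -
    have "S ^ 3 = S\<^sup>2 * S" by (simp add: eval_nat_numeral ac_simps)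
    also have "\<dots> = d\<^sup>2 + d * (1 + R\<^sup>2 + R + R ^ 4) + (R + R ^ 4) * (1 + R\<^sup>2)"
      unfolding S2 unfolding S by (simp add: ring_expand)
    finally show ?thesis unfolding d2 by (simp add: ring_expand)
  qed
  have d5: "d ^ 5 = d + 1 + R + (R + R\<^sup>2) * d"
  proof -
    have "d ^ 5 = d ^ 4 * d" by (simp add: eval_nat_numeral ac_simps)
    also have "\<dots> = d\<^sup>2 + (R + R\<^sup>2) * d" unfolding d4 by (simp add: ring_expand)
    finally show ?thesis unfolding d2 .
  qed
  have d10: "d ^ 10 = (1 + R\<^sup>2 + R ^ 4) * (d + 1 + R) + 1 + R\<^sup>2"
  proof -
    have "d ^ 10 = (d ^ 5)\<^sup>2" by (simp flip: power_mult)
    also have "\<dots> = (1 + R\<^sup>2 + R ^ 4) * d\<^sup>2 + 1 + R\<^sup>2"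
      unfolding d5 bfps_add_square power_mult_distrib by (simp add: ring_expand)
    finally show ?thesis unfolding d2 .
  qed
  have "R ^ 4 * (g + h) ^ 8 = (P ^ 4 * (g + h)) ^ 8"
    by (simp add: R_def power_mult_distrib flip: power_mult)
  also have "\<dots> = S + R * S ^ 3 + R ^ 6 * S + S ^ 4"
    unfolding L(2) bfps_add_power8 power_mult_distrib R_def S_def by (simp flip: power_mult)
  also have "\<dots> = R ^ 3 * d ^ 5 + R\<^sup>2 * d ^ 10"
    unfolding S3 S4 d5 d10 unfolding S by (simp add: ring_expand)
  also have "\<dots> = R ^ 3 * (R * (g * h)) + R\<^sup>2 * (R * (g * h))\<^sup>2"
    using L(3) by (simp add: R_def flip: power_mult)
  also have "\<dots> = R ^ 4 * (g * h + (g * h)\<^sup>2)" by (simp add: ring_expand)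
  finally have "(g + h) ^ 8 = g * h + (g * h)\<^sup>2"
    using P_nonzero[of 7] by (simp add: R_def P_def)
  hence "h ^ 8 + g ^ 8 = g * h + (g * h)\<^sup>2" by (simp add: bfps_add_power8 add.commute)
  from bfps_eq_add[OF this] show ?thesis by (simp add: g_def h_def power_mult_distrib ac_simps)
qed

subsection \<open>Hecke operators and modular equations\<close>

definition Up :: "nat \<Rightarrow> bit fps \<Rightarrow> bit fps" where
  "Up p f = Abs_fps (\<lambda>n. f $ (p * n))"

lemma Tp_eq: "p > 0 \<Longrightarrow> Tp p f = Up p f + dil p f"
  by (rule fps_ext) (simp add: Tp_def Up_def dil_nth)

lemma Up_add: "Up p (f + g) = Up p f + Up p g"
  by (rule fps_ext) (simp add: Up_def)

lemma Up_0 [simp]: "Up p 0 = 0"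
  by (rule fps_ext) (simp add: Up_def)

text \<open>Only indices divisible by \<open>p\<close> survive in the dilated factor.\<close>

lemma Up_dil_mult:
  assumes p: "p > 0"
  shows "Up p (dil p g * f) = g * Up p f"
proof (rule fps_ext)
  fix n
  have "Up p (dil p g * f) $ n = (\<Sum>i=0..p * n. dil p g $ i * f $ (p * n - i))"
    by (simp add: Up_def fps_mult_nth)
  also have "\<dots> = (\<Sum>i\<in>(*) p ` {0..n}. dil p g $ i * f $ (p * n - i))"
    using p by (intro sum.mono_neutral_right) (auto simp: dil_nth elim!: dvdE)
  also have "\<dots> = (\<Sum>i=0..n. dil p g $ (p * i) * f $ (p * n - p * i))"
    using p by (subst sum.reindex) (auto simp: inj_on_def)
  also have "\<dots> = (g * Up p f) $ n"
    using p by (simp add: fps_mult_nth Up_def dil_nth right_diff_distrib' )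
  finally show "Up p (dil p g * f) $ n = (g * Up p f) $ n" .
qed

lemma Tp_add: "Tp p (f + g) = Tp p f + Tp p g"
  by (rule fps_ext) (simp add: Tp_def add.assoc add.left_commute)

lemma Tp_0 [simp]: "Tp p 0 = 0"
  by (rule fps_ext) (simp add: Tp_def)

text \<open>Squaring is dilation by 2, which commutes with both summands of \<open>Tp p\<close>
  because \<open>p\<close> is odd.\<close>

lemma Tp_square:
  assumes "odd p"
  shows "Tp p (f\<^sup>2) = (Tp p f)\<^sup>2"
proof (rule fps_ext)
  fix n
  have p: "p > 0" using assms by (simp add: odd_pos)
  have "p * n div 2 = p * (n div 2)" "p dvd n \<Longrightarrow> n div 2 div p = n div p div 2" if "even n"
    using that by (auto simp: div_mult2_eq[symmetric] mult.commute elim!: evenE)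
  moreover have "even (n div p) \<longleftrightarrow> even n" if "p dvd n"
  proof -
    from that obtain m where "n = p * m" ..
    thus ?thesis using assms p by simp
  qed
  moreover have "p dvd n div 2 \<longleftrightarrow> p dvd n" if "even n"
  proof -
    from that obtain m where "n = 2 * m" ..
    moreover have "coprime p 2" using assms by simp
    ultimately show ?thesis by (simp add: coprime_dvd_mult_right_iff)
  qed
  ultimately show "Tp p (f\<^sup>2) $ n = (Tp p f)\<^sup>2 $ n"
    using assms unfolding bfps_square[of f] bfps_square[of "Tp p f"]
    by (auto simp: Tp_def dil_nth)
qed

lemma Tp_power4: "odd p \<Longrightarrow> Tp p (f ^ 4) = Tp p f ^ 4"
  using Tp_square[of p "f\<^sup>2"] Tp_square[of p f] by (simp flip: power_mult)

lemma Tp_power8: "odd p \<Longrightarrow> Tp p (f ^ 8) = Tp p f ^ 8"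
  using Tp_square[of p "f ^ 4"] Tp_power4[of p f] by (simp flip: power_mult)

lemma Tp_power16: "odd p \<Longrightarrow> Tp p (f ^ 16) = Tp p f ^ 16"
  using Tp_square[of p "f ^ 8"] Tp_power8[of p f] by (simp flip: power_mult)

text \<open>A symmetric algebraic relation between \<open>x\<close>-series and their images under \<open>x \<mapsto> x^p\<close>
  becomes a linear recurrence for \<^term>\<open>Tp p\<close>.\<close>
lemma Tp_relation:
  assumes "p > 0" "(\<Sum>(a, b)\<leftarrow>xs. a * dil p b) = 0" "(\<Sum>(a, b)\<leftarrow>xs. dil p a * b) = 0"
  shows "(\<Sum>(a, b)\<leftarrow>xs. a * Tp p (b * f)) = 0"
proof -
  \<comment> \<open>The part \<open>dil p\<close> of the operator consumes the relation itself, the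
    part \<open>Up p\<close> its mirror image; hence the two assumptions.\<close>
  have "(\<Sum>(a, b)\<leftarrow>xs. a * Tp p (b * f))
      = Up p ((\<Sum>(a, b)\<leftarrow>xs. dil p a * b) * f) + (\<Sum>(a, b)\<leftarrow>xs. a * dil p b) * dil p f"
  proof (induction xs)
    case Nil
    show ?case by simp
  next
    case (Cons ab xs)
    obtain a b where ab: "ab = (a, b)" by force
    have "a * Tp p (b * f) = Up p (dil p a * b * f) + a * dil p b * dil p f"
      using assms(1) Up_dil_mult[of p a "b * f"]
      by (simp add: Tp_eq dil_mult distrib_left mult.assoc)
    thus ?case using Cons ab by (simp add: Up_add distrib_right distrib_left ac_simps)
  qed
  thus ?thesis using assms by simp
qed

lemma Tp_commute:
  assumes "coprime p q" "p > 0" "q > 0"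
  shows "Tp p (Tp q f) = Tp q (Tp p f)"
proof (rule fps_ext)
  fix n
  have *: "p dvd q * n \<longleftrightarrow> p dvd n" "q dvd p * n \<longleftrightarrow> q dvd n"
    using assms(1) by (simp_all add: coprime_dvd_mult_right_iff coprime_commute)
  have d1: "q * n div p = q * (n div p)" if "p dvd n" using that by (simp add: div_mult_swap)
  have d2: "p * n div q = p * (n div q)" if "q dvd n" using that by (simp add: div_mult_swap)
  have d3: "q dvd n div p \<longleftrightarrow> q dvd n" if "p dvd n"
  proof -
    from that obtain m where "n = p * m" ..
    thus ?thesis using assms coprime_dvd_mult_right_iff[of q p m] by (simp add: coprime_commute)
  qed
  have d4: "p dvd n div q \<longleftrightarrow> p dvd n" if "q dvd n"
  proof -
    from that obtain m where "n = q * m" ..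
    thus ?thesis using assms coprime_dvd_mult_right_iff[of p q m] by simp
  qed
  have d5: "n div p div q = n div q div p" by (simp add: div_mult2_eq[symmetric] mult.commute)
  show "Tp p (Tp q f) $ n = Tp q (Tp p f) $ n"
    by (cases "p dvd n"; cases "q dvd n") (simp_all add: Tp_def * d1 d2 d3 d4 d5 mult.left_commute[of p q n] add_ac)
qed

text \<open>For prime \<open>p\<close>, \<open>p n\<close> is a square exactly when
  \<open>n / p\<close> is one, and \<open>p \<noteq> 5\<close> keeps the condition at 5 intact. The
  two summands of \<open>Tp p\<close> thus coincide and cancel modulo 2.\<close>

lemma Tp_yy:
  assumes "prime p" "p \<noteq> 5"
  shows "Tp p yy = 0"
proof (rule fps_ext)
  fix n
  have p: "p > 0" using assms prime_gt_0_nat by blast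
  have five: "5 dvd p * m \<longleftrightarrow> 5 dvd m" for m
    using assms primes_dvd_imp_eq[of 5 p] by (auto simp: prime_dvd_mult_iff)
  have "(\<exists>a. (a = 0 \<or> \<not> 5 dvd a) \<and> p * n = a\<^sup>2) \<longleftrightarrow>
      p dvd n \<and> (\<exists>a. (a = 0 \<or> \<not> 5 dvd a) \<and> n div p = a\<^sup>2)" (is "?L \<longleftrightarrow> ?R")
  proof
    assume ?L
    then obtain a where a: "a = 0 \<or> \<not> 5 dvd a" "p * n = a\<^sup>2" by blast
    hence "p dvd a" using assms(1) by (metis dvd_triv_left prime_dvd_power)
    then obtain b where b: "a = p * b" by auto
    hence "n = p * b\<^sup>2" using a(2) p by (simp add: power2_eq_square)
    thus ?R using a b p five by auto
  next
    assume ?R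
    then obtain a m where a: "a = 0 \<or> \<not> 5 dvd a" "n div p = a\<^sup>2" and "n = p * m" by blast
    hence "n = p * a\<^sup>2" using p by simp
    hence "p * n = (p * a)\<^sup>2" by (simp add: power2_eq_square)
    thus ?L using a five by (intro exI[of _ "p * a"]) auto
  qed
  thus "Tp p yy $ n = (0::bit fps) $ n" by (auto simp: Tp_def yy_def sqs_nth)
qed

lemma Tp_1: "p > 0 \<Longrightarrow> Tp p 1 = 0"
  by (rule fps_ext) (auto simp: Tp_def)

abbreviation "T3 \<equiv> Tp 3"
abbreviation "T7 \<equiv> Tp 7"

lemma dil_D: "k > 0 \<Longrightarrow> dil k D = dil k yy + dil k yy ^ 4"
  by (simp add: D_yy dil_add dil_power)

text \<open>\<open>delta3\<close> read as a polynomial in \<open>dil 3 yy\<close>;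
  \<open>yY3'\<close> is the mirror image demanded by \<open>Tp_relation\<close>.\<close>

lemma yY3: "yy * dil 3 yy ^ 4 + (D * dil 3 yy + 1) = 0"
proof -
  have "yy * dil 3 yy ^ 4 + (D * dil 3 yy + 1) = D * dil 3 D + (1 + yy * dil 3 yy) ^ 4"
    unfolding bfps_add_power4 dil_D[OF zero_less_numeral] unfolding D_yy
    by (simp add: distrib_left distrib_right power_mult_distrib ac_simps)
  thus ?thesis by (simp add: delta3)
qed

lemma yY3': "dil 3 yy * yy ^ 4 + (dil 3 D * yy + 1) = 0"
proof -
  have "dil 3 yy * yy ^ 4 + (dil 3 D * yy + 1) = D * dil 3 D + (1 + yy * dil 3 yy) ^ 4"
    unfolding bfps_add_power4 dil_D[OF zero_less_numeral] unfolding D_yy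
    by (simp add: distrib_left distrib_right power_mult_distrib ac_simps)
  thus ?thesis by (simp add: delta3)
qed

lemma T3_yy: "yy * T3 (yy ^ 4 * f) = D * T3 (yy * f) + T3 f"
proof -
  have "(\<Sum>(a, b)\<leftarrow>[(yy, yy ^ 4), (D, yy), (1, 1)]. a * T3 (b * f)) = 0"
    by (rule Tp_relation) (use yY3 yY3' in \<open>simp_all add: dil_power\<close>)
  thus ?thesis by (simp add: bfps_eqI)
qed

lemma yY7: "yy\<^sup>2 * dil 7 yy ^ 8 + (D * dil 7 yy ^ 4 + (D\<^sup>2 * (dil 7 yy)\<^sup>2 + (D * dil 7 yy + 1))) = 0"
proof -
  have "yy\<^sup>2 * dil 7 yy ^ 8 + (D * dil 7 yy ^ 4 + (D\<^sup>2 * (dil 7 yy)\<^sup>2 + (D * dil 7 yy + 1)))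
     = D * dil 7 D + (D * dil 7 D)\<^sup>2 + (1 + yy * dil 7 yy) ^ 8"
    unfolding bfps_add_power8 power_mult_distrib dil_D[OF zero_less_numeral] bfps_add_square
    unfolding D_yy bfps_add_square
    by (simp add: distrib_left distrib_right power_mult_distrib ac_simps flip: power_mult)
  thus ?thesis by (simp add: delta7)
qed

lemma yY7': "(dil 7 yy)\<^sup>2 * yy ^ 8 + (dil 7 D * yy ^ 4 + ((dil 7 D)\<^sup>2 * yy\<^sup>2 + (dil 7 D * yy + 1))) = 0"
proof -
  have "(dil 7 yy)\<^sup>2 * yy ^ 8 + (dil 7 D * yy ^ 4 + ((dil 7 D)\<^sup>2 * yy\<^sup>2 + (dil 7 D * yy + 1)))
     = D * dil 7 D + (D * dil 7 D)\<^sup>2 + (1 + yy * dil 7 yy) ^ 8"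
    unfolding bfps_add_power8 power_mult_distrib dil_D[OF zero_less_numeral] bfps_add_square
    unfolding D_yy bfps_add_square
    by (simp add: distrib_left distrib_right power_mult_distrib ac_simps flip: power_mult)
  thus ?thesis by (simp add: delta7)
qed

lemma T7_yy: "T7 f = yy\<^sup>2 * T7 (yy ^ 8 * f) + (D * T7 (yy ^ 4 * f) + (D\<^sup>2 * T7 (yy\<^sup>2 * f) + D * T7 (yy * f)))"
proof -
  have "(\<Sum>(a, b)\<leftarrow>[(yy\<^sup>2, yy ^ 8), (D, yy ^ 4), (D\<^sup>2, yy\<^sup>2), (D, yy), (1, 1)]. a * T7 (b * f)) = 0"
    by (rule Tp_relation) (use yY7 yY7' in \<open>simp_all add: dil_power\<close>)
  hence "T7 f + (yy\<^sup>2 * T7 (yy ^ 8 * f) + (D * T7 (yy ^ 4 * f) + (D\<^sup>2 * T7 (yy\<^sup>2 * f) + D * T7 (yy * f)))) = 0"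
    by (simp add: ac_simps)
  thus ?thesis by (rule bfps_eqI)
qed

lemma T7_yy8: "T7 (yy ^ 8 * f) = ii\<^sup>2 * (D * T7 (yy ^ 4 * f) + D\<^sup>2 * T7 (yy\<^sup>2 * f) + D * T7 (yy * f) + T7 f)"
proof -
  have i: "ii\<^sup>2 * (yy\<^sup>2 * g) = g" for g
    by (metis mult.assoc mult_1 power_mult_distrib power_one yy_ii(2))
  have "ii\<^sup>2 * (D * T7 (yy ^ 4 * f) + D\<^sup>2 * T7 (yy\<^sup>2 * f) + D * T7 (yy * f) + T7 f)
    = ii\<^sup>2 * (yy\<^sup>2 * T7 (yy ^ 8 * f))"
    by (subst (4) T7_yy) (simp add: ac_simps)
  thus ?thesis by (simp only: i)
qed

lemma T3_G: "T3 (G ^ 4 * f) = G * T3 (G * f) + G ^ 4 * T3 f"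
proof -
  have "(\<Sum>(a, b)\<leftarrow>[(1, G ^ 4), (G, G), (G ^ 4, 1)]. a * T3 (b * f)) = 0"
    by (rule Tp_relation) (simp_all add: dil_power G_modular3 ac_simps)
  thus ?thesis by (simp add: bfps_eqI)
qed

lemma T3_G2: "T3 (G ^ 8 * f) = G\<^sup>2 * T3 (G\<^sup>2 * f) + G ^ 8 * T3 f"
proof -
  have "dil 3 G ^ 8 = (dil 3 G ^ 4)\<^sup>2" by (simp flip: power_mult)
  hence "dil 3 G ^ 8 = G\<^sup>2 * (dil 3 G)\<^sup>2 + G ^ 8"
    unfolding G_modular3 bfps_add_square by (simp add: power_mult_distrib flip: power_mult)
  hence "(\<Sum>(a, b)\<leftarrow>[(1, G ^ 8), (G\<^sup>2, G\<^sup>2), (G ^ 8, 1)]. a * T3 (b * f)) = 0"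
    by (intro Tp_relation) (simp_all add: dil_power ac_simps)
  thus ?thesis by (simp add: bfps_eqI)
qed

lemma T3_G4: "T3 (G ^ 16 * f) = G ^ 4 * T3 (G ^ 4 * f) + G ^ 16 * T3 f"
proof -
  have "dil 3 G ^ 16 = (dil 3 G ^ 4) ^ 4" by (simp flip: power_mult)
  hence "dil 3 G ^ 16 = G ^ 4 * dil 3 G ^ 4 + G ^ 16"
    unfolding G_modular3 bfps_add_power4 by (simp add: power_mult_distrib flip: power_mult G_modular3)
  hence "(\<Sum>(a, b)\<leftarrow>[(1, G ^ 16), (G ^ 4, G ^ 4), (G ^ 16, 1)]. a * T3 (b * f)) = 0"
    by (intro Tp_relation) (simp_all add: dil_power ac_simps)
  thus ?thesis by (simp add: bfps_eqI)
qed

lemma T7_G: "T7 (G ^ 8 * f) = G\<^sup>2 * T7 (G\<^sup>2 * f) + G * T7 (G * f) + G ^ 8 * T7 f"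
proof -
  have "(\<Sum>(a, b)\<leftarrow>[(1, G ^ 8), (G\<^sup>2, G\<^sup>2), (G, G), (G ^ 8, 1)]. a * T7 (b * f)) = 0"
    by (rule Tp_relation) (simp_all add: dil_power G_modular7 ac_simps)
  hence "T7 (G ^ 8 * f) + (G\<^sup>2 * T7 (G\<^sup>2 * f) + G * T7 (G * f) + G ^ 8 * T7 f) = 0" by (simp add: add.assoc)
  thus ?thesis by (rule bfps_eqI)
qed

lemma T7_G2: "T7 (G ^ 16 * f) = G ^ 4 * T7 (G ^ 4 * f) + G\<^sup>2 * T7 (G\<^sup>2 * f) + G ^ 16 * T7 f"
proof -
  have "dil 7 G ^ 16 = (dil 7 G ^ 8)\<^sup>2" by (simp flip: power_mult)
  hence "dil 7 G ^ 16 = G ^ 4 * dil 7 G ^ 4 + G\<^sup>2 * (dil 7 G)\<^sup>2 + G ^ 16"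
    unfolding G_modular7 bfps_add_square by (simp add: power_mult_distrib flip: power_mult)
  hence "(\<Sum>(a, b)\<leftarrow>[(1, G ^ 16), (G ^ 4, G ^ 4), (G\<^sup>2, G\<^sup>2), (G ^ 16, 1)]. a * T7 (b * f)) = 0"
    by (intro Tp_relation) (simp_all add: dil_power ac_simps)
  hence "T7 (G ^ 16 * f) + (G ^ 4 * T7 (G ^ 4 * f) + G\<^sup>2 * T7 (G\<^sup>2 * f) + G ^ 16 * T7 f) = 0" by (simp add: add.assoc)
  thus ?thesis by (rule bfps_eqI)
qed

lemma T_yy_powers:
  assumes "p \<in> {3, 7}"
  shows "Tp p 1 = 0" "Tp p yy = 0" "Tp p (yy\<^sup>2) = 0" "Tp p (yy ^ 4) = 0" "Tp p (yy ^ 8) = 0"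
    "Tp p (yy ^ 16) = 0" "Tp p D = 0"
proof -
  have p: "odd p" "prime p" "p \<noteq> 5" "p > 0" using assms by auto
  show "Tp p 1 = 0" "Tp p yy = 0" using p by (simp_all add: Tp_1 Tp_yy)
  thus "Tp p (yy\<^sup>2) = 0" "Tp p (yy ^ 4) = 0" "Tp p (yy ^ 8) = 0" "Tp p (yy ^ 16) = 0"
    using p by (simp_all add: Tp_square Tp_power4 Tp_power8 Tp_power16)
  thus "Tp p D = 0" using \<open>Tp p yy = 0\<close> by (simp add: D_yy Tp_add)
qed

lemmas T3_yy_powers = T_yy_powers[of 3, simplified]
lemmas T7_yy_powers = T_yy_powers[of 7, simplified]

lemma ww_nth1: "ww $ 1 = 1"
proof -
  have "\<exists>a\<in>{m::nat. \<not> 5 dvd m}. 1 = a\<^sup>2" by (rule bexI[of _ 1]) auto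
  thus ?thesis by (simp add: ww_def sqs_nth)
qed

text \<open>\<open>ww\<close> starts with \<open>x\<close>. This excludes the root 0 of the
  quadratic equations for \<open>T3 (yy ^ 3)\<close> and \<open>T7 (yy ^ 7)\<close>.\<close>

lemma Tp_ww_power: "p > 1 \<Longrightarrow> Tp p (ww ^ p) $ 1 = 1"
  using startsby_zero_power_nth_same[of ww p] ww_nth1 by (simp add: Tp_def w12_nth0)

lemma ww_yy: "ww = 1 + yy"
  by (simp add: yy_eq)

lemma yy_ii_power: "yy ^ n * ii ^ n = 1" "ii ^ n * yy ^ n = 1"
  by (simp_all add: yy_ii flip: power_mult_distrib)

lemma yy_ii_ge: "b \<le> a \<Longrightarrow> yy ^ a * ii ^ b = yy ^ (a - b)"
  using power_add[of yy "a - b" b] yy_ii_power(1)[of b] by (simp add: mult.assoc)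

lemma yy_ii_le: "a \<le> b \<Longrightarrow> yy ^ a * ii ^ b = ii ^ (b - a)"
  using power_add[of ii a "b - a"] yy_ii_power(1)[of a] by (simp flip: mult.assoc)

lemma yy_ii_simps [simp]: "yy * (ii * f) = f" "ii * (yy * f) = f"
  by (simp_all add: mult.assoc[symmetric] yy_ii)

lemma T3_yy3: "yy * T3 (yy ^ 3) = D"
proof -
  \<comment> \<open>The recurrence at \<open>yy^2\<close>. By Frobenius its left side contains the
    square of \<open>T3 (yy ^ 3)\<close>, so the candidates are 0 and \<open>D / yy\<close>.\<close>
  have "yy * T3 (yy ^ 6) = D * T3 (yy ^ 3)"
    using T3_yy[of "yy\<^sup>2"] by (simp add: T3_yy_powers flip: power_add power_Suc)
  moreover have "T3 (yy ^ 6) = (T3 (yy ^ 3))\<^sup>2"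
    using Tp_square[of 3 "yy ^ 3"] by (simp flip: power_mult)
  ultimately have "T3 (yy ^ 3) * (yy * T3 (yy ^ 3)) = T3 (yy ^ 3) * D"
    by (simp add: power2_eq_square ac_simps)
  moreover have "T3 (yy ^ 3) \<noteq> 0"
  proof -
    have "ww ^ 3 = 1 + yy + yy\<^sup>2 + yy ^ 3" unfolding ww_yy by (simp add: ring_expand)
    hence "T3 (ww ^ 3) = T3 (yy ^ 3)" by (simp add: Tp_add T3_yy_powers)
    thus ?thesis using Tp_ww_power[of 3] by auto
  qed
  ultimately show ?thesis by simp
qed

lemma T3_ii: "T3 ii = D"
proof -
  have "yy ^ 4 * ii = yy ^ 3" using yy_ii_ge[of 1 4] by simp
  thus ?thesis using T3_yy[of ii] T3_yy3 by (simp add: yy_ii T3_yy_powers)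
qed

lemma T3_yy5: "T3 (yy ^ 5) = 0"
  using T3_yy[of yy] by (simp add: T3_yy_powers yy_nonzero power2_eq_square[symmetric] flip: power_Suc2)

text \<open>\<open>G D = D^6 / yy^8\<close> is the square of \<open>D^3 / yy^4\<close>, so Frobenius
  leaves only Laurent monomials of small degree to evaluate.\<close>

lemma GD_square: "G * D = (ii + yy\<^sup>2 + yy ^ 5 + yy ^ 8)\<^sup>2"
proof (rule bfps_cancel[of "yy ^ 8"])
  have "yy ^ 8 * (G * D) = D ^ 6" using G_eq by (simp add: eval_nat_numeral ac_simps)
  also have "\<dots> = (D ^ 3)\<^sup>2" by (simp flip: power_mult)
  also have "D ^ 3 = yy ^ 4 * (ii + yy\<^sup>2 + yy ^ 5 + yy ^ 8)"
    unfolding D_yy by (simp add: ring_expand yy_ii)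
  finally show "yy ^ 8 * (G * D) = yy ^ 8 * (ii + yy\<^sup>2 + yy ^ 5 + yy ^ 8)\<^sup>2"
    by (simp add: power_mult_distrib flip: power_mult)
qed (simp add: yy_nonzero)

lemma T3_GD: "T3 (G * D) = D\<^sup>2"
  unfolding GD_square by (simp add: Tp_square Tp_add T3_yy_powers T3_ii T3_yy5)

lemma D_nth1: "D $ 1 = 1"
proof -
  have "\<exists>a\<in>{m::nat. \<not> 5 dvd m \<and> odd m}. 1 = a\<^sup>2" by (rule bexI[of _ 1]) auto
  thus ?thesis by (simp add: D_sqs sqs_nth)
qed

lemma D_nonzero: "D \<noteq> 0"
  using D_nth1 by auto

lemma G_nonzero: "G \<noteq> 0"
  using G_eq D_nonzero by auto

lemma D16_sum: "G ^ 3 * D = D ^ 16 + G ^ 4 * D ^ 4"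
  by (simp add: D16 add.assoc mult.commute)

lemma D32: "D ^ 32 = D\<^sup>2 * G ^ 6 + D ^ 8 * G ^ 8"
proof -
  have "D ^ 32 = (D ^ 16)\<^sup>2" by (simp flip: power_mult)
  thus ?thesis unfolding D16 bfps_add_square by (simp add: power_mult_distrib flip: power_mult)
qed

subsection \<open>Values of the Hecke operators\<close>

lemma G_cancel: "G * f = G * g \<Longrightarrow> f = g"
  using G_nonzero by simp

lemma T3_step: "T3 (G ^ (i + 4) * f) = G * T3 (G ^ (i + 1) * f) + G ^ 4 * T3 (G ^ i * f)"
  using T3_G[of "G ^ i * f"] by (simp add: power_add ac_simps)

lemma T7_step: "T7 (G ^ (i + 8) * f) = G\<^sup>2 * T7 (G ^ (i + 2) * f) + G * T7 (G ^ (i + 1) * f) + G ^ 8 * T7 (G ^ i * f)"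
  using T7_G[of "G ^ i * f"] by (simp add: power_add power2_eq_square ac_simps)

text \<open>The engine of the computation: doubled exponents reduce to the original ones, and the
  recurrences \<open>T3_step\<close> and \<open>T7_step\<close> pass from there to odd powers of
  \<open>G\<close>.\<close>

lemma Tp_frob:
  assumes "odd p"
  shows "Tp p (G ^ (2 * i) * D ^ (2 * j)) = (Tp p (G ^ i * D ^ j))\<^sup>2"
  using Tp_square[OF assms, of "G ^ i * D ^ j"] by (simp add: power_mult_distrib mult.commute flip: power_mult)

lemma D16_sq: "D ^ 16 = G ^ 3 * D + G ^ 4 * D ^ 4"
  using D16 by (simp add: mult.commute)

text \<open>This is \<open>D_3\<close>, without the division by \<open>G\<close>; see \<open>G_dd3\<close> below.\<close>
definition dd3 :: "bit fps" where "dd3 = D ^ 3 * yy ^ 8"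

lemma G_dd3: "G * dd3 = D ^ 8"
proof -
  have "G * dd3 = D ^ 3 * (G * yy ^ 8)" by (simp add: dd3_def ac_simps)
  thus ?thesis by (simp add: G_eq flip: power_add)
qed

lemma dd3_sq: "G\<^sup>2 * dd3\<^sup>2 = G ^ 3 * D + G ^ 4 * D ^ 4"
proof -
  have "G\<^sup>2 * dd3\<^sup>2 = (G * dd3)\<^sup>2" by (simp add: power_mult_distrib)
  thus ?thesis by (simp add: G_dd3 D16_sq flip: power_mult)
qed

lemma T3_G3D: "T3 (G ^ 3 * D) = D ^ 8"
  unfolding D16_sum Tp_add
  using Tp_power16[of 3 D] Tp_power4[of 3 "G * D"] T3_GD
  by (simp add: T3_yy_powers power_mult_distrib flip: power_mult)

text \<open>\<open>T3 (G^16 D^16)\<close> is computed once by Frobenius and once by replacing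
  \<open>D^16\<close> and using the recurrences. Everything cancels except the fourth power of the
  unknown.\<close>

lemma T3_G2D: "T3 (G\<^sup>2 * D) = 0"
proof -
  let ?x = "T3 (G\<^sup>2 * D)"
  have "T3 (G ^ 16 * D ^ 16) = D ^ 32"
    using Tp_power16[of 3 "G * D"] T3_GD by (simp add: power_mult_distrib flip: power_mult)
  moreover have "G ^ 16 * D ^ 16 = G ^ 16 * (G ^ 3 * D) + G ^ 20 * D ^ 4"
    unfolding D16_sq distrib_left by (simp add: mult.assoc[symmetric] flip: power_add)
  ultimately have "D ^ 32 = T3 (G ^ 16 * (G ^ 3 * D)) + T3 (G ^ 20 * D ^ 4)" by (simp add: Tp_add)
  also have "T3 (G ^ 16 * (G ^ 3 * D)) = G ^ 4 * T3 (G ^ 7 * D) + G ^ 16 * D ^ 8"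
    using T3_G4[of "G ^ 3 * D"] T3_G3D by (simp add: mult.assoc[symmetric] flip: power_add)
  also have "T3 (G ^ 7 * D) = G * (G * D\<^sup>2) + G ^ 4 * D ^ 8"
    using T3_step[of 3 D] T3_step[of 0 D] by (simp add: T3_G3D T3_GD T3_yy_powers)
  also have "T3 (G ^ 20 * D ^ 4) = (G * ?x + G ^ 4 * D\<^sup>2) ^ 4"
    using Tp_power4[of 3 "G ^ 5 * D"] T3_step[of 1 D]
    by (simp add: T3_GD power_mult_distrib power2_eq_square flip: power_mult)
  finally have "G ^ 4 * ?x ^ 4 = 0"
    unfolding D32 bfps_add_power4
    by (simp add: ring_expand)
  thus ?thesis using G_nonzero by simp
qed

text \<open>The pattern of many values below: \<open>G^4 D^2\<close> is a square with known image,
  and the recurrence divides out a factor \<open>G\<close>.\<close>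

lemma T3_G1D2: "T3 (G * D\<^sup>2) = 0"
  using T3_step[of 0 "D\<^sup>2"] Tp_frob[of 3 2 1] by (simp add: T3_G2D T3_yy_powers Tp_square G_nonzero)

lemma T3_G2D2: "T3 (G\<^sup>2 * D\<^sup>2) = D ^ 4"
  using Tp_frob[of 3 1 1] by (simp add: T3_GD flip: power_mult)

lemma T3_G3D2: "T3 (G ^ 3 * D\<^sup>2) = G\<^sup>2 * D"
proof (rule G_cancel)
  have "T3 (G ^ 6 * D\<^sup>2) = D ^ 16" using Tp_frob[of 3 3 1] by (simp add: T3_G3D flip: power_mult)
  hence "G * T3 (G ^ 3 * D\<^sup>2) + G ^ 4 * D ^ 4 = D ^ 16"
    using T3_step[of 2 "D\<^sup>2"] by (simp add: T3_G2D2)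
  from bfps_eq_add[OF this] show "G * T3 (G ^ 3 * D\<^sup>2) = G * (G\<^sup>2 * D)"
    unfolding D16_sq by (simp add: ring_expand)
qed

lemma T3_G4D2: "T3 (G ^ 4 * D\<^sup>2) = 0"
  using Tp_frob[of 3 2 1] by (simp add: T3_G2D)

lemma T3_G2D4: "T3 (G\<^sup>2 * D ^ 4) = 0"
  using Tp_frob[of 3 1 2] by (simp add: T3_G1D2)

lemma T3_G4D4: "T3 (G ^ 4 * D ^ 4) = G * dd3"
  using Tp_frob[of 3 2 2] by (simp add: T3_G2D2 G_dd3 flip: power_mult)

lemma T3_G1D4: "T3 (G * D ^ 4) = dd3"
  by (rule G_cancel) (use T3_step[of 0 "D ^ 4"] T3_G4D4 in \<open>auto simp: T3_yy_powers Tp_power4\<close>)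

lemma T3_G3D4: "T3 (G ^ 3 * D ^ 4) = G ^ 3 * D\<^sup>2"
proof (rule G_cancel)
  have "T3 (G ^ 6 * D ^ 4) = G ^ 4 * D\<^sup>2"
    using Tp_frob[of 3 3 2] by (simp add: T3_G3D2 power_mult_distrib flip: power_mult)
  hence "G * T3 (G ^ 3 * D ^ 4) = G ^ 4 * D\<^sup>2"
    using T3_step[of 2 "D ^ 4"] by (simp add: T3_G2D4)
  also have "\<dots> = G * (G ^ 3 * D\<^sup>2)" by (simp add: ring_expand)
  finally show "G * T3 (G ^ 3 * D ^ 4) = G * (G ^ 3 * D\<^sup>2)" .
qed

lemma T3_G1dd: "T3 (G * dd3) = 0"
  by (simp add: G_dd3 Tp_power8 T3_yy_powers)

lemma T3_G1D8: "T3 (G * D ^ 8) = 0"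
  using T3_step[of 0 "D ^ 8"] Tp_frob[of 3 2 4] by (simp add: T3_G2D4 T3_yy_powers Tp_power8 G_nonzero)

lemma G_pow_dd3: "G ^ Suc i * dd3 = G ^ i * D ^ 8"
  using G_dd3 by (simp add: mult.assoc mult.left_commute)

lemma T3_G2dd: "T3 (G\<^sup>2 * dd3) = 0"
  using T3_G1D8 G_pow_dd3[of 1] by (simp only: numeral_2_eq_2 One_nat_def power_Suc0_right)

lemma T3_G3dd: "T3 (G ^ 3 * dd3) = dd3\<^sup>2"
  using Tp_frob[of 3 1 4] G_pow_dd3[of 2] by (simp add: T3_G1D4)

lemma T3_G4dd: "T3 (G ^ 4 * dd3) = G ^ 4 * D"
proof (rule G_cancel)
  have "T3 (G ^ 6 * D ^ 8) = G ^ 6 * D ^ 4"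
    using Tp_frob[of 3 3 4] by (simp add: T3_G3D4 power_mult_distrib flip: power_mult)
  hence "G * T3 (G ^ 3 * D ^ 8) + G ^ 4 * dd3\<^sup>2 = G ^ 6 * D ^ 4"
    using T3_step[of 2 "D ^ 8"] Tp_frob[of 3 1 4] by (simp add: T3_G1D4)
  from bfps_eq_add[OF this]
  have "G * T3 (G ^ 3 * D ^ 8) = G ^ 6 * D ^ 4 + G\<^sup>2 * (G\<^sup>2 * dd3\<^sup>2)"
    by (simp add: mult.assoc[symmetric] flip: power_add)
  also have "\<dots> = G * (G ^ 4 * D)" unfolding dd3_sq by (simp add: ring_expand)
  finally have "G * T3 (G ^ 3 * D ^ 8) = G * (G ^ 4 * D)" .
  moreover have "G ^ 4 * dd3 = G ^ 3 * D ^ 8" using G_pow_dd3[of 3] by simp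
  ultimately show "G * T3 (G ^ 4 * dd3) = G * (G ^ 4 * D)" by (simp only:)
qed

lemma T3_dd3: "T3 dd3 = D"
proof -
  have "G ^ 4 * T3 dd3 = G ^ 4 * D"
    using T3_step[of 0 dd3] T3_G4dd by (auto simp: T3_G1dd)
  thus ?thesis using G_nonzero by simp
qed

lemma ii_mult_yy: "yy\<^sup>2 * ii\<^sup>2 = 1" "ii\<^sup>2 * yy\<^sup>2 = 1"
  by (simp_all add: yy_ii_power)

lemma T7_sq: "T7 (yy ^ (2 * k)) = (T7 (yy ^ k))\<^sup>2"
  using Tp_square[of 7 "yy ^ k"] by (simp add: mult.commute flip: power_mult)

lemma T7_rec: "T7 (yy ^ (k + 8)) = ii\<^sup>2 * (D * T7 (yy ^ (k + 4)) + D\<^sup>2 * T7 (yy ^ (k + 2))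
    + D * T7 (yy ^ (k + 1)) + T7 (yy ^ k))"
  using T7_yy8[of "yy ^ k"] by (simp add: power_add power2_eq_square ac_simps)

text \<open>The recurrences at \<open>yy^2\<close> and \<open>yy^4\<close> give two equations for
  \<open>a\<close> and \<open>b\<close>. After eliminating \<open>b\<close>, a nonzero
  \<open>a\<close> would satisfy an equation in which \<open>D^3\<close> has order 3 at
  \<open>x = 0\<close> and all other terms have order at least 4.\<close>

lemma T7_yy35: "T7 (yy ^ 3) = 0" "T7 (yy ^ 5) = 0"
proof -
  define a b where "a = T7 (yy ^ 3)" and "b = T7 (yy ^ 5)"
  have sq: "T7 (yy ^ 6) = a\<^sup>2" "T7 (yy ^ 10) = b\<^sup>2" "T7 (yy ^ 12) = a ^ 4"
    using T7_sq[of 3] T7_sq[of 5] T7_sq[of 6] by (simp_all add: a_def b_def flip: power_mult)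
  have yi: "yy\<^sup>2 * (ii\<^sup>2 * f) = f" for f using ii_mult_yy by (simp flip: mult.assoc)
  have 1: "yy\<^sup>2 * b\<^sup>2 = D * a\<^sup>2 + D * a"
    using T7_rec[of 2] sq by (simp add: T7_yy_powers yi a_def b_def)
  have 2: "yy\<^sup>2 * a ^ 4 = D\<^sup>2 * a\<^sup>2 + D * b"
    using T7_rec[of 4] sq by (simp add: T7_yy_powers yi a_def b_def)
  have "a = 0"
  proof (rule ccontr)
    assume a: "a \<noteq> 0"
    have "(yy\<^sup>2 * a ^ 4)\<^sup>2 = D ^ 4 * a ^ 4 + D\<^sup>2 * b\<^sup>2"
      unfolding 2 bfps_add_square by (simp add: power_mult_distrib flip: power_mult)
    hence "yy\<^sup>2 * (yy\<^sup>2 * a ^ 4)\<^sup>2 = yy\<^sup>2 * D ^ 4 * a ^ 4 + D\<^sup>2 * (yy\<^sup>2 * b\<^sup>2)"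
      by (simp add: distrib_left ac_simps)
    hence "yy\<^sup>2 * (yy\<^sup>2 * a ^ 4)\<^sup>2 + (yy\<^sup>2 * D ^ 4 * a ^ 4 + D\<^sup>2 * (D * a\<^sup>2 + D * a)) = 0"
      unfolding 1 by (rule iffD1[OF bfps_eq_iff])
    moreover have "a * (yy ^ 6 * a ^ 7 + (yy\<^sup>2 * D ^ 4 * a ^ 3 + (D ^ 3 * a + D ^ 3)))
        = yy\<^sup>2 * (yy\<^sup>2 * a ^ 4)\<^sup>2 + (yy\<^sup>2 * D ^ 4 * a ^ 4 + D\<^sup>2 * (D * a\<^sup>2 + D * a))"
      by (simp only: power_mult_distrib power_mult[symmetric]) (simp add: ring_expand)
    ultimately have "a * (yy ^ 6 * a ^ 7 + (yy\<^sup>2 * D ^ 4 * a ^ 3 + (D ^ 3 * a + D ^ 3))) = 0"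
      by (simp only:)
    hence e: "yy ^ 6 * a ^ 7 + (yy\<^sup>2 * D ^ 4 * a ^ 3 + (D ^ 3 * a + D ^ 3)) = 0"
      using a by simp
    have D0: "D $ 0 = 0" by (simp add: D_ww w12_nth0 fps_power_zeroth)
    have y0: "yy $ 0 = 1" by (simp add: yy_eq w12_nth0)
    have a0: "a $ 0 = 0"
      using arg_cong[OF e, of "\<lambda>f. f $ 0"] D0 y0 by (simp add: fps_power_zeroth)
    define q d where "q = fps_shift 1 a" and "d = fps_shift 1 D"
    have q: "a = fps_X * q" and d: "D = fps_X * d"
      using a0 D0 by (simp_all add: q_def d_def fps_eq_iff)
    have d0: "d $ 0 = 1" using D_nth1 by (simp add: d)
    have "fps_X ^ 3 * (fps_X * (fps_X ^ 3 * yy ^ 6 * q ^ 7 + fps_X ^ 3 * yy\<^sup>2 * d ^ 4 * q ^ 3 + d ^ 3 * q) + d ^ 3) = 0"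
      using e unfolding q d by (simp add: ring_expand)
    hence "fps_X * (fps_X ^ 3 * yy ^ 6 * q ^ 7 + fps_X ^ 3 * yy\<^sup>2 * d ^ 4 * q ^ 3 + d ^ 3 * q) + d ^ 3 = 0"
      by simp
    from arg_cong[OF this, of "\<lambda>f. f $ 0"] show False using d0 by (simp add: fps_power_zeroth)
  qed
  moreover from this have "b = 0" using 1 yy_nonzero by simp
  ultimately show "T7 (yy ^ 3) = 0" "T7 (yy ^ 5) = 0" by (simp_all add: a_def b_def)
qed

lemma T7_even: "T7 (yy ^ 6) = 0" "T7 (yy ^ 10) = 0" "T7 (yy ^ 12) = 0" "T7 (yy ^ 20) = 0"
  using T7_sq[of 3] T7_sq[of 5] T7_sq[of 6] T7_sq[of 10] by (simp_all add: T7_yy35)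

lemma T7_yy7: "T7 (yy ^ 7) = ii\<^sup>2 * D"
proof -
  let ?p = "T7 (yy ^ 7)"
  have "?p\<^sup>2 = ii\<^sup>2 * (D * ?p)"
    using T7_rec[of 6] T7_sq[of 7] by (simp add: T7_yy_powers T7_even)
  hence "?p * ?p = ?p * (ii\<^sup>2 * D)" by (simp add: power2_eq_square ac_simps)
  moreover have "?p \<noteq> 0"
  proof -
    have "ww ^ 7 = 1 + yy + yy\<^sup>2 + yy ^ 3 + yy ^ 4 + yy ^ 5 + yy ^ 6 + yy ^ 7"
      unfolding ww_yy by (simp add: ring_expand)
    hence "T7 (ww ^ 7) = ?p" by (simp add: Tp_add T7_yy_powers T7_yy35 T7_even)
    thus ?thesis using Tp_ww_power[of 7] by auto
  qed
  ultimately show ?thesis by simp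
qed

lemma T7_yy_odd:
  "T7 (yy ^ 9) = 0" "T7 (yy ^ 11) = ii ^ 4 * D\<^sup>2" "T7 (yy ^ 13) = ii ^ 4 * D ^ 3"
  "T7 (yy ^ 14) = ii ^ 4 * D\<^sup>2" "T7 (yy ^ 15) = ii ^ 6 * D ^ 3 + ii ^ 4 * D"
  "T7 (yy ^ 17) = 0" "T7 (yy ^ 19) = ii ^ 8 * D ^ 4 + ii ^ 6 * D ^ 5"
  "T7 (yy ^ 21) = ii ^ 8 * D ^ 5 + ii ^ 6 * D ^ 3"
  "T7 (yy ^ 22) = ii ^ 8 * D ^ 4" "T7 (yy ^ 25) = ii ^ 8 * D ^ 4 + ii ^ 8 * D ^ 7"
  "T7 (yy ^ 28) = ii ^ 8 * D ^ 4" "T7 (yy ^ 29) = ii ^ 12 * D ^ 7"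
proof -
  note z = T7_yy_powers T7_yy35 T7_even
  show 9: "T7 (yy ^ 9) = 0"
  proof -
    have "1 + 8 = (9::nat)" "1 + 4 = (5::nat)" "1 + 2 = (3::nat)" "1 + 1 = (2::nat)" by simp_all
    from T7_rec[of 1, unfolded this] show ?thesis by (simp add: z)
  qed
  show 11: "T7 (yy ^ 11) = ii ^ 4 * D\<^sup>2" using T7_rec[of 3] by (simp add: z T7_yy7, simp add: ring_expand)
  show 13: "T7 (yy ^ 13) = ii ^ 4 * D ^ 3" using T7_rec[of 5] 9 by (simp add: z T7_yy7, simp add: ring_expand)
  show 14: "T7 (yy ^ 14) = ii ^ 4 * D\<^sup>2"
    using T7_sq[of 7] by (simp add: T7_yy7 power_mult_distrib flip: power_mult)
  show 15: "T7 (yy ^ 15) = ii ^ 6 * D ^ 3 + ii ^ 4 * D"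
    using T7_rec[of 7] 9 11 by (simp add: z T7_yy7, simp add: ring_expand)
  show 17: "T7 (yy ^ 17) = 0" using T7_rec[of 9] 9 11 13 by (simp add: z, simp add: ring_expand)
  show 19: "T7 (yy ^ 19) = ii ^ 8 * D ^ 4 + ii ^ 6 * D ^ 5"
    using T7_rec[of 11] 11 13 15 by (simp add: z, simp add: ring_expand)
  show 21: "T7 (yy ^ 21) = ii ^ 8 * D ^ 5 + ii ^ 6 * D ^ 3"
    using T7_rec[of 13] 13 14 15 17 by (simp add: z, simp add: ring_expand)
  show 22: "T7 (yy ^ 22) = ii ^ 8 * D ^ 4"
    using T7_sq[of 11] 11 by (simp add: power_mult_distrib flip: power_mult)
  have 18: "T7 (yy ^ 18) = 0" using T7_sq[of 9] 9 by simp
  show 25: "T7 (yy ^ 25) = ii ^ 8 * D ^ 4 + ii ^ 8 * D ^ 7"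
    using T7_rec[of 17] 17 18 19 21 by (simp add: z, simp add: ring_expand)
  show 28: "T7 (yy ^ 28) = ii ^ 8 * D ^ 4"
    using T7_sq[of 14] 14 by (simp add: power_mult_distrib flip: power_mult)
  have 23: "T7 (yy ^ 23) = ii ^ 10 * D ^ 5 + ii ^ 8 * D ^ 6 + ii ^ 8 * D ^ 3 + ii ^ 6 * D"
    using T7_rec[of 15] 15 17 19 by (simp add: z, simp add: ring_expand)
  show "T7 (yy ^ 29) = ii ^ 12 * D ^ 7"
    using T7_rec[of 21] 21 22 23 25 by (simp add: z, simp add: ring_expand)
qed

lemma T7_ii_sq: "T7 (ii ^ (2 * k)) = (T7 (ii ^ k))\<^sup>2"
  using Tp_square[of 7 "ii ^ k"] by (simp add: mult.commute flip: power_mult)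

lemma T7_ii:
  "T7 ii = D" "T7 (ii\<^sup>2) = D\<^sup>2" "T7 (ii ^ 4) = D ^ 4" "T7 (ii ^ 5) = D\<^sup>2 + D ^ 5"
  "T7 (ii ^ 7) = D ^ 4 + D ^ 7"
proof -
  note z = T7_yy_powers T7_yy35
  have yi: "yy\<^sup>2 * (ii\<^sup>2 * f) = f" for f using ii_mult_yy by (simp flip: mult.assoc)
  have e1: "yy ^ 8 * ii = yy ^ 7" "yy ^ 4 * ii = yy ^ 3" "yy\<^sup>2 * ii = yy"
    using yy_ii_ge[of 1 8] yy_ii_ge[of 1 4] yy_ii_ge[of 1 2] by simp_all
  show 1: "T7 ii = D" using T7_yy[of ii] by (simp add: e1 yy_ii z T7_yy7 yi)
  show 2: "T7 (ii\<^sup>2) = D\<^sup>2" using T7_ii_sq[of 1] 1 by simp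
  show 4: "T7 (ii ^ 4) = D ^ 4" using T7_ii_sq[of 2] 2 by (simp flip: power_mult)
  have e3: "yy ^ 8 * ii ^ 3 = yy ^ 5" "yy ^ 4 * ii ^ 3 = yy" "yy\<^sup>2 * ii ^ 3 = ii" "yy * ii ^ 3 = ii\<^sup>2"
    using yy_ii_ge[of 3 8] yy_ii_ge[of 3 4] yy_ii_le[of 2 3] yy_ii_le[of 1 3] by simp_all
  have 3: "T7 (ii ^ 3) = 0" using T7_yy[of "ii ^ 3"] by (simp add: e3 z 1 2 flip: power_add power_Suc power_Suc2)
  have e5: "yy ^ 8 * ii ^ 5 = yy ^ 3" "yy ^ 4 * ii ^ 5 = ii" "yy\<^sup>2 * ii ^ 5 = ii ^ 3" "yy * ii ^ 5 = ii ^ 4"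
    using yy_ii_ge[of 5 8] yy_ii_le[of 4 5] yy_ii_le[of 2 5] yy_ii_le[of 1 5] by simp_all
  show 5: "T7 (ii ^ 5) = D\<^sup>2 + D ^ 5"
    using T7_yy[of "ii ^ 5"] by (simp add: e5 z 1 3 4, simp add: ring_expand)
  have 6: "T7 (ii ^ 6) = 0" using T7_ii_sq[of 3] 3 by simp
  have e7: "yy ^ 8 * ii ^ 7 = yy" "yy ^ 4 * ii ^ 7 = ii ^ 3" "yy\<^sup>2 * ii ^ 7 = ii ^ 5" "yy * ii ^ 7 = ii ^ 6"
    using yy_ii_ge[of 7 8] yy_ii_le[of 4 7] yy_ii_le[of 2 7] yy_ii_le[of 1 7] by simp_all
  show "T7 (ii ^ 7) = D ^ 4 + D ^ 7"
    using T7_yy[of "ii ^ 7"] by (simp add: e7 z 3 5 6, simp add: ring_expand)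
qed

lemma T7_GD: "T7 (G * D) = D\<^sup>2"
  unfolding GD_square by (simp add: Tp_square Tp_add T7_yy_powers T7_ii T7_yy35)

lemma T7_G3D: "T7 (G ^ 3 * D) = D ^ 8"
  unfolding D16_sum Tp_add
  using Tp_power16[of 7 D] Tp_power4[of 7 "G * D"] T7_GD
  by (simp add: T7_yy_powers power_mult_distrib flip: power_mult)

text \<open>By \<open>G = D^5 / yy^8\<close> such products expand into Laurent polynomials in
  \<open>yy\<close>, whose images can be read off from \<open>T7_yy_odd\<close> and
  \<open>T7_ii\<close>.\<close>

lemma G_D_ii: "G ^ i * D ^ j = D ^ (5 * i + j) * ii ^ (8 * i)"
proof -
  have "G = G * (yy * ii) ^ 8" by (simp add: yy_ii)
  also have "\<dots> = (G * yy ^ 8) * ii ^ 8" by (simp add: power_mult_distrib ac_simps)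
  finally have "G ^ i = (D ^ 5 * ii ^ 8) ^ i" by (simp only: G_eq)
  thus ?thesis
    by (simp only: power_mult_distrib power_mult power_add) (simp only: mult.assoc mult.commute[of "D ^ j"])
qed

lemma D_expand: "D\<^sup>2 = yy\<^sup>2 + yy ^ 8" "D ^ 4 = yy ^ 4 + yy ^ 16" "D ^ 8 = yy ^ 8 + yy ^ 32"
  unfolding D_yy bfps_add_square bfps_add_power4 bfps_add_power8 by (simp_all flip: power_mult)

lemma T7_G2D: "T7 (G\<^sup>2 * D) = 0"
proof -
  have "G\<^sup>2 * D = D ^ 11 * ii ^ 16" using G_D_ii[of 2 1] by simp
  also have "D ^ 11 = D ^ 8 * (D\<^sup>2 * D)" by (simp flip: power_add power_Suc2)
  also have "\<dots> = yy ^ 11 + yy ^ 14 + yy ^ 17 + yy ^ 20 + yy ^ 35 + yy ^ 38 + yy ^ 41 + yy ^ 44"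
    unfolding D_expand unfolding D_yy by (simp add: distrib_left distrib_right ac_simps flip: power_add power_Suc power_Suc2)
  also have "\<dots> * ii ^ 16 = ii ^ 5 + ii\<^sup>2 + yy + yy ^ 4 + yy ^ 19 + yy ^ 22 + yy ^ 25 + yy ^ 28"
    by (simp add: distrib_right yy_ii_ge yy_ii_le)
  finally have "T7 (G\<^sup>2 * D) = T7 (ii ^ 5) + T7 (ii\<^sup>2) + T7 (yy ^ 19) + T7 (yy ^ 22) + T7 (yy ^ 25) + T7 (yy ^ 28)"
    by (simp add: Tp_add T7_yy_powers)
  also have "\<dots> = D ^ 5 * (1 + ii ^ 6 + D\<^sup>2 * ii ^ 8)"
    unfolding T7_yy_odd T7_ii by (simp add: ring_expand)
  also have "1 + ii ^ 6 + D\<^sup>2 * ii ^ 8 = 0"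
    unfolding D_expand by (simp add: distrib_right yy_ii_ge yy_ii_le)
  finally show ?thesis by simp
qed

lemma T7_G5D: "T7 (G ^ 5 * D) = G ^ 4 * D\<^sup>2"
proof -
  have "G ^ 5 * D = (D ^ 13 * ii ^ 20)\<^sup>2"
    using G_D_ii[of 5 1] by (simp add: power_mult_distrib flip: power_mult)
  hence "T7 (G ^ 5 * D) = (T7 (D ^ 13 * ii ^ 20))\<^sup>2" by (simp add: Tp_square)
  also have "D ^ 13 = D ^ 8 * (D ^ 4 * D)" by (simp flip: power_add power_Suc2)
  also have "\<dots> = yy ^ 13 + yy ^ 16 + yy ^ 25 + yy ^ 28 + yy ^ 37 + yy ^ 40 + yy ^ 49 + yy ^ 52"
    unfolding D_expand unfolding D_yy by (simp add: distrib_left distrib_right ac_simps flip: power_add power_Suc power_Suc2)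
  also have "\<dots> * ii ^ 20 = ii ^ 7 + ii ^ 4 + yy ^ 5 + yy ^ 8 + yy ^ 17 + yy ^ 20 + yy ^ 29 + yy ^ 32"
    by (simp add: distrib_right yy_ii_ge yy_ii_le)
  also have "T7 \<dots> = D ^ 7 * (1 + ii ^ 12)"
  proof -
    have "T7 (yy ^ 32) = 0" using T7_sq[of 16] by (simp add: T7_yy_powers)
    thus ?thesis unfolding Tp_add
      by (simp add: T7_yy_powers T7_yy35 T7_even T7_ii T7_yy_odd, simp add: ring_expand)
  qed
  also have "1 + ii ^ 12 = D ^ 4 * ii ^ 16"
    unfolding D_expand by (simp add: distrib_right yy_ii_ge yy_ii_le)
  also have "(D ^ 7 * (D ^ 4 * ii ^ 16))\<^sup>2 = D ^ 22 * ii ^ 32"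
    by (simp add: power_mult_distrib mult.assoc[symmetric] flip: power_mult power_add)
  also have "\<dots> = G ^ 4 * D\<^sup>2" using G_D_ii[of 4 2] by simp
  finally show ?thesis .
qed

text \<open>\<open>G^11 D\<close> is the eighth power of a short Laurent polynomial. As
  \<open>11 = 3 + 8\<close>, the recurrence at 3 then has \<open>T7 (G^4 D)\<close> as its only
  unknown.\<close>

lemma T7_G11D: "T7 (G ^ 11 * D) = D ^ 32 + D ^ 8"
proof -
  have "G ^ 11 * D = (D ^ 7 * ii ^ 11) ^ 8"
    using G_D_ii[of 11 1] by (simp add: power_mult_distrib flip: power_mult)
  hence "T7 (G ^ 11 * D) = T7 (D ^ 7 * ii ^ 11) ^ 8" by (simp add: Tp_power8)
  also have "D ^ 7 = D ^ 4 * (D\<^sup>2 * D)" by (simp flip: power_add power_Suc2)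
  also have "\<dots> = yy ^ 7 + yy ^ 10 + yy ^ 13 + yy ^ 16 + yy ^ 19 + yy ^ 22 + yy ^ 25 + yy ^ 28"
    unfolding D_expand unfolding D_yy by (simp add: distrib_left distrib_right ac_simps flip: power_add power_Suc power_Suc2)
  also have "\<dots> * ii ^ 11 = ii ^ 4 + ii + yy\<^sup>2 + yy ^ 5 + yy ^ 8 + yy ^ 11 + yy ^ 14 + yy ^ 17"
    by (simp add: distrib_right yy_ii_ge yy_ii_le)
  also have "T7 \<dots> = D ^ 4 + D"
    unfolding Tp_add by (simp add: T7_yy_powers T7_yy35 T7_ii T7_yy_odd)
  also have "(D ^ 4 + D) ^ 8 = D ^ 32 + D ^ 8" by (simp add: bfps_add_power8 flip: power_mult)
  finally show ?thesis .
qed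

lemma T7_G4D: "T7 (G ^ 4 * D) = dd3"
proof (rule G_cancel)
  have "D ^ 32 + D ^ 8 = G\<^sup>2 * (G ^ 4 * D\<^sup>2) + G * T7 (G ^ 4 * D) + G ^ 8 * D ^ 8"
    using T7_step[of 3 D] by (simp add: T7_G5D T7_G3D T7_G11D)
  hence "G * T7 (G ^ 4 * D) + (G\<^sup>2 * (G ^ 4 * D\<^sup>2) + G ^ 8 * D ^ 8) = D ^ 32 + D ^ 8"
    by (simp only: ac_simps)
  from bfps_eq_add[OF this]
  have "G * T7 (G ^ 4 * D) = (D\<^sup>2 * G ^ 6 + D ^ 8 * G ^ 8 + D ^ 8) + (G\<^sup>2 * (G ^ 4 * D\<^sup>2) + G ^ 8 * D ^ 8)"
    by (simp only: D32)
  also have "\<dots> = D ^ 8" by (simp add: ring_expand)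
  finally show "G * T7 (G ^ 4 * D) = G * dd3" by (simp only: G_dd3)
qed

lemma T7_G2D2: "T7 (G\<^sup>2 * D\<^sup>2) = D ^ 4" "T7 (G ^ 4 * D\<^sup>2) = 0" "T7 (G ^ 6 * D\<^sup>2) = D ^ 16"
   "T7 (G ^ 8 * D\<^sup>2) = dd3\<^sup>2" "T7 (G ^ 10 * D\<^sup>2) = G ^ 8 * D ^ 4"
  using Tp_frob[of 7 1 1] Tp_frob[of 7 2 1] Tp_frob[of 7 3 1] Tp_frob[of 7 4 1] Tp_frob[of 7 5 1]
  by (simp_all add: T7_GD T7_G2D T7_G3D T7_G4D T7_G5D power_mult_distrib flip: power_mult)

lemma T7_D: "T7 (D\<^sup>2) = 0" "T7 (D ^ 4) = 0" "T7 (D ^ 8) = 0"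
  by (simp_all add: Tp_square Tp_power4 Tp_power8 T7_yy_powers)

lemma T7_G1D2: "T7 (G * D\<^sup>2) = D"
proof (rule G_cancel)
  have "G * T7 (G * D\<^sup>2) + G\<^sup>2 * D ^ 4 = dd3\<^sup>2"
    using T7_G[of "D\<^sup>2"] by (simp add: T7_G2D2 T7_D add.commute)
  from bfps_eq_add[OF this] have "G\<^sup>2 * (G * T7 (G * D\<^sup>2)) = G\<^sup>2 * dd3\<^sup>2 + G\<^sup>2 * (G\<^sup>2 * D ^ 4)"
    by (simp add: distrib_left)
  also have "\<dots> = G\<^sup>2 * (G * D)" unfolding dd3_sq by (simp add: ring_expand)
  finally show "G * T7 (G * D\<^sup>2) = G * D" using G_nonzero by simp
qed

lemma T7_G3D2: "T7 (G ^ 3 * D\<^sup>2) = 0"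
proof -
  have "G * T7 (G ^ 3 * D\<^sup>2) + G ^ 8 * D ^ 4 = G ^ 8 * D ^ 4"
    using T7_step[of 2 "D\<^sup>2"] by (simp add: T7_G2D2)
  hence "G * T7 (G ^ 3 * D\<^sup>2) = 0" using bfps_eq_add by fastforce
  thus ?thesis using G_nonzero by simp
qed

lemma T7_G2D4: "T7 (G\<^sup>2 * D ^ 4) = D\<^sup>2" "T7 (G ^ 4 * D ^ 4) = D ^ 8" "T7 (G ^ 6 * D ^ 4) = 0"
   "T7 (G ^ 8 * D ^ 4) = 0" "T7 (G ^ 12 * D ^ 4) = D ^ 32"
  using Tp_frob[of 7 1 2] Tp_frob[of 7 2 2] Tp_frob[of 7 3 2] Tp_frob[of 7 4 2] Tp_power4[of 7 "G\<^sup>2 * D"] Tp_power4[of 7 "G ^ 3 * D"]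
  by (simp_all add: T7_G1D2 T7_G2D2 T7_G3D2 T7_G2D T7_G3D power_mult_distrib flip: power_mult)

lemma T7_G1D4: "T7 (G * D ^ 4) = G * D\<^sup>2"
proof (rule G_cancel)
  have "G * T7 (G * D ^ 4) + G\<^sup>2 * D\<^sup>2 = 0"
    using T7_G[of "D ^ 4"] by (simp add: T7_G2D4 T7_D add.commute)
  from bfps_eqI[OF this] show "G * T7 (G * D ^ 4) = G * (G * D\<^sup>2)" by (simp add: power2_eq_square)
qed

lemma T7_G7D: "T7 (G ^ 7 * D) = G ^ 4 * D ^ 8"
proof -
  have "G ^ 7 * D = G ^ 4 * (G ^ 3 * D)" by (simp flip: mult.assoc power_add)
  also have "\<dots> = (G * D ^ 4) ^ 4 + (G\<^sup>2 * D) ^ 4"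
    unfolding D16_sum by (simp add: distrib_left power_mult_distrib mult.assoc[symmetric] flip: power_mult power_add)
  finally have "T7 (G ^ 7 * D) = T7 (G * D ^ 4) ^ 4 + T7 (G\<^sup>2 * D) ^ 4"
    by (simp add: Tp_add Tp_power4)
  thus ?thesis by (simp add: T7_G1D4 T7_G2D power_mult_distrib flip: power_mult)
qed

lemma T7_steps:
  "T7 (G ^ 10 * f) = G * T7 (G ^ 3 * f) + (G\<^sup>2 * T7 (G ^ 4 * f) + G ^ 8 * T7 (G\<^sup>2 * f))"
  "T7 (G ^ 12 * f) = G * T7 (G ^ 5 * f) + (G\<^sup>2 * T7 (G ^ 6 * f) + G ^ 8 * T7 (G ^ 4 * f))"
  "T7 (G ^ 14 * f) = G * T7 (G ^ 7 * f) + (G\<^sup>2 * T7 (G ^ 8 * f) + G ^ 8 * T7 (G ^ 6 * f))"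
  using T7_step[of 2 f] T7_step[of 4 f] T7_step[of 6 f] by (simp_all add: add_ac power3_eq_cube mult.assoc)

lemma T7_G7D2: "T7 (G ^ 7 * D\<^sup>2) = G\<^sup>2 * D + G ^ 3 * D ^ 4"
proof (rule G_cancel)
  have "T7 (G ^ 14 * D\<^sup>2) = G ^ 8 * D ^ 16"
    using Tp_frob[of 7 7 1] by (simp add: T7_G7D power_mult_distrib flip: power_mult)
  hence "G * T7 (G ^ 7 * D\<^sup>2) + G\<^sup>2 * dd3\<^sup>2 + G ^ 8 * D ^ 16 = G ^ 8 * D ^ 16"
    using T7_step[of 6 "D\<^sup>2"] by (simp add: T7_G2D2 add.commute)
  hence "G * T7 (G ^ 7 * D\<^sup>2) + G\<^sup>2 * dd3\<^sup>2 = 0"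
    by (metis add_cancel_left_left)
  from bfps_eqI[OF this] show "G * T7 (G ^ 7 * D\<^sup>2) = G * (G\<^sup>2 * D + G ^ 3 * D ^ 4)"
    unfolding dd3_sq by (simp add: ring_expand)
qed

lemma T7_G14D4: "T7 (G ^ 14 * D ^ 4) = G ^ 4 * D\<^sup>2 + G ^ 6 * D ^ 8"
  using Tp_frob[of 7 7 2] by (simp add: T7_G7D2 bfps_add_square power_mult_distrib flip: power_mult)

lemma T7_G7D4: "T7 (G ^ 7 * D ^ 4) = G ^ 3 * D\<^sup>2 + G ^ 5 * D ^ 8"
proof (rule G_cancel)
  have "G * T7 (G ^ 7 * D ^ 4) = G ^ 4 * D\<^sup>2 + G ^ 6 * D ^ 8"
    using T7_step[of 6 "D ^ 4"] T7_G14D4 by (simp add: T7_G2D4)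
  thus "G * T7 (G ^ 7 * D ^ 4) = G * (G ^ 3 * D\<^sup>2 + G ^ 5 * D ^ 8)" by (simp add: ring_expand)
qed

lemma T7_G2D8: "T7 (G\<^sup>2 * D ^ 8) = G\<^sup>2 * D ^ 4" "T7 (G ^ 4 * D ^ 8) = D ^ 4" "T7 (G ^ 8 * D ^ 8) = D ^ 16"
  "T7 (G ^ 12 * D ^ 8) = 0" "T7 (G ^ 14 * D ^ 8) = G ^ 6 * D ^ 4 + G ^ 10 * D ^ 16"
  using Tp_frob[of 7 1 4] Tp_power4[of 7 "G * D\<^sup>2"] Tp_power8[of 7 "G * D"] Tp_power4[of 7 "G ^ 3 * D\<^sup>2"]
    Tp_frob[of 7 7 4]
  by (simp_all add: T7_G1D4 T7_G1D2 T7_GD T7_G3D2 T7_G7D4 bfps_add_square power_mult_distrib flip: power_mult)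

lemma T7_G1D8: "T7 (G * D ^ 8) = G\<^sup>2 * D"
proof (rule G_cancel)
  have "G * T7 (G * D ^ 8) + G\<^sup>2 * (G\<^sup>2 * D ^ 4) = D ^ 16"
    using T7_G[of "D ^ 8"] by (simp add: T7_G2D8 T7_D add.commute)
  from bfps_eq_add[OF this] show "G * T7 (G * D ^ 8) = G * (G\<^sup>2 * D)"
    unfolding D16_sq by (simp add: ring_expand)
qed

lemma G_nth: "G $ 5 = 1" "n < 5 \<Longrightarrow> G $ n = 0"
proof -
  have "F $ 1 = 1" unfolding F_def by (auto intro!: exI[of _ 1])
  thus "G $ 5 = 1" by (simp add: G_dil dil_nth)
  have "F $ 0 = 0" unfolding F_def by auto
  thus "n < 5 \<Longrightarrow> G $ n = 0" by (auto simp: G_dil dil_nth elim!: dvdE)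
qed

lemma subdegree_G: "subdegree G = 5"
  by (rule subdegreeI) (use G_nth in auto)

text \<open>Frobenius and the recurrence lead from \<open>x\<close> through \<open>a\<close>,
  \<open>b\<close>, \<open>c\<close>, \<open>d\<close> back to \<open>x\<close>. For the error
  \<open>e\<close> the cycle closes as \<open>e^16 = G^11 e\<close>, and a nonzero \<open>e\<close>
  would give \<open>15 * subdegree e = 55\<close>, which is impossible.\<close>

lemma T7_G6D: "T7 (G ^ 6 * D) = G ^ 3 * D\<^sup>2"
proof -
  define x where "x = T7 (G ^ 6 * D)"
  define a b c d where "a = T7 (G ^ 5 * D\<^sup>2)" and "b = T7 (G ^ 3 * D ^ 4)"
    and "c = T7 (G ^ 5 * D ^ 8)" and "d = T7 (G ^ 3 * D ^ 16)"
  have "T7 (G ^ 12 * D\<^sup>2) = x\<^sup>2" using Tp_frob[of 7 6 1] by (simp add: x_def)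
  hence "G * a + G\<^sup>2 * D ^ 16 = x\<^sup>2" using T7_step[of 4 "D\<^sup>2"] by (simp add: T7_G2D2 a_def add.commute)
  from bfps_eq_add[OF this] have a: "G * a = x\<^sup>2 + G\<^sup>2 * D ^ 16" .
  have "T7 (G ^ 10 * D ^ 4) = a\<^sup>2" using Tp_frob[of 7 5 2] by (simp add: a_def)
  hence "G * b + (G\<^sup>2 * D ^ 8 + G ^ 8 * D\<^sup>2) = a\<^sup>2"
    using T7_steps(1)[of "D ^ 4"] by (simp add: T7_G2D4 b_def)
  from bfps_eq_add[OF this] have b: "G * b = a\<^sup>2 + (G\<^sup>2 * D ^ 8 + G ^ 8 * D\<^sup>2)" .
  have "T7 (G ^ 6 * D ^ 8) = b\<^sup>2" using Tp_frob[of 7 3 4] by (simp add: b_def)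
  hence "G * c + (G\<^sup>2 * b\<^sup>2 + G ^ 8 * D ^ 4) = 0"
    using T7_steps(2)[of "D ^ 8"] by (simp add: T7_G2D8 c_def)
  from bfps_eqI[OF this] have c: "G * c = G\<^sup>2 * b\<^sup>2 + G ^ 8 * D ^ 4" .
  have "T7 (G ^ 10 * D ^ 16) = c\<^sup>2" using Tp_frob[of 7 5 8] by (simp add: c_def)
  moreover have "T7 (G ^ 4 * D ^ 16) = G ^ 4 * D ^ 8" "T7 (G\<^sup>2 * D ^ 16) = G ^ 4 * D\<^sup>2"
    using Tp_power4[of 7 "G * D ^ 4"] Tp_frob[of 7 1 8]
    by (simp_all add: T7_G1D4 T7_G1D8 power_mult_distrib flip: power_mult)
  ultimately have "G * d + (G\<^sup>2 * (G ^ 4 * D ^ 8) + G ^ 8 * (G ^ 4 * D\<^sup>2)) = c\<^sup>2"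
    using T7_steps(1)[of "D ^ 16"] by (simp add: d_def)
  from bfps_eq_add[OF this] have d: "G * d = c\<^sup>2 + (G ^ 6 * D ^ 8 + G ^ 12 * D\<^sup>2)"
    by (simp add: mult.assoc[symmetric] flip: power_add)
  have "G ^ 6 * D = G ^ 3 * (G ^ 3 * D)" by (simp flip: mult.assoc power_add)
  also have "\<dots> = G ^ 3 * D ^ 16 + G ^ 7 * D ^ 4"
    unfolding D16_sum by (simp add: distrib_left mult.assoc[symmetric] flip: power_add)
  finally have x: "x = d + (G ^ 3 * D\<^sup>2 + G ^ 5 * D ^ 8)"
    by (simp add: x_def d_def Tp_add T7_G7D4)
  define e where "e = x + G ^ 3 * D\<^sup>2"
  have "G * e = G * d + G ^ 6 * D ^ 8" unfolding e_def x by (simp add: ring_expand)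
  hence e1: "G * e = c\<^sup>2 + G ^ 12 * D\<^sup>2" unfolding d by (simp add: ac_simps)
  have "G ^ 3 * e = (G * c)\<^sup>2 + G ^ 14 * D\<^sup>2"
  proof -
    have "G ^ 3 * e = G\<^sup>2 * (G * e)" by (simp add: eval_nat_numeral ac_simps)
    thus ?thesis unfolding e1 by (simp add: distrib_left power_mult_distrib mult.assoc[symmetric] flip: power_add)
  qed
  also have "\<dots> = (G * b) ^ 4 + G ^ 16 * D ^ 8 + G ^ 14 * D\<^sup>2"
    unfolding c bfps_add_square by (simp add: power_mult_distrib flip: power_mult)
  also have "\<dots> = a ^ 8 + G ^ 8 * D ^ 32 + G ^ 32 * D ^ 8 + G ^ 16 * D ^ 8 + G ^ 14 * D\<^sup>2"
    unfolding b bfps_add_power4 by (simp add: power_mult_distrib add.assoc flip: power_mult)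
  also have "G ^ 8 * D ^ 32 = G ^ 14 * D\<^sup>2 + G ^ 16 * D ^ 8"
    unfolding D32 by (simp add: distrib_left ac_simps flip: power_add)
  finally have e3: "G ^ 3 * e = a ^ 8 + G ^ 32 * D ^ 8" by (simp add: ac_simps)
  have D128: "G ^ 16 * D ^ 128 = G ^ 40 * D ^ 8 + G ^ 48 * D ^ 32"
  proof -
    have "D ^ 128 = (D ^ 32) ^ 4" by (simp flip: power_mult)
    thus ?thesis unfolding D32 bfps_add_power4
      by (simp add: distrib_left power_mult_distrib ac_simps D32 flip: power_mult power_add)
  qed
  have xe: "x = e + G ^ 3 * D\<^sup>2" by (simp add: e_def add.assoc)
  have "G ^ 11 * e = G ^ 8 * (G ^ 3 * e)" by (simp flip: mult.assoc power_add)
  also have "\<dots> = (G * a) ^ 8 + G ^ 40 * D ^ 8"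
    unfolding e3 by (simp add: distrib_left power_mult_distrib mult.assoc[symmetric] flip: power_add)
  also have "(G * a) ^ 8 = x ^ 16 + G ^ 16 * D ^ 128"
    unfolding a bfps_add_power8 by (simp add: power_mult_distrib flip: power_mult)
  also have "x ^ 16 = e ^ 16 + G ^ 48 * D ^ 32"
  proof -
    have "x ^ 16 = (x ^ 8)\<^sup>2" by (simp flip: power_mult)
    thus ?thesis unfolding xe bfps_add_power8 bfps_add_square by (simp add: power_mult_distrib flip: power_mult)
  qed
  finally have e11: "G ^ 11 * e = e ^ 16" unfolding D128 by (simp add: ac_simps)
  have "e = 0"
  proof (rule ccontr)
    assume e: "e \<noteq> 0"
    have "e * e ^ 15 = e ^ 16" by (simp flip: power_Suc)
    hence "e * e ^ 15 = e * G ^ 11" using e11 by (simp add: mult.commute)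
    hence "e ^ 15 = G ^ 11" using e by simp
    hence "15 * subdegree e = 11 * subdegree G"
      by (metis subdegree_power)
    thus False unfolding subdegree_G by presburger
  qed
  thus ?thesis unfolding x_def[symmetric] using xe by simp
qed

lemma T7_G5D2: "T7 (G ^ 5 * D\<^sup>2) = G ^ 4 * D"
proof (rule G_cancel)
  have "T7 (G ^ 12 * D\<^sup>2) = G ^ 6 * D ^ 4"
    using Tp_frob[of 7 6 1] by (simp add: T7_G6D power_mult_distrib flip: power_mult)
  hence "G * T7 (G ^ 5 * D\<^sup>2) + G\<^sup>2 * D ^ 16 = G ^ 6 * D ^ 4"
    using T7_step[of 4 "D\<^sup>2"] by (simp add: T7_G2D2 add.commute)
  from bfps_eq_add[OF this] show "G * T7 (G ^ 5 * D\<^sup>2) = G * (G ^ 4 * D)"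
    unfolding D16_sq by (simp add: ring_expand)
qed

lemma T7_G3D4: "T7 (G ^ 3 * D ^ 4) = G * D ^ 8"
proof (rule G_cancel)
  have "T7 (G ^ 10 * D ^ 4) = G ^ 8 * D\<^sup>2"
    using Tp_frob[of 7 5 2] by (simp add: T7_G5D2 power_mult_distrib flip: power_mult)
  hence "G * T7 (G ^ 3 * D ^ 4) + (G\<^sup>2 * D ^ 8 + G ^ 8 * D\<^sup>2) = G ^ 8 * D\<^sup>2"
    using T7_steps(1)[of "D ^ 4"] by (simp add: T7_G2D4)
  from bfps_eq_add[OF this] show "G * T7 (G ^ 3 * D ^ 4) = G * (G * D ^ 8)"
    by (simp add: ring_expand)
qed

lemma T7_G6D8: "T7 (G ^ 6 * D ^ 8) = G\<^sup>2 * D ^ 16"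
  using Tp_frob[of 7 3 4] by (simp add: T7_G3D4 power_mult_distrib flip: power_mult)

lemma T7_G5D4: "T7 (G ^ 5 * D ^ 4) = G ^ 5 * D\<^sup>2"
proof (rule G_cancel)
  have "G * T7 (G ^ 5 * D ^ 4) + G ^ 8 * D ^ 8 = D ^ 32"
    using T7_step[of 4 "D ^ 4"] by (simp add: T7_G2D4 add.commute)
  from bfps_eq_add[OF this] show "G * T7 (G ^ 5 * D ^ 4) = G * (G ^ 5 * D\<^sup>2)"
    unfolding D32 by (simp add: ring_expand)
qed

lemma T7_G3D8: "T7 (G ^ 3 * D ^ 8) = G * D ^ 4"
proof (rule G_cancel)
  have "T7 (G ^ 10 * D ^ 8) = G ^ 10 * D ^ 4"
    using Tp_frob[of 7 5 4] by (simp add: T7_G5D4 power_mult_distrib flip: power_mult)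
  hence "G * T7 (G ^ 3 * D ^ 8) + (G\<^sup>2 * D ^ 4 + G ^ 8 * (G\<^sup>2 * D ^ 4)) = G ^ 10 * D ^ 4"
    using T7_steps(1)[of "D ^ 8"] by (simp add: T7_G2D8)
  from bfps_eq_add[OF this] show "G * T7 (G ^ 3 * D ^ 8) = G * (G * D ^ 4)"
    by (simp add: ring_expand)
qed

lemma T7_G5D8: "T7 (G ^ 5 * D ^ 8) = G ^ 6 * D"
proof (rule G_cancel)
  have "G * T7 (G ^ 5 * D ^ 8) + (G\<^sup>2 * (G\<^sup>2 * D ^ 16) + G ^ 8 * D ^ 4) = 0"
    using T7_steps(2)[of "D ^ 8"] by (simp add: T7_G2D8 T7_G6D8)
  from bfps_eqI[OF this] show "G * T7 (G ^ 5 * D ^ 8) = G * (G ^ 6 * D)"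
    unfolding D16_sq by (simp add: ring_expand)
qed

lemma T7_G7D8: "T7 (G ^ 7 * D ^ 8) = G ^ 4 * D"
proof (rule G_cancel)
  have "G * T7 (G ^ 7 * D ^ 8) + (G\<^sup>2 * D ^ 16 + G ^ 8 * (G\<^sup>2 * D ^ 16)) = G ^ 6 * D ^ 4 + G ^ 10 * D ^ 16"
    using T7_steps(3)[of "D ^ 8"] by (simp add: T7_G2D8 T7_G6D8)
  from bfps_eq_add[OF this]
  have "G * T7 (G ^ 7 * D ^ 8) = G ^ 6 * D ^ 4 + G\<^sup>2 * D ^ 16"
    by (simp add: mult.assoc[symmetric] add.assoc add.left_commute flip: power_add)
  also have "\<dots> = G * (G ^ 4 * D)" unfolding D16_sq by (simp add: ring_expand)
  finally show "G * T7 (G ^ 7 * D ^ 8) = G * (G ^ 4 * D)" .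
qed

lemma T7_dd3: "T7 dd3 = 0" "T7 (G * dd3) = 0" "T7 (G\<^sup>2 * dd3) = G\<^sup>2 * D" "T7 (G ^ 3 * dd3) = G\<^sup>2 * D ^ 4"
  "T7 (G ^ 4 * dd3) = G * D ^ 4" "T7 (G ^ 5 * dd3) = D ^ 4" "T7 (G ^ 6 * dd3) = G ^ 6 * D"
  "T7 (G ^ 7 * dd3) = G ^ 5 * D + G ^ 6 * D ^ 4"
proof -
  show 1: "T7 (G * dd3) = 0" by (simp add: G_dd3 T7_D)
  show 2: "T7 (G\<^sup>2 * dd3) = G\<^sup>2 * D"
    using T7_G1D8 G_pow_dd3[of 1] by (simp only: numeral_2_eq_2 One_nat_def power_Suc0_right)
  show "T7 (G ^ 3 * dd3) = G\<^sup>2 * D ^ 4" using G_pow_dd3[of 2] by (simp add: T7_G2D8)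
  show "T7 (G ^ 4 * dd3) = G * D ^ 4" using G_pow_dd3[of 3] by (simp add: T7_G3D8)
  show "T7 (G ^ 5 * dd3) = D ^ 4" using G_pow_dd3[of 4] by (simp add: T7_G2D8)
  show "T7 (G ^ 6 * dd3) = G ^ 6 * D" using G_pow_dd3[of 5] by (simp add: T7_G5D8)
  have "T7 (G ^ 7 * dd3) = G\<^sup>2 * D ^ 16" using G_pow_dd3[of 6] by (simp add: T7_G6D8)
  thus "T7 (G ^ 7 * dd3) = G ^ 5 * D + G ^ 6 * D ^ 4"
    unfolding D16_sq by (simp add: distrib_left mult.assoc[symmetric] flip: power_add)
  have "T7 (G ^ 8 * dd3) = G ^ 4 * D" using G_pow_dd3[of 7] by (simp add: T7_G7D8)
  hence "G ^ 4 * D + G ^ 8 * T7 dd3 = G ^ 4 * D"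
    using T7_G[of dd3] 1 2 by (simp add: mult.assoc[symmetric] flip: power_add)
  thus "T7 dd3 = 0" using G_nonzero by simp
qed

subsection \<open>Weights on exponents\<close>

text \<open>The sum of \<open>2^(k div 2)\<close> over the binary digits \<open>2^k\<close> of \<open>n\<close>; a base 4 digit holds two binary digits of equal weight.\<close>
fun wgt :: "nat \<Rightarrow> nat" where
  "wgt n = (if n < 4 then (if n = 0 then 0 else if n = 3 then 2 else 1) else 2 * wgt (n div 4) + wgt (n mod 4))"

declare wgt.simps [simp del]

lemma wgt_small [simp]: "wgt 0 = 0" "wgt (Suc 0) = 1" "wgt 1 = 1" "wgt 2 = 1" "wgt 3 = 2"
  "wgt (Suc (Suc 0)) = 1" "wgt (Suc (Suc (Suc 0))) = 2"
  by (simp_all add: wgt.simps)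

lemma wgt_digit: "s < 4 \<Longrightarrow> wgt (4 * m + s) = 2 * wgt m + wgt s"
  by (cases "m = 0") (simp_all add: wgt.simps[of "4 * m + s"])

lemma less4_cases: "(s::nat) < 4 \<Longrightarrow> s = 0 \<or> s = 1 \<or> s = 2 \<or> s = 3"
  by linarith

lemma wgt_4 [simp]: "wgt 4 = 2" using wgt_digit[of 0 1] by simp

lemma wgt_Suc: "wgt (1 + b) \<le> 1 + wgt b"
proof (induction b rule: less_induct)
  case (less b)
  define d where "d = b div 4"
  define t where "t = b mod 4"
  have b: "b = 4 * d + t" and t: "t < 4" by (simp_all add: d_def t_def)
  show ?case
  proof (cases "t = 3")
    case True
    have "wgt (1 + d) \<le> 1 + wgt d" by (rule less.IH) (use True b in simp)
    moreover have "1 + b = 4 * (1 + d) + 0" using True b by simp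
    ultimately show ?thesis using wgt_digit[of 0 "1 + d"] wgt_digit[of t d] True b by simp
  next
    case False
    hence t1: "t + 1 < 4" using t by simp
    have "1 + b = 4 * d + (t + 1)" using b by simp
    moreover have "wgt (t + 1) \<le> 1 + wgt t" using less4_cases[OF t] False by (elim disjE) simp_all
    ultimately show ?thesis using wgt_digit[OF t1, of d] wgt_digit[OF t, of d] b by simp
  qed
qed

text \<open>A carry merges two digits \<open>2^k\<close> into \<open>2^(k+1)\<close>, which weighs
  at most twice as much. The induction does this one base 4 digit at a time.\<close>

lemma wgt_subadd: "wgt (m + n) \<le> wgt m + wgt n"
proof (induction m arbitrary: n rule: less_induct)
  case (less m)
  show ?case
  proof (cases "m = 0")
    case False
    define a s b r where "a = m div 4" and "s = m mod 4" and "b = n div 4" and "r = n mod 4"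
    have m: "m = 4 * a + s" and s: "s < 4" and n: "n = 4 * b + r" and r: "r < 4"
      by (simp_all add: a_def s_def b_def r_def)
    have am: "a < m" using False by (simp add: a_def)
    have ab: "wgt (a + b) \<le> wgt a + wgt b" by (rule less.IH[OF am])
    have ab1: "wgt (a + (b + 1)) \<le> wgt a + wgt (b + 1)" by (rule less.IH[OF am])
    have b1: "wgt (b + 1) \<le> wgt b + 1" using wgt_Suc[of b] by (simp add: add.commute)
    have mn: "m + n = 4 * (a + b) + (s + r)" using m n by simp
    show ?thesis
    proof (cases "s + r < 4")
      case True
      have "wgt (s + r) \<le> wgt s + wgt r"
        using less4_cases[OF s] less4_cases[OF r] True by (elim disjE) simp_all
      thus ?thesis
        using wgt_digit[OF True, of "a + b", folded mn] wgt_digit[OF s, of a, folded m] wgt_digit[OF r, of b, folded n] ab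
        by linarith
    next
      case False
      hence sr: "s + r - 4 < 4" "m + n = 4 * (a + (b + 1)) + (s + r - 4)" using s r mn by simp_all
      \<comment> \<open>A carry removes 4 from this digit and adds 1 to the next one, where it
        counts twice.\<close>
      have "2 + wgt (s + r - 4) \<le> wgt s + wgt r"
        using less4_cases[OF s] less4_cases[OF r] False by (elim disjE) (simp_all)
      thus ?thesis
        using wgt_digit[OF sr(1), of "a + (b + 1)", folded sr(2)] wgt_digit[OF s, of a, folded m]
          wgt_digit[OF r, of b, folded n] ab1 b1
        by linarith
    qed
  qed simp
qed

definition wt :: "nat \<Rightarrow> nat" where "wt K = 2 ^ (K div 2)"

lemma wt_pos: "wt K > 0" by (simp add: wt_def)

lemma wt_Suc_Suc: "wt (Suc (Suc K)) = 2 * wt K"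
  by (simp add: wt_def)

lemma wt_mono: "j \<le> k \<Longrightarrow> wt j \<le> wt k"
  unfolding wt_def by (intro power_increasing div_le_mono) auto

lemma wgt_top: "n < 2 ^ K \<Longrightarrow> wgt (2 ^ K + n) = wt K + wgt n"
proof (induction K arbitrary: n rule: less_induct)
  case (less K)
  consider "K = 0" | "K = 1" | J where "K = Suc (Suc J)"
    by (metis One_nat_def not0_implies_Suc)
  thus ?case
  proof cases
    case 2
    hence "n = 0 \<or> n = 1" using less.prems by auto
    thus ?thesis using 2 by (auto simp: wt_def numeral_2_eq_2[symmetric] eval_nat_numeral(3)[symmetric])
  next
    case 3
    define a s where "a = n div 4" and "s = n mod 4"
    have n: "n = 4 * a + s" and s: "s < 4" by (simp_all add: a_def s_def)
    have a: "a < 2 ^ J" using less.prems 3 n by simp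
    have "2 ^ K + n = 4 * (2 ^ J + a) + s" using 3 n by simp
    thus ?thesis using wgt_digit[OF s, of "2 ^ J + a"] wgt_digit[OF s, of a] less.IH[of J a] a 3 n
      by (simp add: wt_Suc_Suc add.assoc)
  qed (use less.prems in \<open>simp add: wt_def\<close>)
qed

lemma wgt_pow: "wgt (2 ^ K) = wt K"
  using wgt_top[of 0 K] by simp

text \<open>To reach \<open>2^K\<close> the carry passes at least the positions \<open>k\<close> and
  \<open>k + 1\<close>. Then \<open>2^k\<close>, \<open>2^k\<close> and \<open>2^(k+1)\<close> merge
  into \<open>2^(k+2)\<close> of weight \<open>2 * wt k\<close>, and \<open>wt (k + 1)\<close> is
  lost.\<close>

lemma wgt_carry:
  assumes "k + 2 \<le> K" "m < 2 ^ K" "2 ^ K \<le> m + 2 ^ k"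
  shows "wgt (m + 2 ^ k) + 1 \<le> wgt m + wt k"
  using assms
proof (induction K arbitrary: m)
  case (Suc K)
  have p: "(2::nat) ^ k \<le> 2 ^ K" using Suc.prems(1) by (intro power_increasing) auto
  have mK: "2 ^ K \<le> m" using p Suc.prems(3) unfolding power_Suc by linarith
  define l where "l = m - 2 ^ K"
  have m: "m = 2 ^ K + l" and l: "l < 2 ^ K" using mK Suc.prems(2) by (simp_all add: l_def)
  have cm: "wgt m = wt K + wgt l" using wgt_top[OF l] m by simp
  have lk: "2 ^ K \<le> l + 2 ^ k" using Suc.prems(3) m by simp
  show ?case
  proof (cases "k + 2 \<le> K")
    case True
    have "wgt (m + 2 ^ k) \<le> wt K + wgt (l + 2 ^ k)"
      using wgt_subadd[of "2 ^ K" "l + 2 ^ k"] m by (simp add: wgt_pow add.assoc)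
    thus ?thesis using Suc.IH[OF True l lk] cm by simp
  next
    case False
    hence K: "K = k + 1" using Suc.prems(1) by simp
    define j where "j = l - 2 ^ k"
    have l2: "l = 2 ^ k + j" and j: "j < 2 ^ k" using lk l K by (simp_all add: j_def)
    have "m + 2 ^ k = 2 ^ Suc (Suc k) + j" using m l2 K by simp
    moreover have "j < 2 ^ Suc (Suc k)" using j by simp
    ultimately have "wgt (m + 2 ^ k) = 2 * wt k + wgt j" using wgt_top[of j "Suc (Suc k)"] by (simp add: wt_Suc_Suc)
    moreover have "wgt l = wt k + wgt j" using wgt_top[OF j] l2 by simp
    moreover have "wt K > 0" by (rule wt_pos)
    ultimately show ?thesis using cm by simp
  qed
qed simp

section \<open>Polynomials modulo 2 filtered by degree and weight\<close>

abbreviation XX :: "nat \<Rightarrow> bit poly" where "XX k \<equiv> monom 1 k"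

lemma bpoly_add_self [simp]: "(p::bit poly) + p = 0"
  by (rule poly_eqI) (simp only: coeff_add bit_add_self coeff_0)

lemma bpoly_add_self_left [simp]: "(p::bit poly) + (p + q) = q"
  by (simp add: add.assoc[symmetric])

lemma coeff_XX_mult: "coeff (XX k * p) n = (if k \<le> n then coeff p (n - k) else 0)"
  by (simp add: coeff_monom_mult)

lemma XX_mult: "XX j * XX k = XX (j + k)"
  by (simp add: mult_monom)

definition lin :: "(nat \<Rightarrow> bit poly) \<Rightarrow> bit poly \<Rightarrow> bit poly" where
  "lin t p = (\<Sum>n\<le>degree p. smult (coeff p n) (t n))"

lemma lin_bound: "degree p \<le> N \<Longrightarrow> lin t p = (\<Sum>n\<le>N. smult (coeff p n) (t n))"
  unfolding lin_def by (intro sum.mono_neutral_left) (auto simp: coeff_eq_0)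

lemma lin_add: "lin t (p + q) = lin t p + lin t q"
proof -
  let ?N = "max (degree p) (degree q)"
  have "degree (p + q) \<le> ?N" by (rule degree_add_le) auto
  thus ?thesis using lin_bound[of p ?N t] lin_bound[of q ?N t] lin_bound[of "p + q" ?N t]
    by (simp add: smult_add_left sum.distrib)
qed

lemma lin_XX: "lin t (XX n) = t n"
proof -
  have "lin t (XX n) = (\<Sum>k\<le>n. smult (coeff (XX n) k) (t k))"
    by (rule lin_bound) (simp add: degree_monom_le)
  also have "\<dots> = (\<Sum>k\<in>{n}. smult (coeff (XX n) k) (t k))"
    by (intro sum.mono_neutral_right) auto
  finally show ?thesis by simp
qed

lemma lin_0: "lin t 0 = 0"
  by (simp add: lin_def)

text \<open>Only monomials from the support of \<open>q\<close> are added, so hypotheses about that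
  support remain usable in every step.\<close>

lemma bpoly_induct [case_names zero add]:
  assumes "P 0" "\<And>n p. coeff q n \<noteq> 0 \<Longrightarrow> (\<And>m. coeff p m \<noteq> 0 \<Longrightarrow> coeff q m \<noteq> 0) \<Longrightarrow> P p \<Longrightarrow> P (XX n + p)"
  shows "P (q :: bit poly)"
proof -
  have "P (\<Sum>n\<in>S. XX n)" if "S \<subseteq> {n. coeff q n \<noteq> 0}" for S
  proof -
    have "finite S" using that finite_subset MOST_coeff_eq_0[of q] by (auto simp: eventually_cofinite)
    thus ?thesis using that
    proof (induction S rule: finite_induct)
      case (insert n S)
      have "coeff (\<Sum>n\<in>S. XX n) m = of_bool (m \<in> S)" for m
        using insert.hyps(1) by (simp add: coeff_sum sum.If_cases of_bool_def if_distrib[of "\<lambda>x. x = _"])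
      thus ?case using insert by (auto intro!: assms(2) simp: of_bool_def split: if_splits)
    qed (use assms(1) in simp)
  qed
  from this[of "{n. coeff q n \<noteq> 0}"] have "P (\<Sum>n\<in>{n. coeff q n \<noteq> 0}. XX n)" by simp
  also have "(\<Sum>n\<in>{n. coeff q n \<noteq> 0}. XX n) = q"
  proof (rule poly_eqI)
    fix m
    have "finite {n. coeff q n \<noteq> 0}" using MOST_coeff_eq_0[of q] by (simp add: eventually_cofinite)
    thus "coeff (\<Sum>n\<in>{n. coeff q n \<noteq> 0}. XX n) m = coeff q m"
      by (cases "coeff q m") (auto simp: coeff_sum sum.If_cases)
  qed
  finally show ?thesis .
qed

text \<open>\<open>VF K d\<close> holds for the sums of a polynomial of degree below \<open>2^K\<close> and one of weight below \<open>d\<close>.\<close>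
definition VF :: "nat \<Rightarrow> nat \<Rightarrow> bit poly \<Rightarrow> bool" where
  "VF K d p \<longleftrightarrow> (\<forall>m\<ge>2 ^ K. coeff p m \<noteq> 0 \<longrightarrow> wgt m < d)"

definition Fil :: "nat \<Rightarrow> bit poly \<Rightarrow> bool" where
  "Fil d p \<longleftrightarrow> (\<forall>m. coeff p m \<noteq> 0 \<longrightarrow> wgt m < d)"

abbreviation Vv :: "nat \<Rightarrow> bit poly \<Rightarrow> bool" where "Vv K \<equiv> VF K 0"

lemma VF_add: "VF K d p \<Longrightarrow> VF K d q \<Longrightarrow> VF K d (p + q)"
  unfolding VF_def by (metis add.right_neutral add_0 coeff_add)

lemma Fil_add: "Fil d p \<Longrightarrow> Fil d q \<Longrightarrow> Fil d (p + q)"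
  unfolding Fil_def by (metis add.right_neutral add_0 coeff_add)

lemma VF_0 [simp]: "VF K d 0" by (simp add: VF_def)
lemma Fil_0 [simp]: "Fil d 0" by (simp add: Fil_def)

lemma VF_mono: "VF K d p \<Longrightarrow> K \<le> L \<Longrightarrow> d \<le> e \<Longrightarrow> VF L e p"
  unfolding VF_def by (meson le_trans less_le_trans one_le_numeral power_increasing)

lemma Fil_mono: "Fil d p \<Longrightarrow> d \<le> e \<Longrightarrow> Fil e p"
  unfolding Fil_def by (meson less_le_trans)

lemma Fil_VF: "Fil d p \<Longrightarrow> VF K d p"
  by (simp add: Fil_def VF_def)

lemma lin_closed:
  assumes "P 0" "\<And>p q. P p \<Longrightarrow> P q \<Longrightarrow> P (p + q)" "\<And>n. coeff f n \<noteq> 0 \<Longrightarrow> P (t n)"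
  shows "P (lin t f)"
  by (induction f rule: bpoly_induct) (auto simp: lin_0 lin_add lin_XX assms)

subsection \<open>Socles of pairs of lowering operators\<close>

text \<open>The last two conditions control the terms of top degree in the images of powers of 2, where \<open>star\<close> is propagated from \<open>K - 2\<close> to \<open>K\<close>.\<close>
definition good :: "(nat \<Rightarrow> bit poly) \<Rightarrow> bool" where
  "good t \<longleftrightarrow> (\<forall>n m. coeff (t n) m \<noteq> 0 \<longrightarrow> m < n \<and> wgt m < wgt n) \<and>
    (\<forall>K\<ge>2. \<forall>n<2 ^ K. \<forall>m\<ge>2 ^ K. coeff (t (2 ^ K + n) + XX (2 ^ K) * t n) m \<noteq> 0
        \<longrightarrow> wgt m + 2 \<le> wgt n + wt K) \<and>
    (\<forall>K\<ge>4. Vv (K - 2) (t (2 ^ K) + XX (2 ^ (K - 2)) * t (2 ^ (K - 2)))) \<and> Vv 2 (t 8)"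

lemma good_drop: "good t \<Longrightarrow> coeff (t n) m \<noteq> 0 \<Longrightarrow> m < n \<and> wgt m < wgt n"
  unfolding good_def by blast

lemma good_shift: "good t \<Longrightarrow> 2 \<le> K \<Longrightarrow> n < 2 ^ K \<Longrightarrow> 2 ^ K \<le> m \<Longrightarrow>
    coeff (t (2 ^ K + n) + XX (2 ^ K) * t n) m \<noteq> 0 \<Longrightarrow> wgt m + 2 \<le> wgt n + wt K"
  unfolding good_def by blast

lemma good_step: "good t \<Longrightarrow> 4 \<le> K \<Longrightarrow> Vv (K - 2) (t (2 ^ K) + XX (2 ^ (K - 2)) * t (2 ^ (K - 2)))"
  unfolding good_def by blast

lemma good_8: "good t \<Longrightarrow> Vv 2 (t 8)"
  unfolding good_def by blast

lemma good_Fil: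
  assumes "good t" "Fil (Suc d) f"
  shows "Fil d (lin t f)"
proof (rule lin_closed)
  fix n assume "coeff f n \<noteq> 0"
  hence "wgt n < Suc d" using assms(2) by (simp add: Fil_def)
  thus "Fil d (t n)" using good_drop[OF assms(1)] unfolding Fil_def by (meson less_Suc_eq_le less_le_trans)
qed (auto intro: Fil_add)

lemma good_Vv:
  assumes "good t" "Vv K f"
  shows "Vv K (lin t f)"
proof (rule lin_closed)
  fix n assume "coeff f n \<noteq> 0"
  hence "n < 2 ^ K" using assms(2) by (auto simp: VF_def not_le[symmetric])
  thus "Vv K (t n)" using good_drop[OF assms(1)] unfolding VF_def by (meson le_less_trans not_le less_trans)
qed (auto intro: VF_add)

text \<open>By \<open>good_step\<close> the image is, up to low degree, \<open>x^(2^(J-2))\<close>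
  times a polynomial of degree below \<open>2^(J-2)\<close>; \<open>good_8\<close> supplies the
  start.\<close>

lemma good_pow:
  assumes "good t" "3 \<le> J"
  shows "Vv (J - 1) (t (2 ^ J))"
proof (cases "J = 3")
  case True
  thus ?thesis using good_8[OF assms(1)] by simp
next
  case False
  hence J: "4 \<le> J" using assms(2) by simp
  have "Vv (J - 2) (t (2 ^ J) + XX (2 ^ (J - 2)) * t (2 ^ (J - 2)))"
    using good_step[OF assms(1) J] .
  hence "Vv (J - 1) (t (2 ^ J) + XX (2 ^ (J - 2)) * t (2 ^ (J - 2)))" by (rule VF_mono) auto
  moreover have "Vv (J - 1) (XX (2 ^ (J - 2)) * t (2 ^ (J - 2)))"
    unfolding VF_def
  proof (intro allI impI)
    fix m assume m: "2 ^ (J - 1) \<le> m" and nz: "coeff (XX (2 ^ (J - 2)) * t (2 ^ (J - 2))) m \<noteq> 0"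
    hence "m - 2 ^ (J - 2) < 2 ^ (J - 2)"
      using good_drop[OF assms(1)] by (auto simp: coeff_XX_mult split: if_splits)
    moreover have "(2::nat) ^ (J - 1) = 2 * 2 ^ (J - 2)" using J by (simp flip: power_Suc)
    ultimately show "wgt m < 0" using m by simp
  qed
  ultimately have "Vv (J - 1) ((t (2 ^ J) + XX (2 ^ (J - 2)) * t (2 ^ (J - 2))) + XX (2 ^ (J - 2)) * t (2 ^ (J - 2)))"
    by (rule VF_add)
  thus ?thesis by (simp add: add.assoc)
qed

lemma lin_shift_closed:
  assumes "P 0" "\<And>p q. P p \<Longrightarrow> P q \<Longrightarrow> P (p + q)" "\<And>n. coeff f n \<noteq> 0 \<Longrightarrow> P (t (k + n) + XX k * t n)"
  shows "P (lin t (XX k * f) + XX k * lin t f)"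
proof (induction f rule: bpoly_induct)
  case zero
  show ?case using assms(1) by (simp add: lin_0)
next
  case (add n p)
  have "lin t (XX k * (XX n + p)) + XX k * lin t (XX n + p) =
      (t (k + n) + XX k * t n) + (lin t (XX k * p) + XX k * lin t p)"
    by (simp add: distrib_left lin_add lin_XX XX_mult ac_simps)
  thus ?case using assms(2)[OF assms(3)[OF add(1)] add(3)] by simp
qed

text \<open>The sense in which \<open>t\<close> commutes with \<open>x^(2^K)\<close>: the error has
  low degree or loses two units of weight, one more than \<open>t\<close> is bound to lose.\<close>

lemma good_shift_lin:
  assumes "good t" "2 \<le> K" "Vv K f" "Fil (Suc d) f"
  shows "VF K (d + wt K - 1) (lin t (XX (2 ^ K) * f) + XX (2 ^ K) * lin t f)"
proof (rule lin_shift_closed)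
  fix n assume n: "coeff f n \<noteq> 0"
  hence nK: "n < 2 ^ K" and d: "wgt n < Suc d"
    using assms(3,4) by (auto simp: VF_def Fil_def not_le[symmetric])
  show "VF K (d + wt K - 1) (t (2 ^ K + n) + XX (2 ^ K) * t n)"
    unfolding VF_def
  proof (intro allI impI)
    fix m assume "2 ^ K \<le> m" "coeff (t (2 ^ K + n) + XX (2 ^ K) * t n) m \<noteq> 0"
    from good_shift[OF assms(1,2) nK this] show "wgt m < d + wt K - 1" using d by simp
  qed
qed (auto intro: VF_add)

lemma split_top:
  assumes "Vv (Suc K) f"
  shows "f = poly_cutoff (2 ^ K) f + XX (2 ^ K) * poly_shift (2 ^ K) f"
    and "Vv K (poly_cutoff (2 ^ K) f)" and "Vv K (poly_shift (2 ^ K) f)"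
proof -
  show "f = poly_cutoff (2 ^ K) f + XX (2 ^ K) * poly_shift (2 ^ K) f"
    by (rule poly_eqI) (auto simp: coeff_poly_cutoff coeff_poly_shift coeff_XX_mult)
  show "Vv K (poly_cutoff (2 ^ K) f)" by (simp add: VF_def coeff_poly_cutoff)
  show "Vv K (poly_shift (2 ^ K) f)" using assms by (auto simp: VF_def coeff_poly_shift)
qed

lemma Fil_cutoff: "Fil d f \<Longrightarrow> Fil d (poly_cutoff k f)"
  by (auto simp: Fil_def coeff_poly_cutoff)

lemma Fil_shift:
  assumes "Fil d f" "Vv (Suc K) f"
  shows "Fil (d - wt K) (poly_shift (2 ^ K) f)"
  unfolding Fil_def coeff_poly_shift
proof (intro allI impI)
  fix m assume m: "coeff f (m + 2 ^ K) \<noteq> 0"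
  hence "m < 2 ^ K" using assms(2) by (auto simp: VF_def not_le[symmetric] dest!: spec[of _ "m + 2 ^ K"])
  thus "wgt m < d - wt K" using assms(1) m wgt_top[of m K] by (auto simp: Fil_def add.commute)
qed

lemma Fil_XX_mult: "Fil d f \<Longrightarrow> Fil (d + wt K) (XX (2 ^ K) * f)"
  unfolding Fil_def coeff_XX_mult
proof (intro allI impI)
  fix m assume f: "\<forall>m. coeff f m \<noteq> 0 \<longrightarrow> wgt m < d" and m: "(if 2 ^ K \<le> m then coeff f (m - 2 ^ K) else 0) \<noteq> 0"
  hence "2 ^ K \<le> m" "wgt (m - 2 ^ K) < d" by (auto split: if_splits)
  thus "wgt m < d + wt K" using wgt_subadd[of "2 ^ K" "m - 2 ^ K"] by (simp add: wgt_pow)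
qed

lemma VF_shift_back:
  assumes "VF K d (XX (2 ^ K) * g)" "Vv K g"
  shows "Fil (d - wt K) g"
  unfolding Fil_def
proof (intro allI impI)
  fix n assume n: "coeff g n \<noteq> 0"
  hence nK: "n < 2 ^ K" using assms(2) by (auto simp: VF_def not_le[symmetric])
  have "coeff (XX (2 ^ K) * g) (2 ^ K + n) \<noteq> 0" using n by (simp add: coeff_XX_mult)
  hence "wgt (2 ^ K + n) < d" using assms(1) unfolding VF_def by (meson le_add1)
  thus "wgt n < d - wt K" using wgt_top[OF nK] by simp
qed

lemma Fil_1_const: "Fil 1 f \<Longrightarrow> f = 0 \<or> f = 1"
proof -
  assume f: "Fil 1 f"
  have pos: "wgt n > 0" if "n > 0" for n
    using that
  proof (induction n rule: less_induct)
    case (less n)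
    show ?case
    proof (cases "n < 4")
      case True
      thus ?thesis using less.prems by (subst wgt.simps) auto
    next
      case False
      hence "0 < wgt (n div 4)" by (intro less.IH) auto
      thus ?thesis using False by (subst wgt.simps) simp
    qed
  qed
  have z: "coeff f n = 0" if "n > 0" for n
    using f pos[OF that] unfolding Fil_def by (metis less_one not_less_zero)
  have "f = [:coeff f 0:]" by (rule poly_eqI) (use z in \<open>auto simp: coeff_pCons split: nat.splits\<close>)
  thus ?thesis by (cases "coeff f 0") (simp_all add: one_pCons)
qed

text \<open>In the graded object attached to the weight filtration, only constants are killed by both operators.\<close>
definition socle :: "(nat \<Rightarrow> bit poly) \<Rightarrow> (nat \<Rightarrow> bit poly) \<Rightarrow> nat \<Rightarrow> bool" where
  "socle t u K \<longleftrightarrow> (\<forall>f d. d \<ge> 1 \<longrightarrow> Vv K f \<longrightarrow> Fil (Suc d) f \<longrightarrow>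
     Fil (d - 1) (lin t f) \<longrightarrow> Fil (d - 1) (lin u f) \<longrightarrow> Fil d f)"

text \<open>No polynomial of weight \<open>wt K\<close> with leading term \<open>x^(2^K)\<close> loses weight at least 2 under both operators.\<close>
definition star :: "(nat \<Rightarrow> bit poly) \<Rightarrow> (nat \<Rightarrow> bit poly) \<Rightarrow> nat \<Rightarrow> bool" where
  "star t u K \<longleftrightarrow> (\<forall>f. Vv K f \<longrightarrow> Fil (Suc (wt K)) f \<longrightarrow>
     \<not> (Fil (wt K - 1) (lin t (f + XX (2 ^ K))) \<and> Fil (wt K - 1) (lin u (f + XX (2 ^ K)))))"

lemma Vv_cancel: "VF K d (p + q) \<Longrightarrow> VF K d q \<Longrightarrow> VF K d p"
  using VF_add[of K d "p + q" q] by (simp add: add.assoc)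

lemma Fil_cancel: "Fil d (p + q) \<Longrightarrow> Fil d q \<Longrightarrow> Fil d p"
  using Fil_add[of d "p + q" q] by (simp add: add.assoc)

text \<open>Modulo low degree only \<open>x^(2^K)\<close> times the leading part contributes to
  \<open>lin t f\<close>, and there \<open>t\<close> nearly commutes with \<open>x^(2^K)\<close>; so
  a large weight loss is inherited by the leading part. The term \<open>r\<close> makes room for the
  image of a higher power of 2 in \<open>star_step\<close>.\<close>

lemma top_part:
  assumes t: "good t" and K: "2 \<le> K" and f: "Vv (Suc K) f" "Fil (Suc d) f" "wt K \<le> d"
    and r: "VF K e (lin t f + r)" "VF K e r" "d \<le> Suc e"
  shows "Fil (e - wt K) (lin t (poly_shift (2 ^ K) f))"
proof -
  define f0 f1 where "f0 = poly_cutoff (2 ^ K) f" and "f1 = poly_shift (2 ^ K) f"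
  note sp = split_top[OF f(1), folded f0_def f1_def]
  have Ff1: "Fil (Suc (d - wt K)) f1" using Fil_shift[OF f(2,1)] f(3) by (simp add: f1_def Suc_diff_le)
  have R: "VF K (d - 1) (lin t (XX (2 ^ K) * f1) + XX (2 ^ K) * lin t f1)"
    using good_shift_lin[OF t K sp(3) Ff1] f(3) wt_pos[of K] by simp
  have "VF K e (lin t f)" by (rule Vv_cancel[OF r(1,2)])
  moreover have "lin t f = lin t (XX (2 ^ K) * f1) + lin t f0" by (subst sp(1)) (simp add: lin_add add.commute)
  moreover have "VF K e (lin t f0)" using good_Vv[OF t sp(2)] by (rule VF_mono) auto
  ultimately have "VF K e (lin t (XX (2 ^ K) * f1))" using Vv_cancel by metis
  moreover have "VF K e (XX (2 ^ K) * lin t f1 + lin t (XX (2 ^ K) * f1))"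
    using VF_mono[OF R order_refl, of e] r(3) by (simp add: add.commute)
  ultimately have "VF K e (XX (2 ^ K) * lin t f1)" using Vv_cancel by blast
  thus ?thesis unfolding f1_def[symmetric] using VF_shift_back good_Vv[OF t sp(3)] by blast
qed

text \<open>The hypothesis at \<open>K\<close> is applied twice, first to the leading part
  \<open>f1\<close> and then to \<open>f0\<close>; \<open>star\<close> covers the case where
  \<open>f1\<close> is the constant 1 of critical weight.\<close>

lemma socle_Suc:
  assumes t: "good t" "good u" and K: "2 \<le> K" and S: "socle t u K" and St: "star t u K"
  shows "socle t u (Suc K)"
  unfolding socle_def
proof (intro allI impI)
  fix f d assume d: "1 \<le> d" and f: "Vv (Suc K) f" "Fil (Suc d) f"
    and T: "Fil (d - 1) (lin t f)" "Fil (d - 1) (lin u f)"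
  define f0 f1 where "f0 = poly_cutoff (2 ^ K) f" and "f1 = poly_shift (2 ^ K) f"
  note sp = split_top[OF f(1), folded f0_def f1_def]
  have Ff0: "Fil (Suc d) f0" unfolding f0_def by (rule Fil_cutoff[OF f(2)])
  have Ff1: "Fil (Suc d - wt K) f1" unfolding f1_def by (rule Fil_shift[OF f(2,1)])
  \<comment> \<open>The leading part vanishes if \<open>2^K\<close> alone exceeds the bound
    \<open>d\<close>, and is constant if \<open>2^K\<close> uses it up.\<close>
  consider "f1 = 0" | "wt K = d" "f1 = 1" | "wt K < d"
  proof (cases "d < wt K")
    case True
    hence "Fil 0 f1" using Ff1 by (rule_tac Fil_mono) auto
    hence "f1 = 0" by (intro poly_eqI) (auto simp: Fil_def)
    thus ?thesis using that by blast
  next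
    case False
    hence "wt K = d \<or> wt K < d" by auto
    thus ?thesis using that Fil_1_const[of f1] Ff1 by auto
  qed
  thus "Fil d f"
  proof cases
    case 1
    hence "f = f0" using sp(1) by simp
    thus ?thesis using S sp(2) f(2) T d unfolding socle_def by blast
  next
    case 2
    hence "f = f0 + XX (2 ^ K)" using sp(1) by simp
    thus ?thesis using St sp(2) Ff0 T 2(1) unfolding star_def by blast
  next
    case 3
    have top: "Fil (d - 1 - wt K) (lin s f1)" if "good s" "Fil (d - 1) (lin s f)" for s
      unfolding f1_def
      by (rule top_part[OF that(1) K f, where r = 0]) (use 3 that(2) Fil_VF in auto)
    have "Fil (d - wt K) f1"
      using S[unfolded socle_def, rule_format, of "d - wt K" f1] sp(3) Ff1 3 top[OF t(1) T(1)] top[OF t(2) T(2)]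
      by (simp add: Suc_diff_le diff_right_commute)
    hence F1: "Fil d (XX (2 ^ K) * f1)" using Fil_XX_mult[of "d - wt K" f1 K] 3 by simp
    \<comment> \<open>Since \<open>x^(2^K) f1\<close> has weight below \<open>d\<close>, its image
      is negligible and the weight loss passes to \<open>f0\<close>.\<close>
    have low: "Fil (d - 1) (lin s f0)" if "good s" "Fil (d - 1) (lin s f)" for s
    proof -
      have "Fil (d - 1) (lin s (XX (2 ^ K) * f1))" using good_Fil[OF that(1), of "d - 1"] F1 d by simp
      moreover have "lin s f = lin s f0 + lin s (XX (2 ^ K) * f1)" by (subst sp(1)) (simp add: lin_add)
      ultimately show ?thesis using Fil_cancel that(2) by metis
    qed
    have "Fil d f0"
      using S[unfolded socle_def, rule_format, OF d sp(2) Ff0 low[OF t(1) T(1)] low[OF t(2) T(2)]] .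
    thus ?thesis using F1 sp(1) Fil_add by metis
  qed
qed

text \<open>A violation at \<open>K = J + 2\<close> descends to one at \<open>J\<close>: up to low
  degree the image of \<open>x^(2^K)\<close> is \<open>x^(2^J)\<close> times that of
  \<open>x^(2^J)\<close>, and the common factor can be stripped off, leaving
  \<open>g1 + x^(2^J)\<close>. The intermediate digit \<open>2^(J+1)\<close> is controlled by
  \<open>socle\<close>.\<close>

lemma star_step:
  assumes t: "good t" "good u" and J: "2 \<le> J" and S: "socle t u (Suc J)" and St: "star t u J"
  shows "star t u (Suc (Suc J))"
  unfolding star_def
proof (intro allI impI notI)
  define K where "K = Suc (Suc J)"
  define W where "W = wt K"
  fix f assume "Vv (Suc (Suc J)) f" "Fil (Suc (wt (Suc (Suc J)))) f"
    and "Fil (wt (Suc (Suc J)) - 1) (lin t (f + XX (2 ^ Suc (Suc J)))) \<and>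
      Fil (wt (Suc (Suc J)) - 1) (lin u (f + XX (2 ^ Suc (Suc J))))"
  hence f: "Vv (Suc (Suc J)) f" "Fil (Suc W) f" and
    T: "Fil (W - 1) (lin t (f + XX (2 ^ K)))" "Fil (W - 1) (lin u (f + XX (2 ^ K)))"
    by (simp_all add: K_def W_def)
  have W: "W = 2 * wt J" by (simp add: W_def K_def wt_Suc_Suc)
  have wJ: "wt J > 0" by (rule wt_pos)
  have wSJ: "wt (Suc J) \<le> W" unfolding W_def K_def by (rule wt_mono) simp
  define h0 h1 where "h0 = poly_cutoff (2 ^ Suc J) f" and "h1 = poly_shift (2 ^ Suc J) f"
  note sp = split_top[OF f(1), folded h0_def h1_def]
  have Fh1: "Fil (Suc W - wt (Suc J)) h1" unfolding h1_def by (rule Fil_shift[OF f(2,1)])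
  have K2: "K - 2 = J" "4 \<le> K" using J by (auto simp: K_def)
  have r: "Vv (Suc J) (s (2 ^ K))" if "good s" for s
    using good_pow[OF that, of K] J by (simp add: K_def)
  have top: "Fil (W - 1 - wt (Suc J)) (lin s h1)"
    if "good s" "Fil (W - 1) (lin s (f + XX (2 ^ K)))" for s
    unfolding h1_def
  proof (rule top_part[OF that(1) _ f wSJ])
    show "VF (Suc J) (W - 1) (lin s f + s (2 ^ K))"
      using Fil_VF[OF that(2)] by (simp add: lin_add lin_XX)
    show "VF (Suc J) (W - 1) (s (2 ^ K))" using r[OF that(1)] by (rule VF_mono) auto
  qed (use J in auto)
  \<comment> \<open>The cases are \<open>J\<close> even and \<open>J\<close> odd:
    \<open>2^(J+1)\<close> weighs half of \<open>W\<close> or all of it, and in the second case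
    \<open>h1\<close> is constant.\<close>
  have low: "VF J (W - 1) (lin s (XX (2 ^ Suc J) * h1))" if s: "good s" for s
  proof (cases "wt (Suc J) < W")
    case True
    have "Fil (W - wt (Suc J)) h1"
      using S[unfolded socle_def, rule_format, of "W - wt (Suc J)" h1] sp(3) Fh1 True
        top[OF t(1) T(1)] top[OF t(2) T(2)]
      by (simp add: Suc_diff_le diff_right_commute)
    hence "Fil W (XX (2 ^ Suc J) * h1)" using Fil_XX_mult[of "W - wt (Suc J)" h1 "Suc J"] True by simp
    thus ?thesis using good_Fil[OF s, of "W - 1"] W wJ Fil_VF by auto
  next
    case False
    hence "Fil 1 h1" using Fh1 wSJ by simp
    hence "h1 = 0 \<or> h1 = 1" by (rule Fil_1_const)
    moreover have "Vv J (s (2 ^ Suc J))" using good_pow[OF s, of "Suc J"] J by simp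
    ultimately show ?thesis by (auto simp: lin_0 lin_XX intro: VF_mono)
  qed
  define g0 g1 where "g0 = poly_cutoff (2 ^ J) h0" and "g1 = poly_shift (2 ^ J) h0"
  note sq = split_top[OF sp(2), folded g0_def g1_def]
  have Fh0: "Fil (Suc W) h0" unfolding h0_def by (rule Fil_cutoff[OF f(2)])
  have Fg1: "Fil (Suc (wt J)) g1" using Fil_shift[OF Fh0 sp(2)] W by (simp add: g1_def)
  have key: "Fil (wt J - 1) (lin s (g1 + XX (2 ^ J)))"
    if s: "good s" and Ts: "Fil (W - 1) (lin s (f + XX (2 ^ K)))" for s
  proof -
    have e: "lin s (f + XX (2 ^ K)) = lin s g0 + lin s (XX (2 ^ J) * g1)
        + lin s (XX (2 ^ Suc J) * h1) + s (2 ^ K)"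
      by (subst sp(1), subst sq(1)) (simp add: lin_add lin_XX)
    have R: "VF J (W - 1) (lin s (XX (2 ^ J) * g1) + XX (2 ^ J) * lin s g1)"
      using good_shift_lin[OF s J sq(3) Fg1] W by (simp add: mult_2)
    have St: "VF J (W - 1) (s (2 ^ K) + XX (2 ^ J) * s (2 ^ J))"
      using good_step[OF s K2(2)] unfolding K2(1) by (rule VF_mono) auto
    have g0: "VF J (W - 1) (lin s g0)" using good_Vv[OF s sq(2)] by (rule VF_mono) auto
    \<comment> \<open>The error terms are added so that everything cancels except
      \<open>x^(2^J)\<close> times the image sought.\<close>
    have "VF J (W - 1) (lin s (f + XX (2 ^ K)) + (lin s g0 + (lin s (XX (2 ^ Suc J) * h1) +
        ((lin s (XX (2 ^ J) * g1) + XX (2 ^ J) * lin s g1) + (s (2 ^ K) + XX (2 ^ J) * s (2 ^ J))))))"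
      by (intro VF_add Fil_VF[OF Ts] g0 low[OF s] R St)
    moreover have "lin s (f + XX (2 ^ K)) + (lin s g0 + (lin s (XX (2 ^ Suc J) * h1) +
        ((lin s (XX (2 ^ J) * g1) + XX (2 ^ J) * lin s g1) + (s (2 ^ K) + XX (2 ^ J) * s (2 ^ J)))))
      = XX (2 ^ J) * lin s (g1 + XX (2 ^ J))"
      unfolding e by (simp add: lin_add lin_XX distrib_left ac_simps)
    ultimately have "VF J (W - 1) (XX (2 ^ J) * lin s (g1 + XX (2 ^ J)))" by simp
    hence "Fil (W - 1 - wt J) (lin s (g1 + XX (2 ^ J)))"
    proof (rule VF_shift_back)
      have "Vv J (s (2 ^ J))" using good_drop[OF s] unfolding VF_def by (meson leD)
      thus "Vv J (lin s (g1 + XX (2 ^ J)))"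
        using good_Vv[OF s sq(3)] by (simp add: lin_add lin_XX VF_add)
    qed
    thus ?thesis using W by (simp add: diff_right_commute)
  qed
  show False
    using St[unfolded star_def, rule_format, OF sq(3) Fg1] key[OF t(1) T(1)] key[OF t(2) T(2)] by blast
qed

text \<open>\<open>star_step\<close> advances by 2, so \<open>star\<close> is carried at two
  consecutive levels.\<close>

lemma socle_all:
  assumes "good t" "good u" "socle t u 2" "star t u 2" "star t u 3" "2 \<le> K"
  shows "socle t u K"
proof -
  have "socle t u (n + 2) \<and> star t u (n + 2) \<and> star t u (n + 3)" for n
  proof (induction n)
    case (Suc n)
    have "socle t u (Suc (n + 2))" using Suc assms(1,2) by (intro socle_Suc) auto
    moreover have "star t u (Suc (Suc (n + 2)))" using Suc assms(1,2) calculation by (intro star_step) auto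
    ultimately show ?case using Suc by (simp add: numeral_eq_Suc)
  qed (use assms in \<open>simp add: numeral_2_eq_2 numeral_3_eq_3\<close>)
  from this[of "K - 2"] show ?thesis unfolding le_add_diff_inverse2[OF assms(6)] by simp
qed

subsection \<open>The two recursive operators\<close>

text \<open>Row \<open>n\<close> lists the exponents in the image of \<open>x^n\<close> under \<open>T_3\<close> (\<open>T_7\<close>); the recurrences determine all other images.\<close>
definition tab3 :: "nat list list" where
  "tab3 = [[], [0], [], [1], [2], [4], [3], [5], [], [8], [4], [6, 9], [5, 10], [4, 7, 12], [8, 11], [5, 10, 13]]"

definition tab7 :: "nat list list" where
  "tab7 = [[], [], [0], [2], [1], [3], [4], [6], [2], [4], [3, 8], [2, 5, 10], [9], [3, 8, 11], [12],
    [6, 9, 14], [5], [4, 7], [8, 16], [5, 10, 18], [17], [19], [4, 12, 20], [14, 22], [13, 18],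
    [7, 15, 20], [8, 16, 19, 24], [5, 21, 26], [6, 14, 25], [8, 16, 19, 24, 27],
    [4, 12, 15, 20, 28], [6, 14, 17, 25, 30]]"

definition psum :: "nat list \<Rightarrow> bit poly" where
  "psum xs = (\<Sum>k\<leftarrow>xs. XX k)"

text \<open>\<open>T3_G4\<close> in terms of exponents: \<open>G^4\<close> shifts the index of
  \<open>ee\<close> by 4, hence \<open>XX 4\<close> for \<open>G^4\<close> and \<open>XX 16\<close>
  for \<open>G^16\<close>. In the same way \<open>t7\<close> follows \<open>T7_G4\<close>.\<close>

fun t3 :: "nat \<Rightarrow> bit poly" where
  "t3 n = (if n < 16 then psum (tab3 ! n) else XX 4 * t3 (n - 12) + XX 16 * t3 (n - 16))"

fun t7 :: "nat \<Rightarrow> bit poly" where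
  "t7 n = (if n < 32 then psum (tab7 ! n) else XX 8 * t7 (n - 24) + XX 4 * t7 (n - 28) + XX 32 * t7 (n - 32))"

declare t3.simps [simp del] t7.simps [simp del]

lemma coeff_psum: "coeff (psum xs) m = of_bool (odd (count_list xs m))"
  by (induction xs) (auto simp: psum_def)

lemma psum_append: "psum (xs @ ys) = psum xs + psum ys"
  by (simp add: psum_def)

lemma psum_shift: "XX k * psum xs = psum (map ((+) k) xs)"
  by (induction xs) (simp_all add: psum_def distrib_left XX_mult)

lemma psum_nonzero: "coeff (psum xs) m \<noteq> 0 \<Longrightarrow> m \<in> set xs \<and> odd (count_list xs m)"
  by (cases "odd (count_list xs m)") (auto simp: coeff_psum intro: ccontr)

lemma t3_base: "n < 16 \<Longrightarrow> t3 n = psum (tab3 ! n)"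
  by (simp add: t3.simps)

lemma t7_base: "n < 32 \<Longrightarrow> t7 n = psum (tab7 ! n)"
  by (simp add: t7.simps)

text \<open>Frobenius for a linear recurrence: applying it twice doubles all shifts, because the
  cross terms cancel.\<close>

lemma t3_rec: "t3 (16 * 2 ^ i + n) = XX (4 * 2 ^ i) * t3 (4 * 2 ^ i + n) + XX (16 * 2 ^ i) * t3 n"
proof (induction i arbitrary: n)
  case 0
  show ?case by (subst t3.simps) simp
next
  case (Suc i)
  define q :: nat where "q = 2 ^ i"
  note IH = Suc.IH[folded q_def]
  have "t3 (16 * q + (16 * q + n)) = XX (4 * q) * t3 (16 * q + (4 * q + n)) + XX (16 * q) * t3 (16 * q + n)"
    using IH[of "16 * q + n"] by (simp add: add.left_commute)
  also have "\<dots> = XX (8 * q) * t3 (4 * q + (4 * q + n)) + XX (32 * q) * t3 n"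
    unfolding IH distrib_left mult.assoc[symmetric] XX_mult by (simp add: ac_simps)
  finally show ?case by (simp add: q_def)
qed

lemma t7_rec: "t7 (32 * 2 ^ i + n) = XX (8 * 2 ^ i) * t7 (8 * 2 ^ i + n) + XX (4 * 2 ^ i) * t7 (4 * 2 ^ i + n)
    + XX (32 * 2 ^ i) * t7 n"
proof (induction i arbitrary: n)
  case 0
  show ?case by (subst t7.simps) simp
next
  case (Suc i)
  define q :: nat where "q = 2 ^ i"
  note IH = Suc.IH[folded q_def]
  have "t7 (32 * q + (32 * q + n)) = XX (8 * q) * t7 (32 * q + (8 * q + n))
      + XX (4 * q) * t7 (32 * q + (4 * q + n)) + XX (32 * q) * t7 (32 * q + n)"
    using IH[of "32 * q + n"] by (simp add: add.left_commute)
  also have "\<dots> = XX (16 * q) * t7 (8 * q + (8 * q + n)) + XX (8 * q) * t7 (4 * q + (4 * q + n)) + XX (64 * q) * t7 n"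
    unfolding IH distrib_left mult.assoc[symmetric] XX_mult
    by (simp add: add.left_commute[of "4 * q" "8 * q" n] ac_simps)
  finally show ?case by (simp add: q_def)
qed

lemma t3_top: "4 \<le> K \<Longrightarrow> t3 (2 ^ K + n) = XX (2 ^ (K - 2)) * t3 (2 ^ (K - 2) + n) + XX (2 ^ K) * t3 n"
proof -
  assume "4 \<le> K"
  then obtain i where K: "K = i + 4" by (metis le_add_diff_inverse2)
  show ?thesis using t3_rec[of i n] unfolding K by (simp add: power_add mult.commute)
qed

lemma t7_top: "5 \<le> K \<Longrightarrow> t7 (2 ^ K + n) = XX (2 ^ (K - 2)) * t7 (2 ^ (K - 2) + n)
    + XX (2 ^ (K - 3)) * t7 (2 ^ (K - 3) + n) + XX (2 ^ K) * t7 n"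
proof -
  assume "5 \<le> K"
  then obtain i where K: "K = i + 5" by (metis le_add_diff_inverse2)
  show ?thesis using t7_rec[of i n] unfolding K by (simp add: power_add mult.commute)
qed

lemma tab3_drop: "list_all (\<lambda>n. list_all (\<lambda>m. m < n \<and> wgt m < wgt n) (tab3 ! n)) [0..<16]"
  by code_simp

lemma tab7_drop: "list_all (\<lambda>n. list_all (\<lambda>m. m < n \<and> wgt m < wgt n) (tab7 ! n)) [0..<32]"
  by code_simp

text \<open>Concatenating rows adds polynomials modulo 2, so only entries of odd multiplicity
  survive. The check serves those \<open>K\<close> for which \<open>2^K + n\<close> still lies in
  the table.\<close>

definition shift_ok :: "nat list list \<Rightarrow> nat \<Rightarrow> bool" where
  "shift_ok T K = list_all (\<lambda>n. let zs = T ! (2 ^ K + n) @ map ((+) (2 ^ K)) (T ! n) in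
     list_all (\<lambda>m. 2 ^ K \<le> m \<longrightarrow> odd (count_list zs m) \<longrightarrow> wgt m + 2 \<le> wgt n + wt K) zs) [0..<2 ^ K]"

lemma tab_shift: "shift_ok tab3 2" "shift_ok tab3 3" "shift_ok tab7 2" "shift_ok tab7 3" "shift_ok tab7 4"
  by code_simp+

lemma shift_okD:
  assumes "shift_ok T K" "n < 2 ^ K" "2 ^ K \<le> m"
    "coeff (psum (T ! (2 ^ K + n)) + XX (2 ^ K) * psum (T ! n)) m \<noteq> 0"
  shows "wgt m + 2 \<le> wgt n + wt K"
  using assms(1,2,3) psum_nonzero[OF assms(4)[unfolded psum_shift psum_append[symmetric]]]
  unfolding shift_ok_def by (auto simp: list_all_iff Let_def)

text \<open>Since \<open>2 * wt k \<le> wt K\<close>, replacing \<open>2^K\<close> by one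
  \<open>2^k\<close> in the argument and one in front cannot raise the weight.\<close>

lemma drop_bound:
  assumes "k + 2 \<le> K" "l < 2 ^ K" "m < 2 ^ k + l" "wgt m < wgt (2 ^ k + l)"
  shows "m + 2 ^ k < 2 ^ K + l" "wgt (m + 2 ^ k) < wgt (2 ^ K + l)"
proof -
  have "(2::nat) ^ (k + 2) \<le> 2 ^ K" by (rule power_increasing[OF assms(1)]) simp
  thus "m + 2 ^ k < 2 ^ K + l" using assms(3) by simp
  have "2 * wt k \<le> wt K" using wt_mono[OF assms(1)] wt_Suc_Suc[of k] by simp
  thus "wgt (m + 2 ^ k) < wgt (2 ^ K + l)"
    using wgt_top[OF assms(2)] wgt_subadd[of m "2 ^ k"] wgt_subadd[of "2 ^ k" l] assms(4) by (simp add: wgt_pow)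
qed

text \<open>One unit is lost by the operator. The second is lost in a carry past \<open>2^K\<close>,
  which happens either when \<open>2^k\<close> is added to \<open>m\<close> or already when it is
  added to \<open>n\<close>.\<close>

lemma shift_bound:
  assumes "k + 2 \<le> K" "n < 2 ^ K" "m < 2 ^ k + n" "wgt m < wgt (2 ^ k + n)" "2 ^ K \<le> m + 2 ^ k"
  shows "wgt (m + 2 ^ k) + 2 \<le> wgt n + wt K"
proof -
  have w: "2 * wt k \<le> wt K" using wt_mono[OF assms(1)] wt_Suc_Suc[of k] by simp
  show ?thesis
  proof (cases "m < 2 ^ K")
    case True
    from wgt_carry[OF assms(1) this assms(5)] show ?thesis
      using wgt_subadd[of "2 ^ k" n] assms(4) w by (simp add: wgt_pow)
  next
    case False
    hence "2 ^ K \<le> n + 2 ^ k" using assms(3) by simp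
    from wgt_carry[OF assms(1,2) this] show ?thesis
      using wgt_subadd[of m "2 ^ k"] assms(4) w by (simp add: wgt_pow add.commute)
  qed
qed

lemma coeff_bpoly_add: "coeff (p + q) m \<noteq> (0::bit) \<Longrightarrow> coeff p m \<noteq> 0 \<or> coeff q m \<noteq> 0"
  by (metis add.right_neutral coeff_add)

lemma coeff_XX_nonzero: "coeff (XX k * p) m \<noteq> 0 \<Longrightarrow> \<exists>m'. m = m' + k \<and> coeff p m' \<noteq> 0"
  unfolding coeff_XX_mult by (metis le_add_diff_inverse2)

lemma top_bit: "2 ^ L \<le> (n::nat) \<Longrightarrow> \<exists>K l. L \<le> K \<and> n = 2 ^ K + l \<and> l < 2 ^ K"
proof -
  assume n: "2 ^ L \<le> n"
  have "\<exists>K. 2 ^ K \<le> n \<and> n < 2 ^ Suc K"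
  proof -
    have "1 \<le> n" using n one_le_power[of "2::nat" L] by linarith
    thus ?thesis using ex_power_ivl1[of 2 n] by simp
  qed
  then obtain K where K: "2 ^ K \<le> n" "n < 2 ^ Suc K" by blast
  have "(2::nat) ^ L < 2 ^ Suc K" using n K(2) by linarith
  hence "L \<le> K" using power_less_imp_less_exp[of "2::nat" L "Suc K"] by simp
  thus ?thesis using K by (intro exI[of _ K] exI[of _ "n - 2 ^ K"]) auto
qed

lemma drop_induct:
  assumes base: "\<And>n m. n < 2 ^ L \<Longrightarrow> coeff (t n) m \<noteq> 0 \<Longrightarrow> m < n \<and> wgt m < wgt n"
    and step: "\<And>K l m. L \<le> K \<Longrightarrow> l < 2 ^ K \<Longrightarrow> coeff (t (2 ^ K + l)) m \<noteq> 0 \<Longrightarrow>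
      (\<exists>k m'. k + 2 \<le> K \<and> m = m' + 2 ^ k \<and> coeff (t (2 ^ k + l)) m' \<noteq> 0) \<or>
      (\<exists>m'. m = m' + 2 ^ K \<and> coeff (t l) m' \<noteq> 0)"
  shows "coeff (t n) m \<noteq> 0 \<Longrightarrow> m < n \<and> wgt m < wgt n"
proof (induction n arbitrary: m rule: less_induct)
  case (less n)
  show ?case
  proof (cases "n < 2 ^ L")
    case True
    thus ?thesis using base less.prems by blast
  next
    case False
    then obtain K l where K: "L \<le> K" and n: "n = 2 ^ K + l" and l: "l < 2 ^ K" using top_bit[of L n] by auto
    from step[OF K l less.prems[unfolded n]] consider
      (1) k m' where "k + 2 \<le> K" "m = m' + 2 ^ k" "coeff (t (2 ^ k + l)) m' \<noteq> 0"
      | (2) m' where "m = m' + 2 ^ K" "coeff (t l) m' \<noteq> 0" by blast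
    thus ?thesis
    proof cases
      case 1
      have "(2::nat) ^ k < 2 ^ K" using 1(1) by simp
      hence "m' < 2 ^ k + l \<and> wgt m' < wgt (2 ^ k + l)" by (intro less.IH 1(3)) (simp add: n)
      thus ?thesis using drop_bound[OF 1(1) l] 1(2) n by blast
    next
      case 2
      have "m' < l \<and> wgt m' < wgt l" by (intro less.IH 2(2)) (simp add: n)
      thus ?thesis using 2(1) n wgt_top[OF l] wgt_subadd[of m' "2 ^ K"] by (simp add: wgt_pow)
    qed
  qed
qed

lemma t3_drop: "coeff (t3 n) m \<noteq> 0 \<Longrightarrow> m < n \<and> wgt m < wgt n"
proof (rule drop_induct[where L = 4])
  fix n m assume "n < 2 ^ 4" "coeff (t3 n) m \<noteq> 0"
  thus "m < n \<and> wgt m < wgt n"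
    using tab3_drop psum_nonzero[of "tab3 ! n" m] by (auto simp: t3_base list_all_iff simp del: bit_not_zero_iff)
next
  fix K l m assume K: "4 \<le> K" "coeff (t3 (2 ^ K + l)) m \<noteq> (0::bit)"
  from coeff_bpoly_add[OF this(2)[unfolded t3_top[OF this(1)]]]
  show "(\<exists>k m'. k + 2 \<le> K \<and> m = m' + 2 ^ k \<and> coeff (t3 (2 ^ k + l)) m' \<noteq> 0) \<or>
      (\<exists>m'. m = m' + 2 ^ K \<and> coeff (t3 l) m' \<noteq> 0)"
  proof (elim disjE)
    assume "coeff (XX (2 ^ (K - 2)) * t3 (2 ^ (K - 2) + l)) m \<noteq> 0"
    from coeff_XX_nonzero[OF this] have "\<exists>m'. K - 2 + 2 \<le> K \<and> m = m' + 2 ^ (K - 2) \<and> coeff (t3 (2 ^ (K - 2) + l)) m' \<noteq> 0"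
      using K(1) by simp
    thus ?thesis by blast
  qed (blast dest: coeff_XX_nonzero)
qed

lemma t7_drop: "coeff (t7 n) m \<noteq> 0 \<Longrightarrow> m < n \<and> wgt m < wgt n"
proof (rule drop_induct[where L = 5])
  fix n m assume "n < 2 ^ 5" "coeff (t7 n) m \<noteq> 0"
  thus "m < n \<and> wgt m < wgt n"
    using tab7_drop psum_nonzero[of "tab7 ! n" m] by (auto simp: t7_base list_all_iff simp del: bit_not_zero_iff)
next
  fix K l m assume K: "5 \<le> K" "coeff (t7 (2 ^ K + l)) m \<noteq> (0::bit)"
  from coeff_bpoly_add[OF this(2)[unfolded t7_top[OF this(1)]]]
  show "(\<exists>k m'. k + 2 \<le> K \<and> m = m' + 2 ^ k \<and> coeff (t7 (2 ^ k + l)) m' \<noteq> 0) \<or>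
      (\<exists>m'. m = m' + 2 ^ K \<and> coeff (t7 l) m' \<noteq> 0)"
  proof (elim disjE)
    assume "coeff (XX (2 ^ (K - 2)) * t7 (2 ^ (K - 2) + l) + XX (2 ^ (K - 3)) * t7 (2 ^ (K - 3) + l)) m \<noteq> 0"
    from coeff_bpoly_add[OF this] obtain k where k: "k = K - 2 \<or> k = K - 3" "coeff (XX (2 ^ k) * t7 (2 ^ k + l)) m \<noteq> 0"
      by blast
    have "k + 2 \<le> K" using k(1) K(1) by auto
    thus ?thesis using coeff_XX_nonzero[OF k(2)] by blast
  qed (blast dest: coeff_XX_nonzero)
qed

lemma XX_shift_bound:
  assumes "\<And>n m. coeff (t n) m \<noteq> 0 \<Longrightarrow> m < n \<and> wgt m < wgt n"
    and "k + 2 \<le> K" "n < 2 ^ K" "2 ^ K \<le> m" "coeff (XX (2 ^ k) * t (2 ^ k + n)) m \<noteq> 0"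
  shows "wgt m + 2 \<le> wgt n + wt K"
proof -
  obtain m' where "m = m' + 2 ^ k" "coeff (t (2 ^ k + n)) m' \<noteq> 0" using coeff_XX_nonzero[OF assms(5)] by blast
  thus ?thesis using shift_bound[OF assms(2,3)] assms(1,4) by blast
qed

lemma good_t3: "good t3"
  unfolding good_def
proof (intro conjI allI impI)
  fix n m assume "coeff (t3 n) m \<noteq> 0"
  thus "m < n" "wgt m < wgt n" using t3_drop by blast+
next
  fix K n m :: nat
  assume K: "2 \<le> K" and n: "n < 2 ^ K" and m: "2 ^ K \<le> m"
    and nz: "coeff (t3 (2 ^ K + n) + XX (2 ^ K) * t3 n) m \<noteq> 0"
  show "wgt m + 2 \<le> wgt n + wt K"
  proof (cases "4 \<le> K")
    case True
    have "t3 (2 ^ K + n) + XX (2 ^ K) * t3 n = XX (2 ^ (K - 2)) * t3 (2 ^ (K - 2) + n)"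
      unfolding t3_top[OF True] by (simp add: add.assoc)
    hence "coeff (XX (2 ^ (K - 2)) * t3 (2 ^ (K - 2) + n)) m \<noteq> 0" using nz by metis
    moreover have "K - 2 + 2 \<le> K" using K by simp
    ultimately show ?thesis using XX_shift_bound[where t = t3, OF t3_drop _ n m] by blast
  next
    case False
    hence "K = 2 \<or> K = 3" using K by auto
    thus ?thesis
    proof
      assume K: "K = 2"
      show ?thesis using shift_okD[OF tab_shift(1), of n m] n m nz unfolding K by (simp add: t3_base)
    next
      assume K: "K = 3"
      show ?thesis using shift_okD[OF tab_shift(2), of n m] n m nz unfolding K by (simp add: t3_base)
    qed
  qed
next
  fix K :: nat assume "4 \<le> K"
  from t3_top[OF this, of 0] show "Vv (K - 2) (t3 (2 ^ K) + XX (2 ^ (K - 2)) * t3 (2 ^ (K - 2)))"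
    by (simp add: t3_base[of 0] tab3_def psum_def)
next
  show "Vv 2 (t3 8)" by (simp add: t3_base tab3_def psum_def)
qed

lemma good_t7: "good t7"
  unfolding good_def
proof (intro conjI allI impI)
  fix n m assume "coeff (t7 n) m \<noteq> 0"
  thus "m < n" "wgt m < wgt n" using t7_drop by blast+
next
  fix K n m :: nat
  assume K: "2 \<le> K" and n: "n < 2 ^ K" and m: "2 ^ K \<le> m"
    and nz: "coeff (t7 (2 ^ K + n) + XX (2 ^ K) * t7 n) m \<noteq> 0"
  show "wgt m + 2 \<le> wgt n + wt K"
  proof (cases "5 \<le> K")
    case True
    have "t7 (2 ^ K + n) + XX (2 ^ K) * t7 n = XX (2 ^ (K - 2)) * t7 (2 ^ (K - 2) + n) + XX (2 ^ (K - 3)) * t7 (2 ^ (K - 3) + n)"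
      unfolding t7_top[OF True] by (simp add: add.assoc)
    with nz coeff_bpoly_add obtain k where k: "k = K - 2 \<or> k = K - 3" "coeff (XX (2 ^ k) * t7 (2 ^ k + n)) m \<noteq> 0"
      by metis
    have "k + 2 \<le> K" using k(1) True by auto
    from XX_shift_bound[where t = t7, OF t7_drop this n m k(2)] show ?thesis by simp
  next
    case False
    hence "K = 2 \<or> K = 3 \<or> K = 4" using K by auto
    thus ?thesis
    proof (elim disjE)
      assume K: "K = 2"
      show ?thesis using shift_okD[OF tab_shift(3), of n m] n m nz unfolding K by (simp add: t7_base)
    next
      assume K: "K = 3"
      show ?thesis using shift_okD[OF tab_shift(4), of n m] n m nz unfolding K by (simp add: t7_base)
    next
      assume K: "K = 4"
      show ?thesis using shift_okD[OF tab_shift(5), of n m] n m nz unfolding K by (simp add: t7_base)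
    qed
  qed
next
  fix K :: nat assume K: "4 \<le> K"
  show "Vv (K - 2) (t7 (2 ^ K) + XX (2 ^ (K - 2)) * t7 (2 ^ (K - 2)))"
  proof (cases "K = 4")
    case True
    thus ?thesis by (simp add: t7_base tab7_def psum_def XX_mult)
  next
    case False
    hence K5: "5 \<le> K" using K by simp
    have "t7 (2 ^ K) + XX (2 ^ (K - 2)) * t7 (2 ^ (K - 2)) = XX (2 ^ (K - 3)) * t7 (2 ^ (K - 3))"
      using t7_top[OF K5, of 0] by (simp add: t7_base[of 0] tab7_def psum_def add_ac)
    \<comment> \<open>The remaining term is \<open>x^(2^(K-3))\<close> times a polynomial of degree
      below \<open>2^(K-3)\<close>.\<close>
    moreover have "Vv (K - 2) (XX (2 ^ (K - 3)) * t7 (2 ^ (K - 3)))"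
      unfolding VF_def
    proof (intro allI impI)
      fix m assume m: "2 ^ (K - 2) \<le> m" and nz: "coeff (XX (2 ^ (K - 3)) * t7 (2 ^ (K - 3))) m \<noteq> 0"
      obtain m' where "m = m' + 2 ^ (K - 3)" "coeff (t7 (2 ^ (K - 3))) m' \<noteq> 0"
        using coeff_XX_nonzero[OF nz] by blast
      hence "m < 2 * 2 ^ (K - 3)" using t7_drop[of "2 ^ (K - 3)" m'] by simp
      moreover have "Suc (K - 3) = K - 2" using K5 by simp
      hence "(2::nat) * 2 ^ (K - 3) = 2 ^ (K - 2)" by (simp only: power_Suc[symmetric])
      ultimately show "wgt m < 0" using m by simp
    qed
    ultimately show ?thesis by simp
  qed
next
  show "Vv 2 (t7 8)" by (simp add: t7_base tab7_def psum_def VF_def)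
qed

lemma coeff_lin: "degree f \<le> N \<Longrightarrow> coeff (lin t f) m = (\<Sum>n\<le>N. coeff f n * coeff (t n) m)"
  by (simp add: lin_bound coeff_sum)

lemma Vv_degree: "Vv K f \<Longrightarrow> degree f < 2 ^ K"
proof (rule ccontr)
  assume f: "Vv K f" and "\<not> degree f < 2 ^ K"
  hence d: "2 ^ K \<le> degree f" by simp
  have "f \<noteq> 0"
  proof
    assume "f = 0"
    thus False using d by simp
  qed
  hence "coeff f (degree f) \<noteq> 0" by (metis leading_coeff_0_iff)
  thus False using f d unfolding VF_def by blast
qed

lemma Fil_coeff: "Fil d f \<Longrightarrow> d \<le> wgt m \<Longrightarrow> coeff f m = 0"
  unfolding Fil_def by (metis leD)

lemma atMost_3: "{..3} = {0, 1, 2, 3::nat}" and atMost_4: "{..4} = {0, 1, 2, 3, 4::nat}"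
  by auto

lemma small_tables:
  "t3 0 = 0" "t3 (Suc 0) = 1" "t3 2 = 0" "t3 3 = XX 1" "t3 4 = XX 2" "t3 8 = 0"
  "t7 0 = 0" "t7 (Suc 0) = 0" "t7 2 = 1" "t7 3 = XX 2" "t7 4 = XX 1" "t7 8 = XX 2"
  by (simp_all add: t3_base t7_base tab3_def tab7_def psum_def)

text \<open>\<open>t3\<close> sends \<open>x\<close> and \<open>x^3\<close> to \<open>1\<close> and
  \<open>x\<close>, and \<open>t7\<close> sends \<open>x^2\<close> to \<open>1\<close>; these images
  detect every nonconstant coefficient.\<close>

lemma socle_2: "socle t3 t7 2"
  unfolding socle_def
proof (intro allI impI)
  fix f d assume d: "1 \<le> d" and f: "Vv 2 f" "Fil (Suc d) f"
    and T: "Fil (d - 1) (lin t3 f)" "Fil (d - 1) (lin t7 f)"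
  have deg: "degree f \<le> 3" using Vv_degree[OF f(1)] by simp
  note c = coeff_lin[OF deg] atMost_3 small_tables
  have c0: "coeff (lin t3 f) 0 = coeff f 1" "coeff (lin t3 f) 1 = coeff f 3" "coeff (lin t7 f) 0 = coeff f 2"
    by (simp_all add: c)
  have z: "coeff f m = 0" if "m > 3" for m using deg that by (simp add: coeff_eq_0)
  have nz: "coeff f m = 0" if m: "d \<le> wgt m" for m
  proof -
    consider "m = 0" | "m = 1" | "m = 2" | "m = 3" | "m > 3" by linarith
    thus ?thesis
    proof cases
      case 2
      thus ?thesis using Fil_coeff[OF T(1), of 0] d m by (simp add: c0)
    next
      case 3
      thus ?thesis using Fil_coeff[OF T(2), of 0] d m by (simp add: c0)
    next
      case 4
      have "d - 1 \<le> wgt 1" using m 4 by simp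
      from Fil_coeff[OF T(1) this] show ?thesis using c0(2) 4 by simp
    qed (use m d z in auto)
  qed
  show "Fil d f" unfolding Fil_def using nz by (meson not_le)
qed

text \<open>\<open>t3\<close> sends \<open>x^4\<close> to \<open>x^2\<close>, of weight 1, which no
  image of degree at most 3 polynomials can cancel.\<close>

lemma star_2: "star t3 t7 2"
  unfolding star_def
proof (intro allI impI notI)
  fix f assume f: "Vv 2 f" and "Fil (wt 2 - 1) (lin t3 (f + XX (2 ^ 2))) \<and> Fil (wt 2 - 1) (lin t7 (f + XX (2 ^ 2)))"
  hence "Fil 1 (lin t3 (f + XX 4))" by (simp add: wt_def)
  from Fil_coeff[OF this, of 2] have "coeff (lin t3 f) 2 + 1 = 0" by (simp add: lin_add lin_XX small_tables)
  moreover have "degree f \<le> 3" using Vv_degree[OF f] by simp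
  ultimately show False by (simp add: coeff_lin atMost_3 small_tables)
qed

text \<open>The weight bound leaves exponents up to 4. Then \<open>t3\<close> forces the coefficient
  of \<open>x^3\<close> to vanish, while \<open>t7\<close> needs it to cancel the image
  \<open>x^2\<close> of \<open>x^8\<close>.\<close>

lemma star_3: "star t3 t7 3"
  unfolding star_def
proof (intro allI impI notI)
  fix f assume f: "Vv 3 f" "Fil (Suc (wt 3)) f" and
    "Fil (wt 3 - 1) (lin t3 (f + XX (2 ^ 3))) \<and> Fil (wt 3 - 1) (lin t7 (f + XX (2 ^ 3)))"
  hence T: "Fil 1 (lin t3 (f + XX 8))" "Fil 1 (lin t7 (f + XX 8))" and F: "Fil 3 f" by (simp_all add: wt_def)
  have "wgt 5 = 3" "wgt 6 = 3" "wgt 7 = 4" using wgt_digit[of 1 1] wgt_digit[of 2 1] wgt_digit[of 3 1] by simp_all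
  hence z: "coeff f 5 = 0" "coeff f 6 = 0" "coeff f 7 = 0" by (auto intro: Fil_coeff[OF F])
  have deg: "degree f < 8" using Vv_degree[OF f(1)] by simp
  have "degree f \<le> 4"
  proof (rule degree_le, intro allI impI)
    fix i :: nat assume "4 < i"
    hence "i = 5 \<or> i = 6 \<or> i = 7 \<or> 8 \<le> i" by linarith
    thus "coeff f i = 0" using z coeff_eq_0[of f i] deg by auto
  qed
  note c = coeff_lin[OF this] atMost_4 small_tables lin_add lin_XX
  show False using Fil_coeff[OF T(1), of 1] Fil_coeff[OF T(2), of 2] by (simp add: c)
qed

lemma socle_t: "2 \<le> K \<Longrightarrow> socle t3 t7 K"
  by (rule socle_all[OF good_t3 good_t7 socle_2 star_2 star_3])

subsection \<open>The module in terms of polynomials\<close>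

definition ebase :: "nat \<Rightarrow> bit fps" where
  "ebase r = (if r = 0 then D else if r = 1 then dd3 else if r = 2 then G * D\<^sup>2 else G * D ^ 4)"

text \<open>The \<open>D_k\<close> with \<open>k \<equiv> 1, 3, 7, 9 (mod 20)\<close> in increasing order of \<open>k\<close>; see \<open>Dk_index_eq\<close> below.\<close>
definition ee :: "nat \<Rightarrow> bit fps" where
  "ee n = G ^ (4 * (n div 4)) * ebase (n mod 4)"

lemma ee_add: "ee (4 * j + n) = G ^ (4 * j) * ee n"
  by (simp add: ee_def power_add distrib_left mult.assoc)

text \<open>For fixed \<open>f\<close> a sequence in \<open>i\<close> governed by the recurrences;
  four initial values for \<open>T_3\<close> and eight for \<open>T_7\<close> determine it.\<close>

definition win :: "nat \<Rightarrow> bit fps \<Rightarrow> nat \<Rightarrow> bit fps" where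
  "win p f i = Tp p (G ^ i * f)"

definition es :: "nat list \<Rightarrow> bit fps" where
  "es xs = (\<Sum>k\<leftarrow>xs. ee k)"

lemma Tp_ee: "Tp p (ee n) = win p (ebase (n mod 4)) (4 * (n div 4))"
  by (simp add: win_def ee_def)

lemma win3_rec:
  "win 3 f (i + 4) = G * win 3 f (i + 1) + G ^ 4 * win 3 f i"
  "win 3 f (i + 8) = G\<^sup>2 * win 3 f (i + 2) + G ^ 8 * win 3 f i"
  using T3_step[of i f] T3_G2[of "G ^ i * f"]
  by (simp_all add: win_def power_add power2_eq_square ac_simps)

lemma win3_step:
  "win 3 f 4 = G * win 3 f 1 + G ^ 4 * win 3 f 0"
  "win 3 f 8 = G\<^sup>2 * win 3 f 2 + G ^ 8 * win 3 f 0"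
  "win 3 f 9 = G\<^sup>2 * win 3 f 3 + G ^ 8 * win 3 f 1"
  "win 3 f 12 = G * win 3 f 9 + G ^ 4 * win 3 f 8"
  using win3_rec(1)[of f 0] win3_rec(2)[of f 0] win3_rec(2)[of f 1] win3_rec(1)[of f 8]
  by (simp_all flip: numeral_2_eq_2 numeral_3_eq_3)

text \<open>The fourth power of the modular equation has only exponents divisible by 4, where powers
  of \<open>G\<close> act as shifts on \<open>ee\<close>.\<close>

lemma T7_G4: "T7 (G ^ 32 * f) = G ^ 8 * T7 (G ^ 8 * f) + G ^ 4 * T7 (G ^ 4 * f) + G ^ 32 * T7 f"
proof -
  have "dil 7 G ^ 32 = (dil 7 G ^ 8) ^ 4" by (simp flip: power_mult)
  hence "dil 7 G ^ 32 = G ^ 8 * dil 7 G ^ 8 + G ^ 4 * dil 7 G ^ 4 + G ^ 32"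
    unfolding G_modular7 bfps_add_power4 by (simp add: power_mult_distrib flip: power_mult G_modular7)
  hence "(\<Sum>(a, b)\<leftarrow>[(1, G ^ 32), (G ^ 8, G ^ 8), (G ^ 4, G ^ 4), (G ^ 32, 1)]. a * T7 (b * f)) = 0"
    by (intro Tp_relation) (simp_all add: dil_power ac_simps)
  hence "T7 (G ^ 32 * f) + (G ^ 8 * T7 (G ^ 8 * f) + G ^ 4 * T7 (G ^ 4 * f) + G ^ 32 * T7 f) = 0" by (simp add: add.assoc)
  thus ?thesis by (rule bfps_eqI)
qed

lemma win7_rec:
  "win 7 f (i + 8) = G\<^sup>2 * win 7 f (i + 2) + G * win 7 f (i + 1) + G ^ 8 * win 7 f i"
  "win 7 f (i + 16) = G ^ 4 * win 7 f (i + 4) + G\<^sup>2 * win 7 f (i + 2) + G ^ 16 * win 7 f i"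
  using T7_step[of i f] T7_G2[of "G ^ i * f"]
  by (simp_all add: win_def power_add power2_eq_square ac_simps)

lemma win7_step:
  "win 7 f 8 = G\<^sup>2 * win 7 f 2 + G * win 7 f 1 + G ^ 8 * win 7 f 0"
  "win 7 f 10 = G\<^sup>2 * win 7 f 4 + G * win 7 f 3 + G ^ 8 * win 7 f 2"
  "win 7 f 12 = G\<^sup>2 * win 7 f 6 + G * win 7 f 5 + G ^ 8 * win 7 f 4"
  "win 7 f 14 = G\<^sup>2 * win 7 f 8 + G * win 7 f 7 + G ^ 8 * win 7 f 6"
  "win 7 f 16 = G ^ 4 * win 7 f 4 + G\<^sup>2 * win 7 f 2 + G ^ 16 * win 7 f 0"
  "win 7 f 20 = G ^ 4 * win 7 f 8 + G\<^sup>2 * win 7 f 6 + G ^ 16 * win 7 f 4"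
  "win 7 f 24 = G ^ 4 * win 7 f 12 + G\<^sup>2 * win 7 f 10 + G ^ 16 * win 7 f 8"
  "win 7 f 28 = G ^ 4 * win 7 f 16 + G\<^sup>2 * win 7 f 14 + G ^ 16 * win 7 f 12"
  using win7_rec(1)[of f 0] win7_rec(1)[of f 2] win7_rec(1)[of f 4] win7_rec(1)[of f 6]
    win7_rec(2)[of f 0] win7_rec(2)[of f 4] win7_rec(2)[of f 8] win7_rec(2)[of f 12]
  by (simp_all flip: numeral_2_eq_2 numeral_3_eq_3)

lemma D8_dd3: "D ^ 8 = G * dd3"
  by (simp add: G_dd3)

lemma GG: "G ^ i * (G * f) = G ^ Suc i * f"
  by (simp add: ac_simps)

lemma win3_D: "win 3 D 0 = 0" "win 3 D (Suc 0) = D\<^sup>2" "win 3 D 2 = 0" "win 3 D 3 = G * dd3"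
  by (simp_all add: win_def T3_yy_powers T3_GD T3_G2D T3_G3D D8_dd3)

lemma win3_dd3: "win 3 dd3 0 = D" "win 3 dd3 (Suc 0) = 0" "win 3 dd3 2 = 0" "win 3 dd3 3 = dd3\<^sup>2"
  by (simp_all add: win_def T3_dd3 T3_G1dd T3_G2dd T3_G3dd)

lemma win3_GD2: "win 3 (G * D\<^sup>2) 0 = 0" "win 3 (G * D\<^sup>2) (Suc 0) = D ^ 4" "win 3 (G * D\<^sup>2) 2 = G\<^sup>2 * D"
  "win 3 (G * D\<^sup>2) 3 = 0"
  unfolding win_def GG using T3_G1D2 T3_G2D2 T3_G3D2 T3_G4D2 by (simp_all add: eval_nat_numeral)

lemma win3_GD4: "win 3 (G * D ^ 4) 0 = dd3" "win 3 (G * D ^ 4) (Suc 0) = 0" "win 3 (G * D ^ 4) 2 = G ^ 3 * D\<^sup>2"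
  "win 3 (G * D ^ 4) 3 = G * dd3"
  unfolding win_def GG using T3_G1D4 T3_G2D4 T3_G3D4 T3_G4D4 by (simp_all add: eval_nat_numeral)

lemma win7_D: "win 7 D 0 = 0" "win 7 D (Suc 0) = D\<^sup>2" "win 7 D 2 = 0" "win 7 D 3 = G * dd3" "win 7 D 4 = dd3"
  "win 7 D 5 = G ^ 4 * D\<^sup>2" "win 7 D 6 = G ^ 3 * D\<^sup>2" "win 7 D 7 = G ^ 5 * dd3"
  using T7_G7D
  by (simp_all add: win_def T7_yy_powers T7_GD T7_G2D T7_G3D T7_G4D T7_G5D T7_G6D D8_dd3 GG)

lemma win7_dd3: "win 7 dd3 0 = 0" "win 7 dd3 (Suc 0) = 0" "win 7 dd3 2 = G\<^sup>2 * D" "win 7 dd3 3 = G\<^sup>2 * D ^ 4"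
  "win 7 dd3 4 = G * D ^ 4" "win 7 dd3 5 = D ^ 4" "win 7 dd3 6 = G ^ 6 * D" "win 7 dd3 7 = G ^ 5 * D + G ^ 6 * D ^ 4"
  by (simp_all add: win_def T7_dd3)

lemma win7_GD2: "win 7 (G * D\<^sup>2) 0 = D" "win 7 (G * D\<^sup>2) (Suc 0) = D ^ 4" "win 7 (G * D\<^sup>2) 2 = 0"
  "win 7 (G * D\<^sup>2) 3 = 0" "win 7 (G * D\<^sup>2) 4 = G ^ 4 * D" "win 7 (G * D\<^sup>2) 5 = G ^ 3 * D + G ^ 4 * D ^ 4"
  "win 7 (G * D\<^sup>2) 6 = G\<^sup>2 * D + G ^ 3 * D ^ 4" "win 7 (G * D\<^sup>2) 7 = dd3\<^sup>2"
  unfolding win_def GG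
  using T7_G1D2 T7_G2D2(1,2,3,4)[unfolded D16_sq] T7_G3D2 T7_G5D2 T7_G7D2 by (simp_all add: eval_nat_numeral)

lemma win7_GD4: "win 7 (G * D ^ 4) 0 = G * D\<^sup>2" "win 7 (G * D ^ 4) (Suc 0) = D\<^sup>2" "win 7 (G * D ^ 4) 2 = G\<^sup>2 * dd3"
  "win 7 (G * D ^ 4) 3 = G * dd3" "win 7 (G * D ^ 4) 4 = G ^ 5 * D\<^sup>2" "win 7 (G * D ^ 4) 5 = 0"
  "win 7 (G * D ^ 4) 6 = G ^ 3 * D\<^sup>2 + G ^ 6 * dd3" "win 7 (G * D ^ 4) 7 = 0"
  unfolding win_def GG
  using T7_G1D4 T7_G2D4[unfolded D8_dd3] T7_G3D4[unfolded D8_dd3] T7_G5D4 T7_G7D4[unfolded D8_dd3]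
  by (simp_all add: eval_nat_numeral ac_simps)

lemma G3_dd3_sq: "G * (G * (G * (dd3 * dd3))) = G ^ 4 * D + G ^ 5 * D ^ 4"
proof -
  have "G * (G * (G * (dd3 * dd3))) = G * (G\<^sup>2 * dd3\<^sup>2)" by (simp add: power2_eq_square ac_simps)
  thus ?thesis unfolding dd3_sq by (simp add: ring_expand)
qed

lemmas win_values = win3_D win3_dd3 win3_GD2 win3_GD4 win7_D win7_dd3 win7_GD2 win7_GD4

lemma T3_ee:
  "win 3 D 0 = es (tab3 ! 0)" "win 3 dd3 0 = es (tab3 ! 1)"
  "win 3 (G * D\<^sup>2) 0 = es (tab3 ! 2)" "win 3 (G * D ^ 4) 0 = es (tab3 ! 3)"
  "win 3 D 4 = es (tab3 ! 4)" "win 3 dd3 4 = es (tab3 ! 5)"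
  "win 3 (G * D\<^sup>2) 4 = es (tab3 ! 6)" "win 3 (G * D ^ 4) 4 = es (tab3 ! 7)"
  "win 3 D 8 = es (tab3 ! 8)" "win 3 dd3 8 = es (tab3 ! 9)"
  "win 3 (G * D\<^sup>2) 8 = es (tab3 ! 10)" "win 3 (G * D ^ 4) 8 = es (tab3 ! 11)"
  "win 3 D 12 = es (tab3 ! 12)" "win 3 dd3 12 = es (tab3 ! 13)"
  "win 3 (G * D\<^sup>2) 12 = es (tab3 ! 14)" "win 3 (G * D ^ 4) 12 = es (tab3 ! 15)"
  by (simp_all add: win3_step win_values es_def tab3_def ee_def ebase_def)
    (simp_all add: ring_expand G3_dd3_sq)

lemma T7_ee:
  "win 7 D 0 = es (tab7 ! 0)" "win 7 dd3 0 = es (tab7 ! 1)"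
  "win 7 (G * D\<^sup>2) 0 = es (tab7 ! 2)" "win 7 (G * D ^ 4) 0 = es (tab7 ! 3)"
  "win 7 D 4 = es (tab7 ! 4)" "win 7 dd3 4 = es (tab7 ! 5)"
  "win 7 (G * D\<^sup>2) 4 = es (tab7 ! 6)" "win 7 (G * D ^ 4) 4 = es (tab7 ! 7)"
  "win 7 D 8 = es (tab7 ! 8)" "win 7 dd3 8 = es (tab7 ! 9)"
  "win 7 (G * D\<^sup>2) 8 = es (tab7 ! 10)" "win 7 (G * D ^ 4) 8 = es (tab7 ! 11)"
  "win 7 D 12 = es (tab7 ! 12)" "win 7 dd3 12 = es (tab7 ! 13)"
  "win 7 (G * D\<^sup>2) 12 = es (tab7 ! 14)" "win 7 (G * D ^ 4) 12 = es (tab7 ! 15)"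
  "win 7 D 16 = es (tab7 ! 16)" "win 7 dd3 16 = es (tab7 ! 17)"
  "win 7 (G * D\<^sup>2) 16 = es (tab7 ! 18)" "win 7 (G * D ^ 4) 16 = es (tab7 ! 19)"
  "win 7 D 20 = es (tab7 ! 20)" "win 7 dd3 20 = es (tab7 ! 21)"
  "win 7 (G * D\<^sup>2) 20 = es (tab7 ! 22)" "win 7 (G * D ^ 4) 20 = es (tab7 ! 23)"
  "win 7 D 24 = es (tab7 ! 24)" "win 7 dd3 24 = es (tab7 ! 25)"
  "win 7 (G * D\<^sup>2) 24 = es (tab7 ! 26)" "win 7 (G * D ^ 4) 24 = es (tab7 ! 27)"
  "win 7 D 28 = es (tab7 ! 28)" "win 7 dd3 28 = es (tab7 ! 29)"
  "win 7 (G * D\<^sup>2) 28 = es (tab7 ! 30)" "win 7 (G * D ^ 4) 28 = es (tab7 ! 31)"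
  by (simp_all add: win7_step win_values es_def tab7_def ee_def ebase_def)
    (simp_all add: ring_expand G3_dd3_sq)

lemma less16_cases:
  assumes "\<And>r. r < 4 \<Longrightarrow> P r" "\<And>r. r < 4 \<Longrightarrow> P (4 + r)" "\<And>r. r < 4 \<Longrightarrow> P (8 + r)" "\<And>r. r < 4 \<Longrightarrow> P (12 + r)"
    and "(n::nat) < 16"
  shows "P n"
proof -
  have "n < 4 \<or> (\<exists>r<4. n = 4 + r) \<or> (\<exists>r<4. n = 8 + r) \<or> (\<exists>r<4. n = 12 + r)"
    using assms(5) by presburger
  thus ?thesis using assms(1-4) by blast
qed

lemma T3_base: "n < 16 \<Longrightarrow> Tp 3 (ee n) = es (tab3 ! n)"
proof (rule less16_cases[where P = "\<lambda>n. Tp 3 (ee n) = es (tab3 ! n)"])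
qed (auto dest!: less4_cases simp: Tp_ee ebase_def T3_ee)

lemma T7_base: "n < 32 \<Longrightarrow> Tp 7 (ee n) = es (tab7 ! n)"
proof -
  assume n: "n < 32"
  have 1: "Tp 7 (ee n) = es (tab7 ! n)" if "n < 16" for n
    using that by (rule less16_cases[where P = "\<lambda>n. Tp 7 (ee n) = es (tab7 ! n)", rotated -1])
      (auto dest!: less4_cases simp: Tp_ee ebase_def T7_ee)
  have 2: "Tp 7 (ee (16 + n)) = es (tab7 ! (16 + n))" if "n < 16" for n
    using that by (rule less16_cases[where P = "\<lambda>n. Tp 7 (ee (16 + n)) = es (tab7 ! (16 + n))", rotated -1])
      (auto dest!: less4_cases simp: Tp_ee ebase_def T7_ee)
  show ?thesis using 1[of n] 2[of "n - 16"] n by (cases "n < 16") auto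
qed

definition Phi :: "bit poly \<Rightarrow> bit fps" where
  "Phi p = (\<Sum>n\<le>degree p. fps_const (coeff p n) * ee n)"

lemma Phi_bound: "degree p \<le> N \<Longrightarrow> Phi p = (\<Sum>n\<le>N. fps_const (coeff p n) * ee n)"
  unfolding Phi_def by (intro sum.mono_neutral_left) (auto simp: coeff_eq_0)

lemma Phi_add: "Phi (p + q) = Phi p + Phi q"
proof -
  let ?N = "max (degree p) (degree q)"
  have "degree (p + q) \<le> ?N" by (rule degree_add_le) auto
  thus ?thesis using Phi_bound[of p ?N] Phi_bound[of q ?N] Phi_bound[of "p + q" ?N]
    by (simp add: distrib_right sum.distrib flip: fps_const_add)
qed

lemma Phi_0 [simp]: "Phi 0 = 0"
  by (simp add: Phi_def)

lemma Phi_XX: "Phi (XX n) = ee n"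
proof -
  have "Phi (XX n) = (\<Sum>k\<le>n. fps_const (coeff (XX n) k) * ee k)"
    by (rule Phi_bound) (simp add: degree_monom_le)
  also have "\<dots> = (\<Sum>k\<in>{n}. fps_const (coeff (XX n) k) * ee k)"
    by (intro sum.mono_neutral_right) auto
  finally show ?thesis by simp
qed

lemma Phi_1: "Phi 1 = D"
  using Phi_XX[of 0] by (simp add: ee_def ebase_def)

lemma Phi_psum: "Phi (psum xs) = es xs"
  by (induction xs) (simp_all add: psum_def es_def Phi_add Phi_XX)

lemma Phi_XX_mult: "Phi (XX (4 * j) * p) = G ^ (4 * j) * Phi p"
  by (induction p rule: bpoly_induct) (simp_all add: distrib_left Phi_add XX_mult Phi_XX ee_add)

lemma T3_Phi_t3: "Tp 3 (ee n) = Phi (t3 n)"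
proof (induction n rule: less_induct)
  case (less n)
  show ?case
  proof (cases "n < 16")
    case True
    thus ?thesis by (simp add: T3_base t3_base Phi_psum)
  next
    case False
    then obtain m where n: "n = 16 + m" using le_Suc_ex not_less by blast
    have "Tp 3 (ee n) = G ^ 4 * Tp 3 (ee (4 + m)) + G ^ 16 * Tp 3 (ee m)"
      using ee_add[of 4 m] ee_add[of 1 m] T3_G4[of "ee m"] by (simp add: n)
    also have "\<dots> = Phi (XX 4 * t3 (4 + m) + XX 16 * t3 m)"
      using less.IH[of "4 + m"] less.IH[of m] Phi_XX_mult[of 1 "t3 (4 + m)"] Phi_XX_mult[of 4 "t3 m"]
      by (simp add: n Phi_add)
    finally show ?thesis using t3_rec[of 0 m] by (simp add: n)
  qed
qed

lemma T7_Phi_t7: "Tp 7 (ee n) = Phi (t7 n)"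
proof (induction n rule: less_induct)
  case (less n)
  show ?case
  proof (cases "n < 32")
    case True
    thus ?thesis by (simp add: T7_base t7_base Phi_psum)
  next
    case False
    then obtain m where n: "n = 32 + m" using le_Suc_ex not_less by blast
    have "Tp 7 (ee n) = G ^ 8 * Tp 7 (ee (8 + m)) + G ^ 4 * Tp 7 (ee (4 + m)) + G ^ 32 * Tp 7 (ee m)"
      using ee_add[of 8 m] ee_add[of 2 m] ee_add[of 1 m] T7_G4[of "ee m"] by (simp add: n)
    also have "\<dots> = Phi (XX 8 * t7 (8 + m) + XX 4 * t7 (4 + m) + XX 32 * t7 m)"
      using less.IH[of "8 + m"] less.IH[of "4 + m"] less.IH[of m] Phi_XX_mult[of 2 "t7 (8 + m)"]
        Phi_XX_mult[of 1 "t7 (4 + m)"] Phi_XX_mult[of 8 "t7 m"]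
      by (simp add: n Phi_add)
    finally show ?thesis using t7_rec[of 0 m] by (simp add: n)
  qed
qed

lemma T3_Phi: "Tp 3 (Phi p) = Phi (lin t3 p)"
  by (induction p rule: bpoly_induct) (simp_all add: lin_0 lin_add lin_XX Phi_add Phi_XX Tp_add T3_Phi_t3)

lemma T7_Phi: "Tp 7 (Phi p) = Phi (lin t7 p)"
  by (induction p rule: bpoly_induct) (simp_all add: lin_0 lin_add lin_XX Phi_add Phi_XX Tp_add T7_Phi_t7)

definition Dk_index :: "nat \<Rightarrow> nat" where
  "Dk_index n = 20 * (n div 4) + [1, 3, 7, 9] ! (n mod 4)"

lemma Dk_20: "r < 10 \<Longrightarrow> Dk (20 * m + r) = G ^ (4 * m) * Dbase r"
proof (induction m)
  case (Suc m)
  have "Dk (20 * Suc m + r) = G\<^sup>2 * Dk (20 * m + r + 10)" by (subst Dk.simps) (simp add: add.commute)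
  also have "Dk (20 * m + r + 10) = G\<^sup>2 * Dk (20 * m + r)" by (subst Dk.simps) simp
  also have "G\<^sup>2 * (G\<^sup>2 * Dk (20 * m + r)) = G ^ 4 * Dk (20 * m + r)" by (simp add: eval_nat_numeral ac_simps)
  finally show ?case using Suc by (simp add: power_add mult.assoc)
qed (subst Dk.simps, simp)

lemma Dbase_3: "Dbase 3 = dd3"
  unfolding Dbase_def by (simp add: G_nonzero flip: G_dd3)

lemma Dk_index_eq: "Dk (Dk_index n) = ee n"
proof -
  have "[1, 3, 7, 9] ! (n mod 4) < (10::nat)" "Dbase ([1, 3, 7, 9] ! (n mod 4)) = ebase (n mod 4)"
    using Dbase_3 less4_cases[of "n mod 4"] by (auto simp: ebase_def Dbase_def mult.commute)
  thus ?thesis unfolding Dk_index_def ee_def by (simp add: Dk_20 del: Dk.simps)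
qed

lemma Dk_index_mod: "Dk_index n > 0" "Dk_index n mod 20 \<in> {1, 3, 7, 9}"
proof -
  show "Dk_index n > 0" "Dk_index n mod 20 \<in> {1, 3, 7, 9}" using less4_cases[of "n mod 4"] by (auto simp: Dk_index_def)
qed

lemma inj_Dk_index: "inj Dk_index"
proof (rule injI)
  fix m n assume e: "Dk_index m = Dk_index n"
  have b: "[1, 3, 7, 9] ! (m mod 4) < (20::nat)" for m :: nat
    using less4_cases[of "m mod 4"] by auto
  have "Dk_index m div 20 = m div 4" "Dk_index m mod 20 = [1, 3, 7, 9] ! (m mod 4)" for m
    using b[of m] by (simp_all add: Dk_index_def)
  hence "m div 4 = n div 4" and ix: "[1, 3, 7, 9] ! (m mod 4) = ([1, 3, 7, 9] ! (n mod 4) :: nat)"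
    using e by metis+
  moreover have "m mod 4 = n mod 4"
    using ix less4_cases[of "m mod 4"] less4_cases[of "n mod 4"] by auto
  ultimately show "m = n" by (metis div_mult_mod_eq)
qed

lemma Phi_Wa: "Phi p \<in> Wa"
proof -
  have "Phi p = (\<Sum>k\<in>Dk_index ` {..degree p}. fps_const (coeff p (inv_into UNIV Dk_index k)) * Dk k)"
    unfolding sum.reindex[OF inj_on_subset[OF inj_Dk_index subset_UNIV]] Phi_def o_apply Dk_index_eq
    by (simp only: inv_into_f_f[OF inj_Dk_index UNIV_I])
  moreover have "Dk_index ` {..degree p} \<subseteq> {k. k > 0 \<and> k mod 20 \<in> {1, 3, 7, 9}}"
    by (intro image_subsetI CollectI conjI Dk_index_mod)
  ultimately show ?thesis
    unfolding Wa_def by (intro CollectI exI[of _ "Dk_index ` {..degree p}"] exI conjI) auto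
qed

subsection \<open>Duality and faithfulness\<close>

lemma word_funpow: "((\<lambda>g. Tp 3 g) ^^ i) ((Tp 7 ^^ j) (Tp 3 f)) = (Tp 3 ^^ Suc i) ((Tp 7 ^^ j) f)"
proof -
  have "(Tp 7 ^^ j) (Tp 3 f) = Tp 3 ((Tp 7 ^^ j) f)"
    by (induction j) (simp_all add: Tp_commute[of 7 3] coprime_iff_gcd_eq_1 gcd_non_0_nat)
  thus ?thesis by (simp only: funpow_swap1 funpow.simps o_apply)
qed

abbreviation TT :: "nat \<Rightarrow> nat \<Rightarrow> bit fps \<Rightarrow> bit fps" where
  "TT i j f \<equiv> (Tp 3 ^^ i) ((Tp 7 ^^ j) f)"

lemma TT_Suc_3: "TT (Suc i) j f = TT i j (Tp 3 f)"
  by (rule word_funpow[symmetric])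

lemma TT_Suc_7: "TT i (Suc j) f = TT i j (Tp 7 f)"
  by (simp add: funpow_swap1)

lemma TT_add: "TT i j (f + g) = TT i j f + TT i j g"
proof -
  have "(Tp p ^^ k) (f + g) = (Tp p ^^ k) f + (Tp p ^^ k) g" for p k f g
    by (induction k) (simp_all add: Tp_add)
  thus ?thesis by simp
qed

lemma Vv_exists: "\<exists>K\<ge>2. Vv K f"
proof -
  have "degree f < 2 ^ (degree f + 2)" by (rule less_le_trans[OF less_exp]) simp
  hence "Vv (degree f + 2) f" unfolding VF_def by (metis coeff_eq_0 less_le_trans)
  thus ?thesis by (intro exI[of _ "degree f + 2"]) simp
qed

lemma TT_exact:
  assumes "Fil (Suc d) f" "\<not> Fil d f"
  shows "\<exists>i j. i + j = d \<and> TT i j (Phi f) = D"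
  using assms
proof (induction d arbitrary: f)
  case 0
  have "f \<noteq> 0" using 0(2) by (metis Fil_0)
  hence "f = 1" using Fil_1_const[of f] 0(1) by simp
  thus ?case by (simp add: Phi_1)
next
  case (Suc d)
  obtain K where "2 \<le> K" "Vv K f" using Vv_exists by blast
  hence "\<not> (Fil d (lin t3 f) \<and> Fil d (lin t7 f))"
    using socle_t[of K, unfolded socle_def, rule_format, of "Suc d" f] Suc.prems by auto
  moreover have "Fil (Suc d) (lin t3 f)" "Fil (Suc d) (lin t7 f)"
    using good_Fil[OF good_t3 Suc.prems(1)] good_Fil[OF good_t7 Suc.prems(1)] .
  ultimately consider i j where "i + j = d" "TT i j (Phi (lin t3 f)) = D"
    | i j where "i + j = d" "TT i j (Phi (lin t7 f)) = D"
    using Suc.IH[of "lin t3 f"] Suc.IH[of "lin t7 f"] by blast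
  thus ?case
  proof cases
    case (1 i j)
    thus ?thesis by (intro exI[of _ "Suc i"] exI[of _ j]) (simp only: TT_Suc_3 T3_Phi add_Suc)
  next
    case (2 i j)
    thus ?thesis by (intro exI[of _ i] exI[of _ "Suc j"]) (simp only: TT_Suc_7 T7_Phi add_Suc_right)
  qed
qed

text \<open>Truncated subtraction is harmless: \<open>Fil 0\<close> forces \<open>g = 0\<close>, so
  words of length at least \<open>d\<close> annihilate \<open>Phi f\<close>.\<close>

lemma TT_Phi: "Fil d f \<Longrightarrow> \<exists>g. Fil (d - (i + j)) g \<and> TT i j (Phi f) = Phi g"
proof (induction i arbitrary: d f)
  case 0
  show ?case using 0
  proof (induction j arbitrary: d f)
    case (Suc j)
    have "Fil (d - 1) (lin t7 f)"
    proof (cases d)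
      case 0
      thus ?thesis using Suc.prems good_Fil[OF good_t7, of 0 f] Fil_mono[of 0 f 1] by (metis Fil_def One_nat_def diff_0_eq_0 Fil_0 lin_0 poly_eqI coeff_0 not_less_zero)
    qed (use Suc.prems good_Fil[OF good_t7] in simp)
    from Suc.IH[OF this] show ?case by (simp only: TT_Suc_7 T7_Phi) simp
  qed auto
next
  case (Suc i)
  have "Fil (d - 1) (lin t3 f)"
  proof (cases d)
    case 0
    hence "f = 0" using Suc.prems by (intro poly_eqI) (auto simp: Fil_def)
    thus ?thesis by (simp add: lin_0)
  qed (use Suc.prems good_Fil[OF good_t3] in simp)
  from Suc.IH[OF this] show ?case by (simp only: TT_Suc_3 T3_Phi) simp
qed

text \<open>Interleaves binary digits, so that the weight of \<open>inter a b\<close> is \<open>a + b\<close>.\<close>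
function inter :: "nat \<Rightarrow> nat \<Rightarrow> nat" where
  "inter a b = (if a = 0 \<and> b = 0 then 0 else a mod 2 + 2 * (b mod 2) + 4 * inter (a div 2) (b div 2))"

  by auto
termination
proof (relation "measure (\<lambda>(a, b). a + b)")
  fix a b :: nat
  assume "\<not> (a = 0 \<and> b = 0)"
  hence "a div 2 + b div 2 < a + b" by linarith
  thus "((a div 2, b div 2), (a, b)) \<in> measure (\<lambda>(a, b). a + b)" by simp
qed simp

declare inter.simps [simp del]

lemma inter_eq: "inter a b = 4 * inter (a div 2) (b div 2) + (a mod 2 + 2 * (b mod 2))"
  by (subst inter.simps) (auto simp: inter.simps[of 0 0])

lemma wgt_inter: "wgt (inter a b) = a + b"
proof (induction a b rule: inter.induct)
  case (1 a b)
  show ?case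
  proof (cases "a = 0 \<and> b = 0")
    case False
    have "a mod 2 + 2 * (b mod 2) < 4" "wgt (a mod 2 + 2 * (b mod 2)) = a mod 2 + b mod 2"
      using mod2_eq_if[of a] mod2_eq_if[of b] by (auto split: if_splits)
    thus ?thesis using wgt_digit[of "a mod 2 + 2 * (b mod 2)" "inter (a div 2) (b div 2)"] 1[OF False]
      by (simp add: inter_eq[of a b])
  qed (simp add: inter.simps)
qed

lemma inter_inject: "inter a b = inter c d \<Longrightarrow> a = c \<and> b = d"
proof (induction a b arbitrary: c d rule: inter.induct)
  case (1 a b)
  show ?case
  proof (cases "a = 0 \<and> b = 0")
    case True
    have "a + b = c + d" using wgt_inter 1(2) by metis
    thus ?thesis using True by linarith
  next
    case False
    have "r < 2 \<Longrightarrow> t < 2 \<Longrightarrow> r + 2 * t < 4 \<and> (r + 2 * t) mod 2 = r \<and> (r + 2 * t) div 2 = t" for r t :: nat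
      by presburger
    hence s: "x mod 2 + 2 * (y mod 2) < 4" "(x mod 2 + 2 * (y mod 2)) mod 2 = x mod 2"
        "(x mod 2 + 2 * (y mod 2)) div 2 = y mod 2" for x y :: nat
      using mod_less_divisor[OF zero_less_numeral] by blast+
    have "4 * inter (a div 2) (b div 2) + (a mod 2 + 2 * (b mod 2)) = 4 * inter (c div 2) (d div 2) + (c mod 2 + 2 * (d mod 2))"
      using 1(2) inter_eq by metis
    moreover have "4 * x + r = 4 * y + t \<Longrightarrow> r < 4 \<Longrightarrow> t < 4 \<Longrightarrow> x = y \<and> r = t" for x y r t :: nat by presburger
    ultimately have "inter (a div 2) (b div 2) = inter (c div 2) (d div 2)" and r: "a mod 2 + 2 * (b mod 2) = c mod 2 + 2 * (d mod 2)"
      using s(1)[of a b] s(1)[of c d] by blast+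
    hence "a div 2 = c div 2" "b div 2 = d div 2" using 1(1)[OF False] by blast+
    moreover have "a mod 2 = c mod 2" "b mod 2 = d mod 2" using r s(2,3) by metis+
    ultimately show ?thesis by (metis div_mult_mod_eq)
  qed
qed

definition pairs :: "nat \<Rightarrow> (nat \<times> nat) set" where
  "pairs e = {(i, j). i + j \<le> e}"

lemma finite_pairs: "finite (pairs e)"
  by (rule finite_subset[of _ "{..e} \<times> {..e}"]) (auto simp: pairs_def)

text \<open>The values of all functionals at \<open>f\<close>, kept as a subset of
  \<open>pairs e\<close> so that duality becomes a count of subsets.\<close>

definition beta :: "nat \<Rightarrow> bit poly \<Rightarrow> (nat \<times> nat) set" where
  "beta e f = {(i, j) \<in> pairs e. TT i j (Phi f) $ 1 \<noteq> 0}"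

lemma beta_iff: "(i, j) \<in> pairs e \<Longrightarrow> (i, j) \<in> beta e f \<longleftrightarrow> TT i j (Phi f) $ 1 \<noteq> 0"
  by (simp add: beta_def)

definition indp :: "nat set \<Rightarrow> bit poly" where
  "indp A = (\<Sum>n\<in>A. XX n)"

lemma coeff_indp: "finite A \<Longrightarrow> coeff (indp A) m = of_bool (m \<in> A)"
  by (simp add: indp_def coeff_sum sum.If_cases of_bool_def if_distrib[of "\<lambda>x. x = _"])

text \<open>If \<open>d\<close> is the exact weight of \<open>f + g\<close>, \<open>TT_exact\<close>
  gives a word of length \<open>d\<close> taking the sum to \<open>D\<close>. The coefficient of
  \<open>D\<close> at \<open>x\<close> is 1, so this functional separates \<open>f\<close> from
  \<open>g\<close>.\<close>

lemma beta_inj: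
  assumes "Fil (Suc e) f" "Fil (Suc e) g" "beta e f = beta e g"
  shows "f = g"
proof (rule ccontr)
  assume "f \<noteq> g"
  hence nz: "f + g \<noteq> 0" by (metis add.right_neutral bpoly_add_self_left)
  have "coeff (f + g) (degree (f + g)) \<noteq> 0" using nz by (metis leading_coeff_0_iff)
  hence "\<not> Fil 0 (f + g)" unfolding Fil_def by blast
  moreover have "Fil (Suc e) (f + g)" using assms(1,2) by (rule Fil_add)
  ultimately obtain d where d: "d < Suc e" "\<not> Fil d (f + g)" "Fil (Suc d) (f + g)"
    using ex_least_nat_less[of "\<lambda>d. Fil d (f + g)" "Suc e"] by auto
  obtain i j where ij: "i + j = d" "TT i j (Phi (f + g)) = D" using TT_exact[OF d(3,2)] by blast
  have "(i, j) \<in> pairs e" using ij(1) d(1) by (simp add: pairs_def)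
  from beta_iff[OF this, of f] beta_iff[OF this, of g]
  have "TT i j (Phi f) $ 1 = TT i j (Phi g) $ 1"
    unfolding assms(3) by (cases "TT i j (Phi f) $ 1"; cases "TT i j (Phi g) $ 1") auto
  hence "TT i j (Phi (f + g)) $ 1 = 0" by (simp add: Phi_add TT_add)
  thus False using ij(2) D_nth1 by simp
qed

text \<open>The supports are restricted to the finite set \<open>C\<close> of interleaved pairs;
  then \<open>beta\<close> is an injection between families of equally many subsets.\<close>

lemma beta_surj:
  assumes "S \<subseteq> pairs e"
  shows "\<exists>f. Fil (Suc e) f \<and> beta e f = S"
proof -
  define C where "C = (\<lambda>(a, b). inter a b) ` pairs e"
  have C: "finite C" unfolding C_def using finite_pairs by blast
  have "inj_on (\<lambda>(a, b). inter a b) (pairs e)" by (intro inj_onI) (auto dest: inter_inject)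
  hence card: "card C = card (pairs e)" unfolding C_def by (rule card_image)
  have fil: "Fil (Suc e) (indp A)" if "A \<subseteq> C" for A
    unfolding Fil_def
  proof (intro allI impI)
    fix m assume "coeff (indp A) m \<noteq> 0"
    hence "m \<in> C" using that coeff_indp[OF finite_subset[OF that C], of m] by (cases "m \<in> A") auto
    thus "wgt m < Suc e" by (auto simp: C_def pairs_def wgt_inter)
  qed
  have "inj_on (\<lambda>A. beta e (indp A)) (Pow C)"
  proof (rule inj_onI)
    fix A B assume AB: "A \<in> Pow C" "B \<in> Pow C" "beta e (indp A) = beta e (indp B)"
    hence "indp A = indp B" by (intro beta_inj[of e] fil) auto
    hence "of_bool (m \<in> A) = (of_bool (m \<in> B) :: bit)" for m
      using coeff_indp[of A m] coeff_indp[of B m] AB(1,2) finite_subset[OF _ C] by simp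
    hence "m \<in> A \<longleftrightarrow> m \<in> B" for m by (metis of_bool_eq_iff)
    thus "A = B" by blast
  qed
  hence "card ((\<lambda>A. beta e (indp A)) ` Pow C) = card (Pow (pairs e))"
    using card by (simp add: card_image card_Pow C finite_pairs)
  moreover have "(\<lambda>A. beta e (indp A)) ` Pow C \<subseteq> Pow (pairs e)" by (auto simp: beta_def)
  ultimately have "(\<lambda>A. beta e (indp A)) ` Pow C = Pow (pairs e)"
    using finite_pairs by (intro card_subset_eq) auto
  hence "S \<in> (\<lambda>A. beta e (indp A)) ` Pow C" using assms by simp
  thus ?thesis using fil by blast
qed

theorem theorem5p14:
  fixes P :: "bit fps fps"
  assumes "\<forall>f \<in> Wa. act P f = 0"
  shows "P = 0"
proof (rule ccontr)
  define c where "c = (\<lambda>i j. fps_nth (fps_nth P j) i)"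
  assume "P \<noteq> 0"
  then obtain i' j' where "c i' j' \<noteq> 0" unfolding c_def by (metis fps_ext fps_zero_nth)
  hence ex: "\<exists>e i j. i + j = e \<and> c i j \<noteq> 0" by blast
  define e where "e = (LEAST e. \<exists>i j. i + j = e \<and> c i j \<noteq> 0)"
  obtain i0 j0 where ij0: "i0 + j0 = e" "c i0 j0 \<noteq> 0" using LeastI_ex[OF ex] unfolding e_def by blast
  have below: "c i j = 0" if "i + j < e" for i j
    using not_less_Least[of "i + j" "\<lambda>e. \<exists>i j. i + j = e \<and> c i j \<noteq> 0"] that unfolding e_def by blast
  obtain f where f: "Fil (Suc e) f" "beta e f = {(i0, j0)}"
    using beta_surj[of "{(i0, j0)}" e] ij0(1) by (auto simp: pairs_def)
  \<comment> \<open>Words of length \<open>e\<close> lead to 0 or \<open>D\<close>, and the choice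
    of \<open>f\<close> admits \<open>D\<close> only at \<open>(i0, j0)\<close>.\<close>
  have top: "TT i j (Phi f) = (if (i, j) = (i0, j0) then D else 0)" if "e \<le> i + j" for i j
  proof (cases "i + j = e")
    case True
    obtain g where "Fil 1 g" and g: "TT i j (Phi f) = Phi g" using TT_Phi[OF f(1), of i j] True by auto
    hence "g = 0 \<or> g = 1" by (intro Fil_1_const)
    hence "TT i j (Phi f) = 0 \<or> TT i j (Phi f) = D" using g Phi_1 by auto
    moreover have "TT i j (Phi f) $ 1 \<noteq> 0 \<longleftrightarrow> (i, j) = (i0, j0)"
      using beta_iff[of i j e f] True unfolding f(2) by (simp add: pairs_def)
    ultimately show ?thesis using D_nth1 by auto
  next
    case False
    obtain g where g: "Fil (Suc e - (i + j)) g" "TT i j (Phi f) = Phi g" using TT_Phi[OF f(1), of i j] by blast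
    have "g = 0" using g(1) that False by (intro poly_eqI) (auto simp: Fil_def)
    thus ?thesis using g(2) False ij0(1) by auto
  qed
  let ?S = "{(i, j). TT i j (Phi f) \<noteq> 0}"
  \<comment> \<open>Finiteness must be shown because \<open>sum\<close> over an infinite set is 0 by
    convention.\<close>
  have "?S \<subseteq> pairs e" using top ij0(1) by (auto simp: pairs_def split: if_splits) (metis nat_le_linear)
  hence fin: "finite ?S" using finite_pairs finite_subset by blast
  have S0: "(i0, j0) \<in> ?S" using top[of i0 j0] ij0(1) D_nonzero by simp
  have "act P (Phi f) = (\<Sum>(i, j)\<in>?S. fps_const (c i j) * TT i j (Phi f))" by (simp add: act_def c_def)
  \<comment> \<open>Shorter words may act nontrivially on \<open>f\<close>, but their coefficients
    in \<open>P\<close> vanish by minimality of \<open>e\<close>.\<close>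
  also have "\<dots> = (\<Sum>(i, j)\<in>{(i0, j0)}. fps_const (c i j) * TT i j (Phi f))"
  proof (rule sum.mono_neutral_right[OF fin])
    show "{(i0, j0)} \<subseteq> ?S" using S0 by blast
    show "\<forall>x\<in>?S - {(i0, j0)}. (case x of (i, j) \<Rightarrow> fps_const (c i j) * TT i j (Phi f)) = 0"
    proof (intro ballI)
      fix x assume x: "x \<in> ?S - {(i0, j0)}"
      obtain i j where ij: "x = (i, j)" by (cases x)
      have "i + j < e" using x top[of i j] unfolding ij by (auto intro: ccontr)
      thus "(case x of (i, j) \<Rightarrow> fps_const (c i j) * TT i j (Phi f)) = 0" by (simp add: ij below)
    qed
  qed
  also have "\<dots> = D" using top[of i0 j0] ij0 by (simp add: bit_not_zero_iff)
  finally show False using assms Phi_Wa D_nonzero by metis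
qed

end
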